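(* For all integers $n\ge 2$ and $k\ge 0$, $DCell_k$ (with parameter $n$) is $(n+k-4)$-fault Hamiltonian-connected and $(n+k-3)$-fault Hamiltonian.
   Context: DCell: fix an integer $n\ge 2$. $DCell_0=D_0$ is the complete graph $K_n$, and $t_0=n$. For $k\ge 1$, $D_k=DCell_k$ is built from $t_{k-1}+1$ vertex-disjoint copies $D_{k-1}^0,\dots,D_{k-1}^{t_{k-1}}$ of $D_{k-1}$ together with level $k$ edges; $t_k=t_{k-1}(t_{k-1}+1)$. A vertex of $D_{k-1}$ with label $(\alpha_{k-1},\dots,\alpha_0)$, $\alpha_0\in\{0,\dots,n-1\}$, $\alpha_j\in\{0,\dots,t_{j-1}\}$, has $uid_{k-1}=\alpha_0+\sum_{l=1}^{k-1}\alpha_l t_{l-1}\in\{0,\dots,t_{k-1}-1\}$; a vertex of $D_k$ in copy $D_{k-1}^i$ gets label $(i,\alpha_{k-1},\dots,\alpha_0)$. For each pair $a<b$, the vertex with $uid_{k-1}=b-1$ in $D_{k-1}^a$ is joined to the vertex with $uid_{k-1}=a$ in $D_{k-1}^b$. A graph $G$ is $f$-fault Hamiltonian (resp. $f$-fault Hamiltonian-connected) if for every set $F$ of faulty elements (vertices and/or edges of $G$) with $|F|\le f$, the graph $G\setminus F$ has a Hamiltonian cycle (resp. every pair of distinct vertices of $G\setminus F$ is joined by a Hamiltonian path of $G\setminus F$). *)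

theory Defs
  imports Main
begin

fun dc_t :: "nat \<Rightarrow> nat \<Rightarrow> nat" where
  "dc_t n 0 = n"
| "dc_t n (Suc k) = dc_t n k * (dc_t n k + 1)"

(* A vertex label (alpha_k, ..., alpha_0) is the list [alpha_k, ..., alpha_0]. *)
fun dc_verts :: "nat \<Rightarrow> nat \<Rightarrow> nat list set" where
  "dc_verts n 0 = {[a] | a. a < n}"
| "dc_verts n (Suc k) = {i # v | i v. i \<le> dc_t n k \<and> v \<in> dc_verts n k}"

fun dc_uid :: "nat \<Rightarrow> nat list \<Rightarrow> nat" where
  "dc_uid n [] = 0"
| "dc_uid n [a] = a"
| "dc_uid n (a # b # v) = a * dc_t n (length v) + dc_uid n (b # v)"

fun dc_edges :: "nat \<Rightarrow> nat \<Rightarrow> nat list set set" where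
  "dc_edges n 0 = {{[a], [b]} | a b. a < n \<and> b < n \<and> a \<noteq> b}"
| "dc_edges n (Suc k) =
     {{i # u, i # v} | i u v. i \<le> dc_t n k \<and> {u, v} \<in> dc_edges n k}
   \<union> {{a # u, b # v} | a b u v. a < b \<and> b \<le> dc_t n k \<and>
          u \<in> dc_verts n k \<and> v \<in> dc_verts n k \<and>
          dc_uid n u = b - 1 \<and> dc_uid n v = a}"

definition del_verts :: "'a set \<Rightarrow> 'a set \<Rightarrow> 'a set" where
  "del_verts V FV = V - FV"

definition del_edges :: "'a set set \<Rightarrow> 'a set \<Rightarrow> 'a set set \<Rightarrow> 'a set set" where
  "del_edges E FV FE = {e \<in> E - FE. e \<inter> FV = {}}"

definition is_path :: "'a set set \<Rightarrow> 'a list \<Rightarrow> bool" where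
  "is_path E p \<longleftrightarrow> (\<forall>i. Suc i < length p \<longrightarrow> {p ! i, p ! Suc i} \<in> E)"

definition hamiltonian_cycle :: "'a set \<Rightarrow> 'a set set \<Rightarrow> 'a list \<Rightarrow> bool" where
  "hamiltonian_cycle V E c \<longleftrightarrow>
     length c \<ge> 3 \<and> distinct c \<and> set c = V \<and> is_path E c \<and> {last c, hd c} \<in> E"

definition hamiltonian :: "'a set \<Rightarrow> 'a set set \<Rightarrow> bool" where
  "hamiltonian V E \<longleftrightarrow> (\<exists>c. hamiltonian_cycle V E c)"

definition hamiltonian_path :: "'a set \<Rightarrow> 'a set set \<Rightarrow> 'a \<Rightarrow> 'a \<Rightarrow> 'a list \<Rightarrow> bool" where
  "hamiltonian_path V E u v p \<longleftrightarrow>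
     p \<noteq> [] \<and> hd p = u \<and> last p = v \<and> distinct p \<and> set p = V \<and> is_path E p"

definition hamiltonian_connected :: "'a set \<Rightarrow> 'a set set \<Rightarrow> bool" where
  "hamiltonian_connected V E \<longleftrightarrow>
     (\<forall>u\<in>V. \<forall>v\<in>V. u \<noteq> v \<longrightarrow> (\<exists>p. hamiltonian_path V E u v p))"

(* f may be negative (then the condition is vacuous) *)
definition fault_hamiltonian :: "int \<Rightarrow> 'a set \<Rightarrow> 'a set set \<Rightarrow> bool" where
  "fault_hamiltonian f V E \<longleftrightarrow>
     (\<forall>FV FE. FV \<subseteq> V \<longrightarrow> FE \<subseteq> E \<longrightarrow> int (card FV + card FE) \<le> f \<longrightarrow>
        hamiltonian (del_verts V FV) (del_edges E FV FE))"

definition fault_hamiltonian_connected :: "int \<Rightarrow> 'a set \<Rightarrow> 'a set set \<Rightarrow> bool" where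
  "fault_hamiltonian_connected f V E \<longleftrightarrow>
     (\<forall>FV FE. FV \<subseteq> V \<longrightarrow> FE \<subseteq> E \<longrightarrow> int (card FV + card FE) \<le> f \<longrightarrow>
        hamiltonian_connected (del_verts V FV) (del_edges E FV FE))"

end

(*
  Induction on k.  DCell_(k+1) consists of t+1 copies of DCell_k, t = |DCell_k|, and each vertex of a copy has
  exactly one cross edge, leading to another copy, so that contracting the copies yields the complete graph
  K_(t+1).  Every fault destroys at most one edge of K_(t+1).  If every copy has at most f faults (f = n+k-4), a
  Hamiltonian path or cycle of K_(t+1) minus few edges is lifted: inside each copy it is completed by a
  Hamiltonian path between the two ports, which differ.  The end vertices u, v of the path must not be the ports
  used first and last, which forbids one further edge at either end of the path in K_(t+1).  If some copy has more
  than f faults, almost all faults are in it; this copy still has a Hamiltonian cycle, or a path of it breaks into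
  two pieces at one fault, and the gap is closed by a detour through all other copies.  The inductive step needs
  f >= 0; it starts from complete graphs, from DCell_1 with n = 3 and from DCell_2 with n = 2, the last two being
  checked by explicit paths.
*)
theory Submission
  imports Defs
begin

text \<open>The counts are tight. For \<open>k = 0\<close> there are exactly \<open>f + 5\<close>
  copies, and a complete graph on m vertices stays Hamiltonian-connected after the loss of any m - 4
  edges, but in general not of m - 3. The f + 1 bad edges already exhaust this budget, so the edges
  forbidden at the two ends must come for free. They do, because a bad edge at an end of the path
  can be exempted from the count. The exception is a common forbidden neighbour \<open>x = y\<close>
  at which the other bad edges may be concentrated; then the path leaves its first copy at once and
  returns to the rest of it later. For this a copy must tolerate one deleted vertex even if f = 0,
  which is the origin of the hypothesis \<open>vd\<close>: for f = 0 it is checked for K_4, while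
  the two other cells have at least f + 7 vertices, which leaves room for a direct argument. The two
  exceptional base graphs have 12 and 42 vertices. Instead of listing a path for every pair of
  vertices, they are certified by Posa rotations of a few Hamiltonian cycles: each rotation keeps
  one end of a Hamiltonian path and moves the other.\<close>

lemma is_path_Nil [simp]: "is_path E []"
  and is_path_single [simp]: "is_path E [x]"
  by (simp_all add: is_path_def)

lemma is_path_Cons2 [simp]: "is_path E (x # y # p) \<longleftrightarrow> {x, y} \<in> E \<and> is_path E (y # p)"
  unfolding is_path_def by (auto simp: less_Suc_eq_0_disj nth_Cons' split: if_splits)

lemma is_path_append:
  "p \<noteq> [] \<Longrightarrow> q \<noteq> [] \<Longrightarrow>
    is_path E (p @ q) \<longleftrightarrow> is_path E p \<and> {last p, hd q} \<in> E \<and> is_path E q"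
proof (induction p)
  case (Cons x p)
  then show ?case by (cases p; cases q) auto
qed simp

lemma is_path_rev [simp]: "is_path E (rev p) \<longleftrightarrow> is_path E p"
proof (induction p)
  case (Cons x p)
  then show ?case
    by (cases "p = []") (auto simp: is_path_append last_rev insert_commute neq_Nil_conv)
qed simp

lemma is_path_mono: "is_path E p \<Longrightarrow> (\<And>e. e \<in> E \<Longrightarrow> e \<subseteq> set p \<Longrightarrow> e \<in> E') \<Longrightarrow> is_path E' p"
  unfolding is_path_def by (metis Suc_lessD empty_subsetI insert_subset nth_mem)

lemma is_path_edge: "is_path E p \<Longrightarrow> p = q @ x # y # r \<Longrightarrow> {x, y} \<in> E"
  by (cases "q = []") (auto simp: is_path_append)

lemma is_path_Diff:
  "is_path E p \<Longrightarrow> (\<And>q x y r. p = q @ x # y # r \<Longrightarrow> {x, y} \<noteq> e) \<Longrightarrow> is_path (E - {e}) p"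
proof (induction p rule: induct_list012)
  case (3 x y zs)
  have "{x, y} \<noteq> e" using "3.prems"(2)[of "[]"] by simp
  moreover have "is_path (E - {e}) (y # zs)"
  proof (rule "3.IH"(2))
    show "is_path E (y # zs)" using 3 by simp
  next
    fix q x' y' r assume "y # zs = q @ x' # y' # r"
    then show "{x', y'} \<noteq> e" using "3.prems"(2)[of "x # q"] by simp
  qed
  ultimately show ?case using "3.prems"(1) by simp
qed auto

section \<open>Hamiltonian paths as a relation, and the places where they can be cut\<close>

definition joins :: "'a set set \<Rightarrow> 'a set \<Rightarrow> 'a \<Rightarrow> 'a \<Rightarrow> bool" where
  "joins E W u v \<longleftrightarrow> (\<exists>p. hamiltonian_path W E u v p)"

lemma joins_single [simp]: "joins E {u} v w \<longleftrightarrow> v = u \<and> w = u"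
proof
  assume "v = u \<and> w = u"
  then have "hamiltonian_path {u} E v w [u]" by (simp add: hamiltonian_path_def)
  then show "joins E {u} v w" unfolding joins_def by blast
next
  assume "joins E {u} v w"
  then show "v = u \<and> w = u"
    unfolding joins_def hamiltonian_path_def by (metis hd_in_set last_in_set singletonD)
qed

lemma joins_append:
  assumes "joins E A a b" "{b, c} \<in> E" "joins E B c d" "A \<inter> B = {}"
  shows "joins E (A \<union> B) a d"
proof -
  obtain p q where "hamiltonian_path A E a b p" "hamiltonian_path B E c d q"
    using assms(1,3) unfolding joins_def by blast
  then have "hamiltonian_path (A \<union> B) E a d (p @ q)"
    using assms(2,4) by (auto simp: hamiltonian_path_def is_path_append)
  then show ?thesis unfolding joins_def by blast
qed

lemma joins_Cons:
  assumes "{a, c} \<in> E" "joins E (W - {a}) c d" "a \<in> W"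
  shows "joins E W a d"
  using joins_append[of E "{a}" a a c "W - {a}" d] assms by (simp add: insert_absorb)

lemma joins_rev: "joins E W u v \<Longrightarrow> joins E W v u"
proof -
  have "hamiltonian_path W E v u (rev p)" if "hamiltonian_path W E u v p" for p
    using that by (auto simp: hamiltonian_path_def hd_rev last_rev)
  then show "joins E W u v \<Longrightarrow> joins E W v u" unfolding joins_def by blast
qed

lemma joins_mono:
  assumes "joins E W u v" "\<And>e. e \<in> E \<Longrightarrow> e \<subseteq> W \<Longrightarrow> e \<in> E'"
  shows "joins E' W u v"
  using assms is_path_mono unfolding joins_def hamiltonian_path_def by metis

lemma joins_in: "joins E W u v \<Longrightarrow> u \<in> W \<and> v \<in> W"
  unfolding joins_def hamiltonian_path_def by auto

text \<open>The vertices \<open>s\<close> and \<open>s'\<close> bound the gap of a broken path. They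
  need not be adjacent: the gap may come from a removed fault, and it is bridged by a detour outside
  \<open>W\<close>.\<close>

definition splits :: "'a set set \<Rightarrow> 'a set \<Rightarrow> 'a \<Rightarrow> 'a \<Rightarrow> 'a \<Rightarrow> 'a \<Rightarrow> bool" where
  "splits E W u v s s' \<longleftrightarrow>
     (\<exists>A B. A \<union> B = W \<and> A \<inter> B = {} \<and> joins E A u s \<and> joins E B s' v)"

lemma splits_rev:
  assumes "splits E W u v s s'"
  shows "splits E W v u s' s"
proof -
  obtain A B where AB: "A \<union> B = W" "A \<inter> B = {}" "joins E A u s" "joins E B s' v"
    using assms(1) unfolding splits_def by blast
  then have "B \<union> A = W" "B \<inter> A = {}" "joins E B v s'" "joins E A s u" by (auto intro: joins_rev)
  then show ?thesis unfolding splits_def by blast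
qed

lemma splits_in:
  assumes "splits E W u v s s'"
  shows "s \<in> W" "s' \<in> W" "s \<noteq> s'"
proof -
  obtain A B where "A \<union> B = W" "A \<inter> B = {}" "s \<in> A" "s' \<in> B"
    using assms joins_in unfolding splits_def by metis
  then show "s \<in> W" "s' \<in> W" "s \<noteq> s'" by auto
qed

lemma splits_mono:
  assumes "splits E W u v s s'" "\<And>e. e \<in> E \<Longrightarrow> e \<subseteq> W \<Longrightarrow> e \<in> E'"
  shows "splits E' W u v s s'"
proof -
  obtain A B where AB: "A \<union> B = W" "A \<inter> B = {}" "joins E A u s" "joins E B s' v"
    using assms(1) unfolding splits_def by blast
  have "joins E' A u s" by (rule joins_mono[OF AB(3)]) (use AB(1) assms(2) in blast)
  moreover have "joins E' B s' v" by (rule joins_mono[OF AB(4)]) (use AB(1) assms(2) in blast)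
  ultimately show ?thesis unfolding splits_def using AB(1,2) by blast
qed

lemma splits_joins:
  assumes "splits E W u v s s'" "{s, x} \<in> E" "joins E X x y" "{y, s'} \<in> E" "W \<inter> X = {}"
  shows "joins E (W \<union> X) u v"
proof -
  obtain A B where AB: "A \<union> B = W" "A \<inter> B = {}" "joins E A u s" "joins E B s' v"
    using assms(1) unfolding splits_def by blast
  have "joins E (A \<union> X) u y" using joins_append[OF AB(3) assms(2,3)] AB assms(5) by blast
  then have "joins E ((A \<union> X) \<union> B) u v"
    using joins_append[OF _ assms(4) AB(4)] AB assms(5) by blast
  moreover have "(A \<union> X) \<union> B = W \<union> X" using AB(1) by blast
  ultimately show ?thesis by simp
qed

lemma splitsI:
  assumes "hamiltonian_path W E u v (p @ q)" "p \<noteq> []" "q \<noteq> []"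
  shows "splits E W u v (last p) (hd q)"
proof -
  have "hamiltonian_path (set p) E u (last p) p" "hamiltonian_path (set q) E (hd q) v q"
    "set p \<union> set q = W" "set p \<inter> set q = {}"
    using assms by (auto simp: hamiltonian_path_def is_path_append)
  then show ?thesis unfolding splits_def joins_def by blast
qed

lemma joins_split_after:
  assumes "joins E W u v" "s \<in> W" "s \<noteq> v"
  shows "\<exists>s'. splits E W u v s s' \<and> {s, s'} \<in> E"
proof -
  obtain p where p: "hamiltonian_path W E u v p" using assms unfolding joins_def by blast
  then obtain q r where pq: "p = q @ s # r"
    using assms(2) split_list[of s p] by (auto simp: hamiltonian_path_def)
  then have "r \<noteq> []" using p assms(3) by (auto simp: hamiltonian_path_def)
  moreover have "{s, hd r} \<in> E" using p pq \<open>r \<noteq> []\<close> by (cases r) (auto simp: hamiltonian_path_def intro: is_path_edge)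
  ultimately show ?thesis using splitsI[of W E u v "q @ [s]" r] p pq by auto
qed

lemma joins_split_before:
  assumes "joins E W u v" "s \<in> W" "s \<noteq> u"
  shows "\<exists>s'. splits E W u v s' s \<and> {s', s} \<in> E"
  using joins_split_after[OF joins_rev[OF assms(1)] assms(2,3)] splits_rev by (metis insert_commute)

text \<open>The first and the last edge of a path with at least four vertices are disjoint.\<close>

lemma joins_split_avoiding:
  assumes "joins E W u v" "4 \<le> card W"
  shows "\<exists>s s'. splits E W u v s s' \<and> s \<noteq> z \<and> s' \<noteq> z"
proof -
  obtain p where p: "hamiltonian_path W E u v p" using assms unfolding joins_def by blast
  then have "length p \<ge> 4" using assms(2) distinct_card[of p] by (auto simp: hamiltonian_path_def)
  then obtain a b q where p1: "p = a # b # q" "length q \<ge> 2"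
    by (cases p; cases "tl p") auto
  obtain r d where "q = r @ [d]" using p1(2) by (cases q rule: rev_cases) auto
  moreover from this obtain r' c where "r = r' @ [c]" using p1(2) by (cases r rule: rev_cases) auto
  ultimately obtain r c d where q: "q = r @ [c, d]" by simp
  have 1: "splits E W u v a b" using splitsI[of W E u v "[a]" "b # q"] p p1 by simp
  have 2: "splits E W u v c d" using splitsI[of W E u v "a # b # r @ [c]" "[d]"] p p1 q by simp
  have "distinct [a, b, c, d]" using p p1 q by (auto simp: hamiltonian_path_def)
  then show ?thesis using 1 2 by (metis distinct_length_2_or_more)
qed

text \<open>Meant for a path found while the fault \<open>e\<close> was ignored. If the path uses
  \<open>e\<close>, it is cut there; otherwise it avoids \<open>e\<close> and may be cut anywhere,
  for instance after \<open>u\<close>.\<close>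

lemma joins_split_edge:
  assumes "joins E W u v" "u \<noteq> v"
  shows "\<exists>s s'. splits (E - {e}) W u v s s'"
proof -
  obtain p where p: "hamiltonian_path W E u v p" using assms unfolding joins_def by blast
  show ?thesis
  proof (cases "\<exists>q x y r. p = q @ x # y # r \<and> {x, y} = e")
    case True
    then obtain q x y r where q: "p = q @ x # y # r" "{x, y} = e" by blast
    have d: "distinct p" "is_path E p" "p = (q @ [x]) @ (y # r)" using p q by (auto simp: hamiltonian_path_def)
    then have ip: "is_path E (q @ [x])" "is_path E (y # r)" by (metis is_path_append list.discI snoc_eq_iff_butlast)+
    have i: "is_path (E - {e}) (q @ [x])" by (rule is_path_mono[OF ip(1)]) (use d q in auto)
    have j: "is_path (E - {e}) (y # r)" by (rule is_path_mono[OF ip(2)]) (use d q in auto)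
    have "hamiltonian_path (set (q @ [x])) (E - {e}) u x (q @ [x])"
      "hamiltonian_path (set (y # r)) (E - {e}) y v (y # r)"
      using p q i j by (auto simp: hamiltonian_path_def hd_append)
    moreover have "set (q @ [x]) \<union> set (y # r) = W" "set (q @ [x]) \<inter> set (y # r) = {}"
      using p q by (auto simp: hamiltonian_path_def)
    ultimately show ?thesis unfolding splits_def joins_def by blast
  next
    case False
    then have "is_path (E - {e}) p" using p by (intro is_path_Diff) (auto simp: hamiltonian_path_def)
    then have "hamiltonian_path W (E - {e}) u v p" using p by (simp add: hamiltonian_path_def)
    then have "joins (E - {e}) W u v" unfolding joins_def by blast
    then show ?thesis using joins_split_after[of "E - {e}" W u v u] assms(2) joins_in by metis
  qed
qed

text \<open>Counterpart for an ignored faulty vertex: the path runs through \<open>w\<close>, and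
  omitting \<open>w\<close> leaves two pieces, both nonempty because \<open>w\<close> is not an
  end.\<close>

lemma joins_split_vertex:
  assumes "joins E W u v" "w \<in> W" "w \<noteq> u" "w \<noteq> v"
  shows "\<exists>s s'. splits E (W - {w}) u v s s'"
proof -
  obtain p where p: "hamiltonian_path W E u v p" using assms unfolding joins_def by blast
  then obtain q r where pq: "p = q @ w # r"
    using assms(2) split_list[of w p] by (auto simp: hamiltonian_path_def)
  then have ne: "r \<noteq> []" "q \<noteq> []" using p assms(3,4) by (auto simp: hamiltonian_path_def)
  then have "hamiltonian_path (set q) E u (last q) q" "hamiltonian_path (set r) E (hd r) v r"
    using p pq by (auto simp: hamiltonian_path_def is_path_append) (metis is_path_Cons2 list.collapse)
  moreover have "set q \<union> set r = W - {w}" "set q \<inter> set r = {}"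
      using p pq by (auto simp: hamiltonian_path_def)
  ultimately show ?thesis unfolding splits_def joins_def by blast
qed

section \<open>Hamiltonian cycles and the paths obtained by opening them\<close>

lemma hamiltonian_cycle_rotate:
  assumes "hamiltonian_cycle V E (p @ q)"
  shows "hamiltonian_cycle V E (q @ p)"
proof (cases "p = [] \<or> q = []")
  case False
  then show ?thesis using assms by (auto simp: hamiltonian_cycle_def is_path_append)
qed (use assms in auto)

lemma hamiltonian_cycle_joins:
  assumes "hamiltonian_cycle V E c"
  shows "joins E V (hd c) (last c)"
  using assms unfolding joins_def hamiltonian_cycle_def hamiltonian_path_def by (metis list.size(3) not_numeral_le_zero)

lemma hamiltonianI:
  assumes "joins E W u v" "{v, u} \<in> E" "3 \<le> card W"
  shows "hamiltonian W E"
proof -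
  obtain p where p: "hamiltonian_path W E u v p" using assms unfolding joins_def by blast
  then have "hamiltonian_cycle W E p"
    using assms(2,3) distinct_card[of p] by (auto simp: hamiltonian_cycle_def hamiltonian_path_def)
  then show ?thesis unfolding hamiltonian_def by blast
qed

lemma hamiltonian_card: "hamiltonian W E \<Longrightarrow> 3 \<le> card W"
  unfolding hamiltonian_def hamiltonian_cycle_def by (metis distinct_card)

lemma hamiltonian_mono:
  assumes "hamiltonian W E" "\<And>e. e \<in> E \<Longrightarrow> e \<subseteq> W \<Longrightarrow> e \<in> E'"
  shows "hamiltonian W E'"
proof -
  obtain c where c: "hamiltonian_cycle W E c" using assms(1) unfolding hamiltonian_def by blast
  then have "c \<noteq> []" by (auto simp: hamiltonian_cycle_def)
  then have "{last c, hd c} \<subseteq> W" using c by (auto simp: hamiltonian_cycle_def)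
  then have "hamiltonian_cycle W E' c"
    using c assms(2) is_path_mono[of E c E'] unfolding hamiltonian_cycle_def by auto
  then show ?thesis unfolding hamiltonian_def by blast
qed

text \<open>\<open>s\<close> and \<open>s'\<close> are the neighbours of \<open>w\<close> on the
  cycle. Opening the cycle on either side of \<open>w\<close> gives the first two paths, deleting
  \<open>w\<close> the third.\<close>

lemma hamiltonian_two_neighbours:
  assumes "hamiltonian W E" "w \<in> W"
  shows "\<exists>s s'. s \<noteq> s' \<and> s \<noteq> w \<and> s' \<noteq> w \<and> joins E W w s \<and> joins E W w s' \<and> joins E (W - {w}) s s'"
proof -
  obtain c where c: "hamiltonian_cycle W E c" using assms(1) unfolding hamiltonian_def by blast
  then obtain q r where "c = q @ w # r"
    using assms(2) split_list[of w c] by (auto simp: hamiltonian_cycle_def)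
  with c have c': "hamiltonian_cycle W E (w # r @ q)" using hamiltonian_cycle_rotate by fastforce
  define p where "p = r @ q"
  have p: "hamiltonian_cycle W E (w # p)" using c' p_def by simp
  then have l: "length p \<ge> 2" by (auto simp: hamiltonian_cycle_def)
  then obtain x p' where p': "p = x # p'" "p' \<noteq> []" by (cases p; cases "tl p") auto
  have "joins E W w (last p')" using hamiltonian_cycle_joins[OF p] p' by simp
  moreover have "joins E W x w"
    using hamiltonian_cycle_joins[of W E "p @ [w]"] hamiltonian_cycle_rotate[of W E "[w]" p] p p' by simp
  moreover have "hamiltonian_path (W - {w}) E x (last p') p"
    using p p' by (auto simp: hamiltonian_path_def hamiltonian_cycle_def)
  moreover have "x \<noteq> last p'" "x \<noteq> w" "last p' \<noteq> w" using p p' by (auto simp: hamiltonian_cycle_def)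
  ultimately show ?thesis unfolding joins_def by (metis joins_def joins_rev)
qed

text \<open>If the list traverses \<open>e\<close>, it is rotated so that \<open>e\<close> becomes
  the closing edge; otherwise the list itself is already a path without \<open>e\<close>.\<close>

lemma hamiltonian_avoiding_edge:
  assumes "hamiltonian W E"
  shows "\<exists>s s'. s \<noteq> s' \<and> joins (E - {e}) W s s'"
proof -
  obtain c where c: "hamiltonian_cycle W E c" using assms(1) unfolding hamiltonian_def by blast
  show ?thesis
  proof (cases "\<exists>q x y r. c = q @ x # y # r \<and> {x, y} = e")
    case True
    then obtain q x y r where q: "c = q @ x # y # r" "{x, y} = e" by blast
    define d where "d = (y # r) @ (q @ [x])"
    have d: "hamiltonian_cycle W E d" using hamiltonian_cycle_rotate[of W E "q @ [x]" "y # r"] c q d_def by simp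
    have dd: "distinct d" "is_path E d" "length d \<ge> 3" using d by (auto simp: hamiltonian_cycle_def)
    have "is_path (E - {e}) d"
    proof (rule is_path_Diff[OF dd(2)])
      fix q' x' y' r' assume s: "d = q' @ x' # y' # r'"
      show "{x', y'} \<noteq> e"
      proof
        assume "{x', y'} = e"
        \<comment> \<open>A second occurrence of \<open>e\<close> is impossible: \<open>y\<close> is
          the head of \<open>d\<close> and has no predecessor, and if \<open>x\<close> followed
          \<open>y\<close> directly, then \<open>d\<close>, which ends in \<open>x\<close>, would
          have length 2.\<close>
        then have "y' = y \<or> x' = y \<and> y' = x" using q(2) by auto
        then show False
        proof
          assume "y' = y"
          then show False using s dd(1) d_def by (cases q') auto
        next
          assume a: "x' = y \<and> y' = x"
          then have "q' = []" using s dd(1) d_def by (cases q') auto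
          then have "r @ q @ [x] = x # r'" using s a d_def by simp
          moreover have "x \<notin> set r" "x \<notin> set q" using dd(1) d_def by auto
          ultimately have "r @ q = []" by (cases r; cases q) auto
          then show False using dd(3) d_def by simp
        qed
      qed
    qed
    then have "hamiltonian_path W (E - {e}) (hd d) (last d) d" using d
      by (auto simp: hamiltonian_path_def hamiltonian_cycle_def d_def)
    moreover have "hd d \<noteq> last d" using dd by (auto simp: d_def)
    ultimately show ?thesis unfolding joins_def by blast
  next
    case False
    then have "is_path (E - {e}) c" using c by (intro is_path_Diff) (auto simp: hamiltonian_cycle_def)
    then have "hamiltonian_path W (E - {e}) (hd c) (last c) c" using c
      by (auto simp: hamiltonian_path_def hamiltonian_cycle_def)
    moreover have "hd c \<noteq> last c" using c by (cases c; cases "tl c") (auto simp: hamiltonian_cycle_def)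
    ultimately show ?thesis unfolding joins_def by blast
  qed
qed

text \<open>Two vertices meet at most two of three disjoint edges of the cycle.\<close>

lemma hamiltonian_avoiding_two:
  assumes "hamiltonian W E" "6 \<le> card W"
  shows "\<exists>s s'. s \<noteq> s' \<and> {s, s'} \<inter> {z, z'} = {} \<and> joins E W s s'"
proof -
  obtain c where c: "hamiltonian_cycle W E c" using assms(1) unfolding hamiltonian_def by blast
  then have l: "6 \<le> length c" using assms(2) distinct_card[of c] by (auto simp: hamiltonian_cycle_def)
  have e: "joins E W y x" if "c = p @ x # y # r" for p x y r
    using hamiltonian_cycle_joins[OF hamiltonian_cycle_rotate[of W E "p @ [x]" "y # r"]] c that by simp
  obtain c0 c1 c2 c3 c4 c5 r where cc: "c = c0 # c1 # c2 # c3 # c4 # c5 # r"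
    using l by (auto simp: numeral_eq_Suc Suc_le_length_iff)
  have "joins E W c1 c0" "joins E W c3 c2" "joins E W c5 c4"
    using e[of "[]" c0 c1] e[of "[c0, c1]" c2 c3] e[of "[c0, c1, c2, c3]" c4 c5] cc by auto
  moreover have "distinct [c0, c1, c2, c3, c4, c5]" using c cc by (auto simp: hamiltonian_cycle_def)
  moreover from this have "{c1, c0} \<inter> {z, z'} = {} \<or> {c3, c2} \<inter> {z, z'} = {} \<or> {c5, c4} \<inter> {z, z'} = {}"
    by auto
  ultimately show ?thesis by (metis distinct_length_2_or_more)
qed

section \<open>Hamiltonian paths in complete graphs with few missing edges\<close>

text \<open>The complete graph with the edges in \<open>F\<close> removed is represented by the edge set \<open>- F\<close>.\<close>

definition induced :: "'a set set \<Rightarrow> 'a set \<Rightarrow> 'a set set" where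
  "induced F R = {e \<in> F. \<exists>p\<in>R. \<exists>q\<in>R. p \<noteq> q \<and> e = {p, q}}"

lemma induced_finite [simp]: "finite R \<Longrightarrow> finite (induced F R)"
  by (rule finite_subset[of _ "Pow R"]) (auto simp: induced_def)

lemma induced_remove: "induced F (R - {a}) = {e \<in> induced F R. a \<notin> e}"
  unfolding induced_def by auto

lemma induced_doubleton: "p \<in> R \<Longrightarrow> q \<in> R \<Longrightarrow> p \<noteq> q \<Longrightarrow> {p, q} \<in> induced F R \<longleftrightarrow> {p, q} \<in> F"
  unfolding induced_def by blast

lemma joins_free:
  assumes "finite R" "a \<in> R" "b \<in> R" "a \<noteq> b" "induced F R = {}"
  shows "joins (- F) R a b"
  using assms
proof (induction "card R" arbitrary: R a rule: less_induct)
  case less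
  show ?case
  proof (cases "R - {a, b} = {}")
    case True
    then have "R - {a} = {b}" using less.prems by auto
    moreover have "{a, b} \<notin> F" using less.prems induced_doubleton[of a R b F] by blast
    ultimately show ?thesis using less.prems joins_Cons[of a b "- F" R b] by simp
  next
    case False
    then obtain c where c: "c \<in> R" "c \<noteq> a" "c \<noteq> b" by blast
    have "card (R - {a}) < card R" using less.prems by (intro card_Diff1_less)
    moreover have "induced F (R - {a}) = {}" using less.prems by (simp add: induced_remove)
    ultimately have "joins (- F) (R - {a}) c b"
      using less.prems c less.hyps[of "R - {a}" c] by simp
    moreover have "{a, c} \<notin> F" using less.prems induced_doubleton[of a R c F] c by blast
    ultimately show ?thesis using less.prems joins_Cons[of a c "- F" R b] by simp
  qed
qed

text \<open>Counting: each vertex that fails to be a suitable \<open>c\<close> lies in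
  \<open>Y\<close> or accounts for a bad edge at \<open>a\<close>. Bad edges from \<open>a\<close>
  into \<open>Y\<close> are left out of the count, since \<open>Y\<close> is excluded
  anyway.\<close>

lemma ex_neighbour:
  assumes "finite R" "a \<in> R" "finite Y"
    and "card {e \<in> induced F R - (\<lambda>y. {a, y}) ` Y. a \<in> e} + card Y < card (R - {a})"
  shows "\<exists>c \<in> R. c \<noteq> a \<and> c \<notin> Y \<and> {a, c} \<notin> F"
proof (rule ccontr)
  let ?C = "{c \<in> R. {a, c} \<in> F \<and> c \<noteq> a \<and> c \<notin> Y}"
  assume "\<not> ?thesis"
  then have "R - {a} \<subseteq> ?C \<union> Y" by auto
  then have "card (R - {a}) \<le> card (?C \<union> Y)"
    using assms by (intro card_mono) auto
  also have "\<dots> \<le> card ?C + card Y" by (rule card_Un_le)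
  also have "card ?C \<le> card {e \<in> induced F R - (\<lambda>y. {a, y}) ` Y. a \<in> e}"
    by (rule card_inj_on_le[of "\<lambda>c. {a, c}"])
       (use assms in \<open>auto simp: inj_on_def induced_def doubleton_eq_iff\<close>)
  finally show False using assms by simp
qed

lemma card_split_at:
  assumes "finite A"
  shows "card A = card {e \<in> A. a \<in> e} + card {e \<in> A. a \<notin> e}"
proof -
  have "A = {e \<in> A. a \<in> e} \<union> {e \<in> A. a \<notin> e}" by auto
  then show ?thesis using card_Un_disjoint[of "{e \<in> A. a \<in> e}" "{e \<in> A. a \<notin> e}"] assms by auto
qed

lemma bad_edge_avoiding:
  assumes "e \<in> induced F R"
  shows "\<exists>c z. e = {c, z} \<and> c \<in> R \<and> z \<in> R \<and> c \<noteq> z \<and> c \<noteq> x"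
proof -
  obtain p q where "e = {p, q}" "p \<in> R" "q \<in> R" "p \<noteq> q" using assms unfolding induced_def by blast
  then show ?thesis by (cases "p = x") auto
qed

text \<open>At most m - 4 bad edges, not counting one edge at the start \<open>a\<close>. The
  induction deletes \<open>a\<close> and restarts at a neighbour \<open>c\<close>. The exemption is
  what carries it: in the tight case \<open>c\<close> is chosen as an end of a bad edge, which
  becomes the exempt edge of the new start. With \<open>x = a\<close> nothing is exempt.\<close>

lemma joins_one_sided:
  assumes "finite R" "a \<in> R" "b \<in> R" "a \<noteq> b"
    and "card (induced F R - {{a, x}}) + 4 \<le> card R"
  shows "joins (- F) R a b"
  using assms
proof (induction "card R" arbitrary: R a b x rule: less_induct)
  case less
  let ?I = "induced F R" and ?I' = "induced F R - {{a, x}}"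
  have finI: "finite ?I" using less.prems by simp
  have cardRa: "card (R - {a}) = card R - 1" using less.prems by auto
  define A B where A_def: "A = {e \<in> ?I'. a \<in> e}" and B_def: "B = {e \<in> ?I'. a \<notin> e}"
  have finAB: "finite A" "finite B" using finI by (auto simp: A_def B_def)
  have split: "card ?I' = card A + card B"
    unfolding A_def B_def by (rule card_split_at) (use finI in auto)
  have step: "joins (- F) R a b"
    if "c \<in> R" "c \<noteq> a" "c \<noteq> b" "{a, c} \<notin> F" "card (induced F (R - {a}) - {{c, z}}) + 5 \<le> card R" for c z
  proof (rule joins_Cons[of _ c])
    show "joins (- F) (R - {a}) c b"
      using that less.prems cardRa less.hyps[of "R - {a}" c b z] by (simp add: card_Diff1_less)
  qed (use that less.prems in auto)
  have rest: "induced F (R - {a}) = B" by (auto simp: induced_remove B_def)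
  have "\<exists>c\<in>R. c \<noteq> a \<and> c \<notin> {b, x} \<and> {a, c} \<notin> F"
  proof (rule ex_neighbour)
    have "card {e \<in> ?I - (\<lambda>y. {a, y}) ` {b, x}. a \<in> e} \<le> card A"
      unfolding A_def by (rule card_mono) (use finI in auto)
    moreover have "card {b, x} \<le> 2" by (simp add: card_insert_if)
    ultimately show "card {e \<in> ?I - (\<lambda>y. {a, y}) ` {b, x}. a \<in> e} + card {b, x} < card (R - {a})"
      using less.prems(5) split cardRa by linarith
  qed (use less.prems in auto)
  then obtain c where c: "c \<in> R" "c \<noteq> a" "c \<notin> {b, x}" "{a, c} \<notin> F" by blast
  show ?case
  proof (cases "card B + 5 \<le> card R")
    case True
    have "card (induced F (R - {a}) - {{c, b}}) \<le> card B"
      unfolding rest by (rule card_mono) (use finAB in auto)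
    then show ?thesis using True c by (intro step[of c b]) auto
  next
    case False
    \<comment> \<open>No counted bad edge meets \<open>a\<close>, so nothing is gained by deleting
      \<open>a\<close>, but \<open>a\<close> can move to every vertex other than
      \<open>x\<close>.\<close>
    then have tight: "card A = 0" "card B + 4 = card R"
      using split less.prems by linarith+
    then have "A = {}" using finAB by simp
    then have na: "a \<notin> e" if "e \<in> ?I'" for e using that A_def by blast
    then have good: "{a, c} \<notin> F" if "c \<in> R" "c \<noteq> a" "c \<noteq> x" for c
      using that less.prems induced_doubleton[of a R c F] by (auto simp: doubleton_eq_iff)
    show ?thesis
    proof (cases "B = {}")
      case True
      then have "joins (- F) (R - {a}) c b" using less.prems c rest by (intro joins_free) auto
      then show ?thesis using c less.prems joins_Cons[of a c "- F" R b] by simp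
    next
      case ne: False
      have bound: "card (induced F (R - {a}) - {{c, z}}) + 5 \<le> card R"
        if "{c, z} \<in> B" for c z
        using card_Suc_Diff1[OF _ that] tight(2) finAB unfolding rest by auto
      show ?thesis
      proof (cases "\<exists>c z. {c, z} \<in> B \<and> c \<notin> {b, x}")
        case True
        then obtain c z where cz: "{c, z} \<in> B" "c \<notin> {b, x}" by blast
        then have "c \<in> R" "c \<noteq> a" by (auto simp: B_def induced_def doubleton_eq_iff)
        then show ?thesis using cz good bound[OF cz(1)] by (intro step[of c z]) auto
      next
        case False
        have "e = {b, x} \<and> b \<noteq> x \<and> x \<in> R" if eB: "e \<in> B" for e
        proof -
          obtain p q where "e = {p, q}" "p \<in> R" "q \<in> R" "p \<noteq> q"
            using eB bad_edge_avoiding[of e F R] unfolding B_def by blast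
          moreover have "{p, q} \<in> B" "{q, p} \<in> B" using eB \<open>e = {p, q}\<close> by (simp_all add: insert_commute)
          then have "p \<in> {b, x}" "q \<in> {b, x}" using False by blast+
          ultimately show ?thesis using \<open>e = {p, q}\<close> \<open>p \<noteq> q\<close> \<open>p \<in> R\<close> \<open>q \<in> R\<close> by auto
        qed
        then have only: "induced F (R - {a}) \<subseteq> {{b, x}}" unfolding rest by blast
        then have "card (induced F (R - {a}) - {{b, x}}) = 0" by (metis Diff_eq_empty_iff card.empty)
        moreover have "card R \<ge> 5"
          using tight(2) ne finAB by (cases "card B") auto
        ultimately have "card (induced F (R - {a}) - {{b, x}}) + 4 \<le> card (R - {a})"
          using cardRa by linarith
        \<comment> \<open>The only remaining bad edge meets the target \<open>b\<close>, so the path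
          is built backwards from \<open>b\<close>, where this edge is exempt.\<close>
        then have "joins (- F) (R - {a}) b c"
          by (intro less.hyps[of "R - {a}" b c x]) (use less.prems c in \<open>auto simp: card_Diff1_less\<close>)
        then show ?thesis using c less.prems joins_rev[of "- F" _ b c] joins_Cons[of a c "- F" R b] by simp
      qed
    qed
  qed
qed

text \<open>The same induction with a free end vertex; not having to reach a prescribed
  \<open>b\<close> is worth one more bad edge.\<close>

lemma joins_from:
  assumes "finite R" "a \<in> R" "card (induced F R - {{a, x}}) + 3 \<le> card R"
  shows "\<exists>b. joins (- F) R a b"
  using assms
proof (induction "card R" arbitrary: R a x rule: less_induct)
  case less
  let ?I = "induced F R" and ?I' = "induced F R - {{a, x}}"
  have finI: "finite ?I" using less.prems by simp
  have cardRa: "card (R - {a}) = card R - 1" using less.prems by auto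
  define A B where A_def: "A = {e \<in> ?I'. a \<in> e}" and B_def: "B = {e \<in> ?I'. a \<notin> e}"
  have finAB: "finite A" "finite B" using finI by (auto simp: A_def B_def)
  have split: "card ?I' = card A + card B"
    unfolding A_def B_def by (rule card_split_at) (use finI in auto)
  have step: "\<exists>b. joins (- F) R a b"
    if "c \<in> R" "c \<noteq> a" "{a, c} \<notin> F" "card (induced F (R - {a}) - {{c, z}}) + 4 \<le> card R" for c z
  proof -
    have "\<exists>b. joins (- F) (R - {a}) c b"
      using that less.prems cardRa by (intro less.hyps[of "R - {a}" c z]) (auto simp: card_Diff1_less)
    then show ?thesis using that less.prems joins_Cons[of a c "- F" R] by auto
  qed
  have rest: "induced F (R - {a}) = B" by (auto simp: induced_remove B_def)
  have "\<exists>c\<in>R. c \<noteq> a \<and> c \<notin> {x} \<and> {a, c} \<notin> F"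
  proof (rule ex_neighbour)
    have "card {e \<in> ?I - (\<lambda>y. {a, y}) ` {x}. a \<in> e} = card A" by (simp add: A_def)
    then show "card {e \<in> ?I - (\<lambda>y. {a, y}) ` {x}. a \<in> e} + card {x} < card (R - {a})"
      using less.prems(3) split cardRa by simp
  qed (use less.prems in auto)
  then obtain c where c: "c \<in> R" "c \<noteq> a" "c \<noteq> x" "{a, c} \<notin> F" by blast
  show ?case
  proof (cases "card B + 4 \<le> card R")
    case True
    have "card (induced F (R - {a}) - {{c, a}}) \<le> card B"
      unfolding rest by (rule card_mono) (use finAB in auto)
    then show ?thesis using True c by (intro step[of c a]) auto
  next
    case False
    then have tight: "card A = 0" "card B + 3 = card R"
      using split less.prems by linarith+
    then have "A = {}" using finAB by simp
    then have na: "a \<notin> e" if "e \<in> ?I'" for e using that A_def by blast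
    then have good: "{a, c} \<notin> F" if "c \<in> R" "c \<noteq> a" "c \<noteq> x" for c
      using that less.prems induced_doubleton[of a R c F] by (auto simp: doubleton_eq_iff)
    show ?thesis
    proof (cases "B = {}")
      case True
      have "\<not> R \<subseteq> {a, c}"
        using tight(2) card_mono[of "{a, c}" R] by (auto simp: card_insert_if split: if_splits)
      then obtain d where "d \<in> R" "d \<noteq> a" "d \<noteq> c" by blast
      then have "joins (- F) (R - {a}) c d" using less.prems c rest True by (intro joins_free) auto
      then show ?thesis using c less.prems joins_Cons[of a c "- F" R] by auto
    next
      case ne: False
      then obtain e where e: "e \<in> B" by blast
      then obtain c z where cz: "e = {c, z}" "c \<noteq> x" "c \<in> R" using bad_edge_avoiding[of e F R x] unfolding B_def by blast
      have "card (induced F (R - {a}) - {{c, z}}) + 4 \<le> card R"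
        using card_Suc_Diff1[OF _ e] tight(2) finAB unfolding rest cz(1) by auto
      moreover have "c \<noteq> a" using e cz B_def by auto
      ultimately show ?thesis using cz good by (intro step[of c z]) auto
    qed
  qed
qed

text \<open>With both ends free yet another bad edge is tolerated: the path starts at an end of some
  bad edge, which is then exempt.\<close>

lemma joins_traceable:
  assumes "finite R" "card (induced F R) + 2 \<le> card R" "3 \<le> card R"
  shows "\<exists>a b. joins (- F) R a b"
proof (cases "induced F R = {}")
  case True
  obtain a where "a \<in> R" using assms by (metis all_not_in_conv card.empty not_numeral_le_zero)
  then show ?thesis using joins_from[of R a F a] assms True by auto
next
  case False
  then obtain e where e: "e \<in> induced F R" by blast
  then obtain a x where "e = {a, x}" and aR: "a \<in> R" unfolding induced_def by blast
  with e have "{a, x} \<in> induced F R" by simp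
  then have "card (induced F R - {{a, x}}) + 3 \<le> card R"
    using card_Suc_Diff1[of "induced F R" "{a, x}"] assms by simp
  then show ?thesis using joins_from[of R a F x] assms aR by blast
qed

lemma joins_loop: "joins E W u u \<Longrightarrow> W = {u}"
proof -
  assume "joins E W u u"
  then obtain p where p: "hamiltonian_path W E u u p" unfolding joins_def by blast
  then show "W = {u}" by (cases p) (auto simp: hamiltonian_path_def split: if_splits)
qed

text \<open>A path from \<open>a\<close> to \<open>b\<close> can avoid the two additional edges \<open>{a, x}\<close> and \<open>{b, y}\<close>, except when
  \<open>x = y\<close> and all other bad edges may be concentrated in this vertex.\<close>

lemma joins_two_sided_step:
  fixes F R a b x y
  defines "I \<equiv> induced F R - {{a, x}, {b, y}}"
  assumes R: "finite R" "a \<in> R" "b \<in> R" "a \<noteq> b"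
    and I: "card I + 4 \<le> card R" "card {e \<in> I. a \<notin> e} + 5 \<le> card R"
  shows "joins (- F) R a b"
proof -
  have finI: "finite I" using R by (simp add: I_def)
  have cardRa: "card (R - {a}) = card R - 1" using R by auto
  have split: "card I = card {e \<in> I. a \<in> e} + card {e \<in> I. a \<notin> e}"
    by (rule card_split_at[OF finI])
  have "\<exists>c\<in>R. c \<noteq> a \<and> c \<notin> {b, x} \<and> {a, c} \<notin> F"
  proof (rule ex_neighbour)
    have "card {e \<in> induced F R - (\<lambda>y. {a, y}) ` {b, x}. a \<in> e} \<le> card {e \<in> I. a \<in> e}"
      by (rule card_mono) (use finI R(4) in \<open>auto simp: I_def\<close>)
    moreover have "card {b, x} \<le> 2" by (simp add: card_insert_if)
    ultimately show "card {e \<in> induced F R - (\<lambda>y. {a, y}) ` {b, x}. a \<in> e} + card {b, x} < card (R - {a})"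
      using I(1) split cardRa by linarith
  qed (use R in auto)
  then obtain c where c: "c \<in> R" "c \<noteq> a" "c \<notin> {b, x}" "{a, c} \<notin> F" by blast
  \<comment> \<open>The edge \<open>{a, x}\<close> disappears together with \<open>a\<close>. Only
    \<open>{b, y}\<close> still has to be exempted, so the remaining path is started at
    \<open>b\<close>.\<close>
  have "card (induced F (R - {a}) - {{b, y}}) \<le> card {e \<in> I. a \<notin> e}"
    by (rule card_mono) (use finI in \<open>auto simp: I_def induced_remove\<close>)
  then have "card (induced F (R - {a}) - {{b, y}}) + 4 \<le> card (R - {a})"
    using I(2) cardRa by linarith
  then have "joins (- F) (R - {a}) b c" using R c by (intro joins_one_sided[of _ b c F y]) auto
  then show ?thesis using c R joins_rev[of "- F" _ b c] joins_Cons[of a c "- F" R b] by simp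
qed

text \<open>If there is slack, or a counted bad edge meets an end, deleting that end suffices.
  Otherwise all m - 4 counted edges lie among the m - 2 other vertices, which are still traceable,
  and the trace is attached to \<open>a\<close> and \<open>b\<close>. The exception is genuine: for
  \<open>x = y\<close> a star of m - 4 bad edges at \<open>x\<close> would leave \<open>x\<close>
  with a single usable neighbour.\<close>

lemma joins_two_sided:
  fixes F R a b x y
  defines "I \<equiv> induced F R - {{a, x}, {b, y}}"
  assumes R: "finite R" "a \<in> R" "b \<in> R" "a \<noteq> b" "5 \<le> card R"
    and I: "card I + 4 \<le> card R"
    and exc: "x \<noteq> y \<or> card I + 5 \<le> card R \<or> (\<exists>e\<in>I. a \<in> e \<or> b \<in> e)"
  shows "joins (- F) R a b"
proof -
  have finI: "finite I" using R by (simp add: I_def)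
  have le: "card {e \<in> I. c \<notin> e} \<le> card I" for c by (rule card_mono) (use finI in auto)
  have lt: "card {e \<in> I. c \<notin> e} < card I" if "e \<in> I" "c \<in> e" for c e
    by (rule psubset_card_mono) (use finI that in auto)
  have I': "I = induced F R - {{b, y}, {a, x}}" by (auto simp: I_def)
  consider "card {e \<in> I. a \<notin> e} + 5 \<le> card R" | "card {e \<in> I. b \<notin> e} + 5 \<le> card R"
    | "x \<noteq> y" "\<forall>e\<in>I. a \<notin> e \<and> b \<notin> e" "card I + 4 = card R"
  proof (cases "card I + 5 \<le> card R \<or> (\<exists>e\<in>I. a \<in> e \<or> b \<in> e)")
    case True
    then have "card {e \<in> I. a \<notin> e} + 5 \<le> card R \<or> card {e \<in> I. b \<notin> e} + 5 \<le> card R"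
    proof
      assume "card I + 5 \<le> card R"
      then show ?thesis using le[of a] by linarith
    next
      assume "\<exists>e\<in>I. a \<in> e \<or> b \<in> e"
      then obtain e where "e \<in> I" "a \<in> e \<or> b \<in> e" by blast
      then have "card {e \<in> I. a \<notin> e} < card I \<or> card {e \<in> I. b \<notin> e} < card I" using lt[of e] by metis
      then show ?thesis using I by linarith
    qed
    then show thesis using that(1,2) by metis
  next
    case False
    then have "x \<noteq> y" "\<forall>e\<in>I. a \<notin> e \<and> b \<notin> e" using exc by blast+
    moreover have "card I + 4 = card R" using False I by linarith
    ultimately show thesis by (rule that(3))
  qed
  then show ?thesis
  proof cases
    case 1
    then show ?thesis using R I joins_two_sided_step[of R a b F x y] I_def by simp
  next
    case 2
    then show ?thesis using R I joins_two_sided_step[of R b a F y x] I' joins_rev[of "- F" R b a] by simp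
  next
    case 3
    let ?R = "R - {a, b}"
    have cR: "card ?R + 2 = card R" using R by (simp add: card_Diff_subset)
    have sub: "induced F ?R \<subseteq> I" by (auto simp: I_def induced_def)
    have "card (induced F ?R) + 2 \<le> card ?R" using card_mono[OF finI sub] 3(3) cR by linarith
    moreover have "finite ?R" "3 \<le> card ?R" using R(1,5) cR by auto
    ultimately obtain c d where cd: "joins (- F) ?R c d"
      using joins_traceable[of ?R F] by blast
    have ne: "c \<noteq> d"
    proof
      assume "c = d"
      then have "?R = {c}" using cd joins_loop by metis
      then have "card ?R = 1" by simp
      then show False using cR R(5) by linarith
    qed
    have good: "{a, z} \<notin> F" if "z \<in> ?R" "z \<noteq> x" for z
    proof
      assume "{a, z} \<in> F"
      then have "{a, z} \<in> induced F R" using that R induced_doubleton[of a R z F] by blast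
      moreover have "{a, z} \<noteq> {a, x}" "{a, z} \<noteq> {b, y}" using that R(4) by (simp_all add: doubleton_eq_iff)
      ultimately have "{a, z} \<in> I" by (simp add: I_def)
      then show False using 3(2) by blast
    qed
    have good': "{z, b} \<notin> F" if "z \<in> ?R" "z \<noteq> y" for z
    proof
      assume "{z, b} \<in> F"
      then have "{z, b} \<in> induced F R" using that R induced_doubleton[of z R b F] by blast
      moreover have "{z, b} \<noteq> {a, x}" "{z, b} \<noteq> {b, y}" using that R(4) by (auto simp: doubleton_eq_iff)
      ultimately have "{z, b} \<in> I" by (simp add: I_def)
      then show False using 3(2) by blast
    qed
    have *: "joins (- F) R a b" if "joins (- F) ?R c d" "c \<noteq> x" "d \<noteq> y" for c d
    proof -
      have "c \<in> ?R" "d \<in> ?R" using joins_in[OF that(1)] by auto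
      then have "joins (- F) (?R \<union> {b}) c b"
        using joins_append[OF that(1), of b "{b}" b] good' that by simp
      moreover have "?R \<union> {b} = R - {a}" using R by auto
      ultimately show ?thesis using joins_Cons[of a c "- F" R b] good that \<open>c \<in> ?R\<close> R by simp
    qed
    show ?thesis
    proof (cases "c \<noteq> x \<and> d \<noteq> y")
      case True
      then show ?thesis using * cd by blast
    next
      case False
      \<comment> \<open>As \<open>c\<close>, \<open>d\<close> are distinct and \<open>x\<close>,
        \<open>y\<close> are distinct, an unsuitable orientation of the trace becomes suitable when
        reversed.\<close>
      then have "d \<noteq> x" "c \<noteq> y" using ne 3(1) by auto
      then show ?thesis using * joins_rev[OF cd] by blast
    qed
  qed
qed

text \<open>A Hamiltonian cycle in the form needed for lifting, opened at a vertex \<open>w\<close>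
  with cycle neighbours \<open>p\<close> and \<open>q\<close>. Choosing \<open>w\<close> on a bad
  edge lowers the number of bad edges among the other vertices.\<close>

lemma joins_closed:
  assumes R: "finite R" "3 \<le> card R" and I: "card (induced F R) + 3 \<le> card R"
  shows "\<exists>w\<in>R. \<exists>p q. p \<noteq> q \<and> {w, p} \<notin> F \<and> {w, q} \<notin> F \<and> joins (- F) (R - {w}) p q"
proof -
  have finI: "finite (induced F R)" using R by simp
  have split: "card (induced F R) = card {e \<in> induced F R. w \<in> e} + card (induced F (R - {w}))" for w
    unfolding induced_remove by (rule card_split_at[OF finI])
  have nb: "\<exists>c\<in>R. c \<noteq> w \<and> c \<noteq> p \<and> {w, c} \<notin> F" if "w \<in> R" for w p
  proof -
    have "\<exists>c\<in>R. c \<noteq> w \<and> c \<notin> {p} \<and> {w, c} \<notin> F"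
    proof (rule ex_neighbour)
      have "card {e \<in> induced F R - (\<lambda>y. {w, y}) ` {p}. w \<in> e} \<le> card (induced F R)"
        by (rule card_mono) (use finI in auto)
      moreover have "card (R - {w}) = card R - 1" using that R by simp
      ultimately show "card {e \<in> induced F R - (\<lambda>y. {w, y}) ` {p}. w \<in> e} + card {p} < card (R - {w})"
        using I R by simp
    qed (use that R in auto)
    then show ?thesis by simp
  qed
  have fin: "finite (R - {w})" "w \<in> R \<Longrightarrow> card (R - {w}) = card R - 1" for w using R by auto
  obtain w w' where w: "w \<in> R" "induced F R = {} \<or> {w, w'} \<in> induced F R"
  proof (cases "induced F R = {}")
    case True
    obtain w where "w \<in> R" using R by (metis all_not_in_conv card.empty not_numeral_le_zero)
    then show thesis using True by (intro that[of w w]) simp_all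
  next
    case False
    then obtain w w' where "{w, w'} \<in> induced F R" "w \<in> R" unfolding induced_def by blast
    then show thesis by (intro that[of w w']) simp_all
  qed
  obtain p where p: "p \<in> R" "p \<noteq> w" "{w, p} \<notin> F" using nb[OF w(1)] by blast
  obtain q where q: "q \<in> R" "q \<noteq> w" "q \<noteq> p" "{w, q} \<notin> F" using nb[OF w(1)] by blast
  have "\<exists>p q. p \<noteq> q \<and> {w, p} \<notin> F \<and> {w, q} \<notin> F \<and> joins (- F) (R - {w}) p q"
  proof (cases "induced F (R - {w}) = {} \<or> card (induced F (R - {w})) + 5 \<le> card R")
    case True
    then have "joins (- F) (R - {w}) p q"
    proof
      assume "induced F (R - {w}) = {}"
      then show ?thesis using fin(1) p q by (intro joins_free) simp_all
    next
      assume a: "card (induced F (R - {w})) + 5 \<le> card R"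
      have "card (induced F (R - {w}) - {{p, p}}) \<le> card (induced F (R - {w}))"
        by (rule card_mono) (use fin in auto)
      then have c: "card (induced F (R - {w}) - {{p, p}}) + 4 \<le> card (R - {w})"
        using a fin(2)[OF w(1)] by linarith
      show ?thesis by (rule joins_one_sided[OF _ _ _ _ c]) (use fin(1) p q in simp_all)
    qed
    then show ?thesis using p(3) q(3,4) by (intro exI[of _ p] exI[of _ q]) simp
  next
    case False
    \<comment> \<open>Tight case: \<open>{w, w'}\<close> is the only bad edge at \<open>w\<close>
      and the remaining graph has one bad edge too many. The path therefore starts at an end
      \<open>c\<close> of such an edge, with \<open>c\<close> different from \<open>w'\<close> so
      that \<open>w\<close> is joined to it.\<close>
    then have ww': "{w, w'} \<in> {e \<in> induced F R. w \<in> e}" 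
    proof -
      have "induced F R \<noteq> {}" using False unfolding induced_remove by auto
      then show ?thesis using w by simp
    qed
    have finw: "finite {e \<in> induced F R. w \<in> e}" using finI by simp
    then have ge: "1 \<le> card {e \<in> induced F R. w \<in> e}" using ww' card_gt_0_iff by (metis One_nat_def Suc_leI emptyE)
    then have one: "card {e \<in> induced F R. w \<in> e} = 1" "card (induced F (R - {w})) + 4 = card R"
      using False split[of w] I by linarith+
    obtain e where e: "e \<in> induced F (R - {w})" using False by (meson equals0I)
    then obtain c z where cz: "e = {c, z}" "c \<in> R - {w}" "c \<noteq> w'" using bad_edge_avoiding by metis
    have "{w, c} \<notin> F"
    proof
      assume "{w, c} \<in> F"
      then have "{w, c} \<in> {e \<in> induced F R. w \<in> e}" using cz(2) w(1) induced_doubleton[of w R c F] by blast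
      then have "{w, c} = {w, w'}" using one(1) ww' by (metis card_1_singletonE singletonD)
      then show False using cz by (auto simp: doubleton_eq_iff)
    qed
    moreover obtain q where q: "q \<in> R" "q \<noteq> w" "q \<noteq> c" "{w, q} \<notin> F" using nb[OF w(1)] by blast
    moreover have "joins (- F) (R - {w}) c q"
    proof (rule joins_one_sided)
      show "card (induced F (R - {w}) - {{c, z}}) + 4 \<le> card (R - {w})"
        using card_Suc_Diff1[of "induced F (R - {w})" e] fin w one e cz(1) by simp
    qed (use fin cz q in auto)
    ultimately show ?thesis by (intro exI[of _ c] exI[of _ q]) simp
  qed
  then show ?thesis using w(1) by blast
qed

text \<open>The complement \<open>- F\<close> also contains singletons and larger sets, so edge sets
  are compared only on pairs of distinct vertices of \<open>W\<close>; a distinct list uses no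
  others.\<close>

lemma joins_mono_edges:
  assumes "joins E W u v" "\<And>x y. {x, y} \<in> E \<Longrightarrow> x \<in> W \<Longrightarrow> y \<in> W \<Longrightarrow> x \<noteq> y \<Longrightarrow> {x, y} \<in> E'"
  shows "joins E' W u v"
proof -
  obtain p where p: "hamiltonian_path W E u v p" using assms unfolding joins_def by blast
  then have "is_path E' p"
    unfolding hamiltonian_path_def is_path_def
    by (auto intro!: assms(2) simp: nth_eq_iff_index_eq)
  then have "hamiltonian_path W E' u v p" using p by (simp add: hamiltonian_path_def)
  then show ?thesis unfolding joins_def by blast
qed

section \<open>Complete graphs with faulty vertices and edges\<close>

lemma complete_joins:
  assumes "finite V" "FV \<subseteq> V" "finite FE" "card FV + card FE + 4 \<le> card V" "u \<in> V - FV" "v \<in> V - FV" "u \<noteq> v"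
    and E: "\<And>a b. a \<in> V \<Longrightarrow> b \<in> V \<Longrightarrow> a \<noteq> b \<Longrightarrow> {a, b} \<in> E"
  shows "joins (E - FE) (V - FV) u v"
proof -
  have "card (induced FE (V - FV) - {{u, u}}) \<le> card FE"
    by (rule card_mono) (use assms in \<open>auto simp: induced_def\<close>)
  moreover have "card (V - FV) = card V - card FV" using assms by (simp add: card_Diff_subset finite_subset)
  ultimately have "joins (- FE) (V - FV) u v"
    using assms by (intro joins_one_sided[of _ u v FE u]) auto
  then show ?thesis by (rule joins_mono_edges) (use E in auto)
qed

lemma complete_hamiltonian:
  assumes "finite V" "FV \<subseteq> V" "finite FE" "card FV + card FE + 3 \<le> card V"
    and E: "\<And>a b. a \<in> V \<Longrightarrow> b \<in> V \<Longrightarrow> a \<noteq> b \<Longrightarrow> {a, b} \<in> E"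
  shows "hamiltonian (V - FV) (E - FE)"
proof -
  let ?R = "V - FV"
  have "card (induced FE ?R) \<le> card FE"
    by (rule card_mono) (use assms in \<open>auto simp: induced_def\<close>)
  moreover have c: "card ?R = card V - card FV" using assms by (simp add: card_Diff_subset finite_subset)
  ultimately have "card (induced FE ?R) + 3 \<le> card ?R" "3 \<le> card ?R" using assms by auto
  then obtain w p q where w: "w \<in> ?R" "p \<noteq> q" "{w, p} \<notin> FE" "{w, q} \<notin> FE" "joins (- FE) (?R - {w}) p q"
    using joins_closed[of ?R FE] assms(1) by (metis finite_Diff)
  have pq: "p \<in> ?R - {w}" "q \<in> ?R - {w}" using joins_in[OF w(5)] by auto
  have "joins (E - FE) (?R - {w}) p q" by (rule joins_mono_edges[OF w(5)]) (use E in auto)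
  then have "joins (E - FE) ?R w q" using w pq E joins_Cons[of w p "E - FE" ?R q] by auto
  then show ?thesis by (rule hamiltonianI) (use w pq E \<open>3 \<le> card ?R\<close> in \<open>auto simp: insert_commute\<close>)
qed

section \<open>Disjoint copies contracted to a complete graph\<close>

text \<open>Disjoint copies indexed by \<open>S\<close>; the vertices of copy \<open>i\<close> correspond to the other copies, and
  \<open>port i j\<close> is the vertex of copy \<open>i\<close> whose cross edge leads to copy \<open>j\<close>.\<close>

locale cells =
  fixes S :: "'c set" and V :: "'c \<Rightarrow> 'v set" and E :: "'c \<Rightarrow> 'v set set" and port :: "'c \<Rightarrow> 'c \<Rightarrow> 'v"
  assumes finite_S: "finite S"
    and disjoint_V: "i \<in> S \<Longrightarrow> j \<in> S \<Longrightarrow> i \<noteq> j \<Longrightarrow> V i \<inter> V j = {}"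
    and port_bij: "i \<in> S \<Longrightarrow> bij_betw (port i) (S - {i}) (V i)"
    and E_sub: "i \<in> S \<Longrightarrow> e \<in> E i \<Longrightarrow> e \<subseteq> V i \<and> e \<noteq> {}"
begin

definition verts :: "'v set" where
  "verts = (\<Union>i\<in>S. V i)"

definition cross :: "'v set set" where
  "cross = {{port i j, port j i} |i j. i \<in> S \<and> j \<in> S \<and> i \<noteq> j}"

definition edges :: "'v set set" where
  "edges = (\<Union>i\<in>S. E i) \<union> cross"

text \<open>The edges of the contracted graph that cannot be lifted to a usable cross edge.\<close>

definition bad :: "'v set \<Rightarrow> 'v set set \<Rightarrow> 'c set set" where
  "bad FV FE = {{i, j} |i j. i \<in> S \<and> j \<in> S \<and> i \<noteq> j \<and>
     (port i j \<in> FV \<or> port j i \<in> FV \<or> {port i j, port j i} \<in> FE)}"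

definition region :: "'v set \<Rightarrow> 'c set \<Rightarrow> 'v set" where
  "region FV R = (\<Union>c\<in>R. V c) - FV"

definition linked :: "'v set \<Rightarrow> 'v set set \<Rightarrow> 'c \<Rightarrow> bool" where
  "linked FV FE c \<longleftrightarrow> (\<forall>s\<in>V c - FV. \<forall>t\<in>V c - FV. s \<noteq> t \<longrightarrow> joins (edges - FE) (V c - FV) s t)"

lemma port_in: "i \<in> S \<Longrightarrow> j \<in> S \<Longrightarrow> i \<noteq> j \<Longrightarrow> port i j \<in> V i"
  using port_bij[of i] by (auto simp: bij_betw_def)

lemma port_eq: "i \<in> S \<Longrightarrow> j \<in> S \<Longrightarrow> k \<in> S \<Longrightarrow> i \<noteq> j \<Longrightarrow> i \<noteq> k \<Longrightarrow> port i j = port i k \<longleftrightarrow> j = k"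
  using port_bij[of i] by (auto simp: bij_betw_def inj_on_def)

lemma port_ex: "i \<in> S \<Longrightarrow> v \<in> V i \<Longrightarrow> \<exists>j\<in>S. j \<noteq> i \<and> v = port i j"
  using port_bij[of i] by (auto simp: bij_betw_def)

lemma V_unique: "v \<in> V i \<Longrightarrow> v \<in> V j \<Longrightarrow> i \<in> S \<Longrightarrow> j \<in> S \<Longrightarrow> i = j"
  using disjoint_V by blast

lemma port_notin: "i \<in> S \<Longrightarrow> j \<in> S \<Longrightarrow> k \<in> S \<Longrightarrow> i \<noteq> j \<Longrightarrow> i \<noteq> k \<Longrightarrow> port i j \<notin> V k"
  using V_unique[of "port i j" i k] port_in[of i j] by blast

lemma finite_V: "i \<in> S \<Longrightarrow> finite (V i)"
  using port_bij[of i] finite_S by (metis bij_betw_finite finite_Diff)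

lemma card_V: "i \<in> S \<Longrightarrow> card (V i) + 1 = card S"
  using port_bij[of i] finite_S by (metis Suc_eq_plus1 bij_betw_same_card card_Suc_Diff1)

lemma finite_verts: "finite verts"
  unfolding verts_def using finite_S finite_V by blast

lemma edges_sub:
  assumes "e \<in> edges"
  shows "e \<subseteq> verts"
proof -
  consider i where "i \<in> S" "e \<in> E i" | i j where "i \<in> S" "j \<in> S" "i \<noteq> j" "e = {port i j, port j i}"
    using assms unfolding edges_def cross_def by blast
  then show ?thesis
  proof cases
    case 1
    then show ?thesis using E_sub[of i e] unfolding verts_def by blast
  next
    case 2
    then show ?thesis using port_in[of i j] port_in[of j i] unfolding verts_def by blast
  qed
qed

lemma finite_edges: "finite edges"
  by (rule finite_subset[of _ "Pow verts"]) (use edges_sub finite_verts in auto)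

lemma cross_notin_E:
  assumes "i \<in> S" "j \<in> S" "i \<noteq> j" "k \<in> S"
  shows "{port i j, port j i} \<notin> E k"
proof
  assume "{port i j, port j i} \<in> E k"
  then have "port i j \<in> V k" "port j i \<in> V k" using E_sub[OF assms(4)] by blast+
  then show False using port_in[of i j] port_in[of j i] V_unique[of _ i k] V_unique[of _ j k] assms by metis
qed

lemma bad_sym: "i \<in> S \<Longrightarrow> j \<in> S \<Longrightarrow> i \<noteq> j \<Longrightarrow> {i, j} \<in> bad FV FE \<longleftrightarrow>
    port i j \<in> FV \<or> port j i \<in> FV \<or> {port i j, port j i} \<in> FE"
proof
  assume ij: "i \<in> S" "j \<in> S" "i \<noteq> j" "{i, j} \<in> bad FV FE"
  then obtain i' j' where "{i, j} = {i', j'}" "port i' j' \<in> FV \<or> port j' i' \<in> FV \<or> {port i' j', port j' i'} \<in> FE"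
    unfolding bad_def by blast
  then show "port i j \<in> FV \<or> port j i \<in> FV \<or> {port i j, port j i} \<in> FE"
    by (auto simp: doubleton_eq_iff insert_commute)
qed (auto simp: bad_def)

lemma bad_doubleton:
  assumes "e \<in> bad FV FE"
  obtains i j where "e = {i, j}" "i \<in> S" "j \<in> S" "i \<noteq> j"
    "port i j \<in> FV \<or> port j i \<in> FV \<or> {port i j, port j i} \<in> FE"
  using assms unfolding bad_def by blast

lemma good_edge: "i \<in> S \<Longrightarrow> j \<in> S \<Longrightarrow> i \<noteq> j \<Longrightarrow> {i, j} \<notin> bad FV FE \<Longrightarrow>
    port i j \<in> V i - FV \<and> {port i j, port j i} \<in> edges - FE"
  using port_in bad_sym[of i j FV FE] unfolding edges_def cross_def by blast

lemma finite_bad: "finite (bad FV FE)"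
  by (rule finite_subset[of _ "Pow S"]) (use finite_S in \<open>auto simp: bad_def\<close>)

text \<open>Every fault destroys at most one cross connection, an edge inside a copy none.\<close>

lemma card_bad:
  assumes "finite FV" "finite FE" "a \<in> S"
  shows "card (bad FV FE) \<le> card FV + card (FE - E a)"
proof -
  \<comment> \<open>\<open>?pv\<close> maps a vertex to the pair consisting of its own copy and the
    copy its cross edge leads to; \<open>?pe\<close> maps a cross edge to the two copies it meets.
    Hence every bad edge is an image of a fault causing it.\<close>
  let ?pv = "\<lambda>v. {i \<in> S. v \<in> V i} \<union> {j \<in> S. \<exists>i\<in>S. i \<noteq> j \<and> v = port i j}"
  let ?pe = "\<lambda>e. {i \<in> S. e \<inter> V i \<noteq> {}}"
  have pv: "{i, j} = ?pv (port i j)" if "i \<in> S" "j \<in> S" "i \<noteq> j" for i j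
  proof -
    have "{k \<in> S. port i j \<in> V k} = {i}" using that port_in port_notin by blast
    moreover have "{k \<in> S. \<exists>l\<in>S. l \<noteq> k \<and> port i j = port l k} = {j}"
    proof -
      have "k = j" if "k \<in> S" "l \<in> S" "l \<noteq> k" "port i j = port l k" for k l
        using that \<open>i \<in> S\<close> \<open>j \<in> S\<close> \<open>i \<noteq> j\<close> port_in[of i j] port_in[of l k] V_unique[of _ i l] port_eq[of i j k] by metis
      then show ?thesis using that by blast
    qed
    ultimately show ?thesis by blast
  qed
  have pe: "{i, j} = ?pe {port i j, port j i}" if "i \<in> S" "j \<in> S" "i \<noteq> j" for i j
    using that port_in[of i j] port_in[of j i] port_notin[of i j] port_notin[of j i] by blast
  have "bad FV FE \<subseteq> ?pv ` FV \<union> ?pe ` (FE - E a)"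
  proof
    fix e assume "e \<in> bad FV FE"
    then obtain i j where ij: "e = {i, j}" "i \<in> S" "j \<in> S" "i \<noteq> j"
      "port i j \<in> FV \<or> port j i \<in> FV \<or> {port i j, port j i} \<in> FE" by (rule bad_doubleton)
    from ij(5) consider "port i j \<in> FV" | "port j i \<in> FV" | "{port i j, port j i} \<in> FE - E a"
      using cross_notin_E[OF ij(2-4) assms(3)] by blast
    then show "e \<in> ?pv ` FV \<union> ?pe ` (FE - E a)"
    proof cases
      case 1
      have "e = ?pv (port i j)" using pv[OF ij(2-4)] ij(1) by simp
      then show ?thesis using 1 by (intro UnI1 image_eqI)
    next
      case 2
      have "e = ?pv (port j i)" using pv[OF ij(3,2)] ij(1,4) by (simp add: insert_commute)
      then show ?thesis using 2 by (intro UnI1 image_eqI)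
    next
      case 3
      have "e = ?pe {port i j, port j i}" using pe[OF ij(2-4)] ij(1) by simp
      then show ?thesis using 3 by (intro UnI2 image_eqI)
    qed
  qed
  then have "card (bad FV FE) \<le> card (?pv ` FV \<union> ?pe ` (FE - E a))"
    using assms by (intro card_mono) auto
  also have "\<dots> \<le> card (?pv ` FV) + card (?pe ` (FE - E a))" by (rule card_Un_le)
  also have "\<dots> \<le> card FV + card (FE - E a)" using assms by (intro add_mono card_image_le) auto
  finally show ?thesis .
qed

lemma region_single [simp]: "region FV {c} = V c - FV"
  by (simp add: region_def)

lemma region_Un: "region FV (A \<union> B) = region FV A \<union> region FV B"
  unfolding region_def by blast

lemma region_disjoint: "A \<subseteq> S \<Longrightarrow> B \<subseteq> S \<Longrightarrow> A \<inter> B = {} \<Longrightarrow> region FV A \<inter> region FV B = {}"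
  unfolding region_def using V_unique by blast

lemma region_S: "region FV S = verts - FV"
  by (simp add: region_def verts_def)

lemma glue:
  assumes "joins (edges - FE) (region FV A) u (port i j)" "joins (edges - FE) (region FV B) (port j i) v"
    and "{i, j} \<notin> bad FV FE" "i \<in> A" "j \<in> B" "A \<subseteq> S" "B \<subseteq> S" "A \<inter> B = {}"
  shows "joins (edges - FE) (region FV (A \<union> B)) u v"
  unfolding region_Un
  by (rule joins_append[OF assms(1) _ assms(2)]) (use assms good_edge[of i j] region_disjoint in blast)+

text \<open>Each copy is crossed from its port of entry to its port of exit, which differ because
  the previous and the next copy differ. At the two ends this fails when \<open>u\<close> or
  \<open>v\<close> is itself the port towards the adjacent copy of the list; the last two hypotheses
  rule this out.\<close>

lemma route_list:
  assumes "cs \<noteq> []" "distinct cs" "set cs \<subseteq> S" "is_path (- bad FV FE) cs" "\<And>c. c \<in> set cs \<Longrightarrow> linked FV FE c"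
    and "u \<in> V (hd cs) - FV" "v \<in> V (last cs) - FV"
    and "length cs = 1 \<Longrightarrow> u \<noteq> v"
    and "length cs \<noteq> 1 \<Longrightarrow> u \<noteq> port (hd cs) (cs ! 1) \<and> v \<noteq> port (last cs) (cs ! (length cs - 2))"
  shows "joins (edges - FE) (region FV (set cs)) u v"
  using assms
proof (induction cs arbitrary: u rule: induct_list012)
  case (2 c)
  then show ?case by (simp add: linked_def)
next
  case (3 c d cs)
  have g: "port c d \<in> V c - FV" "port d c \<in> V d - FV" "{c, d} \<notin> bad FV FE"
    using "3.prems" good_edge[of c d FV FE] good_edge[of d c FV FE] by (auto simp: insert_commute)
  have "linked FV FE c" "u \<in> V c - FV" "u \<noteq> port c d" using "3.prems"(5)[of c] "3.prems"(6,9) by auto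
  then have 1: "joins (edges - FE) (region FV {c}) u (port c d)" using g by (simp add: linked_def)
  have "joins (edges - FE) (region FV (set (d # cs))) (port d c) v"
  proof (rule "3.IH"(2))
    show "length (d # cs) = 1 \<Longrightarrow> port d c \<noteq> v" using "3.prems"(9) by auto
    assume "length (d # cs) \<noteq> 1"
    then obtain c' cs' where "cs = c' # cs'" by (cases cs) auto
    then show "port d c \<noteq> port (hd (d # cs)) ((d # cs) ! 1) \<and>
      v \<noteq> port (last (d # cs)) ((d # cs) ! (length (d # cs) - 2))"
      using "3.prems"(2,3,9) port_eq[of d c c'] by auto
  qed (use "3.prems" g in auto)
  then have "joins (edges - FE) (region FV ({c} \<union> set (d # cs))) u v"
    by (rule glue[OF 1]) (use "3.prems" g in auto)
  then show ?case by (simp add: insert_commute)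
qed simp

text \<open>Removing \<open>{a, x}\<close> and \<open>{b, y}\<close> from the contracted graph
  expresses that copy \<open>a\<close> is not left through its start vertex and copy
  \<open>b\<close> is not entered through its end vertex.\<close>

lemma route:
  assumes "joins (- (bad FV FE \<union> {{a, x}, {b, y}})) R a b" "R \<subseteq> S" "a \<noteq> b"
    and "\<And>c. c \<in> R \<Longrightarrow> linked FV FE c"
    and "port a x \<notin> FV" "port b y \<notin> FV" "x \<in> S" "y \<in> S" "x \<noteq> a" "y \<noteq> b"
  shows "joins (edges - FE) (region FV R) (port a x) (port b y)"
proof -
  obtain cs where cs: "hamiltonian_path R (- (bad FV FE \<union> {{a, x}, {b, y}})) a b cs"
    using assms(1) unfolding joins_def by blast
  have ab: "a \<in> S" "b \<in> S" using joins_in[OF assms(1)] assms(2) by auto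
  have p: "is_path (- bad FV FE) cs" by (rule is_path_mono[of "- (bad FV FE \<union> {{a, x}, {b, y}})"]) (use cs in \<open>auto simp: hamiltonian_path_def\<close>)
  have l: "length cs \<ge> 2" using cs assms(3) by (cases cs; cases "tl cs") (auto simp: hamiltonian_path_def)
  have 1: "{cs ! 0, cs ! 1} \<noteq> {a, x}" using cs l unfolding hamiltonian_path_def is_path_def by fastforce
  have "{cs ! (length cs - 2), cs ! Suc (length cs - 2)} \<in> - (bad FV FE \<union> {{a, x}, {b, y}})"
    using cs l unfolding hamiltonian_path_def is_path_def by simp
  then have 2: "{cs ! (length cs - 2), cs ! (length cs - 1)} \<noteq> {b, y}" using l by (auto simp: Suc_diff_le numeral_2_eq_2 Suc_diff_Suc)
  have e: "cs ! 0 = a" "cs ! (length cs - 1) = b" "cs \<noteq> []"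
    using cs by (auto simp: hamiltonian_path_def hd_conv_nth last_conv_nth)
  have ne: "cs ! 1 \<noteq> x" "cs ! (length cs - 2) \<noteq> y" using 1 2 e by (auto simp: insert_commute)
  have in_S: "cs ! 1 \<in> S" "cs ! (length cs - 2) \<in> S" using cs l assms(2) by (auto simp: hamiltonian_path_def)
  have "distinct cs" using cs by (simp add: hamiltonian_path_def)
  then have ne': "cs ! 1 \<noteq> a" "cs ! (length cs - 2) \<noteq> b"
    using e(3) l nth_eq_iff_index_eq[of cs 1 0] nth_eq_iff_index_eq[of cs "length cs - 2" "length cs - 1"]
    by (simp_all flip: e(1,2))
  have "joins (edges - FE) (region FV (set cs)) (port a x) (port b y)"
  proof (rule route_list)
    show "port a x \<noteq> port (hd cs) (cs ! 1) \<and> port b y \<noteq> port (last cs) (cs ! (length cs - 2))"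
      using cs ne ne' in_S ab assms(5-10) port_eq[of a x "cs ! 1"] port_eq[of b y "cs ! (length cs - 2)"]
      by (simp add: hamiltonian_path_def)
    show "port a x \<in> V (hd cs) - FV" "port b y \<in> V (last cs) - FV"
      using port_in[of a x] port_in[of b y] cs ab assms(5-10) by (simp_all add: hamiltonian_path_def)
    show "linked FV FE c" if "c \<in> set cs" for c
      using that assms(4)[of c] cs by (simp add: hamiltonian_path_def)
  qed (use cs l p assms(2) in \<open>simp_all add: hamiltonian_path_def\<close>)
  then show ?thesis using cs by (simp add: hamiltonian_path_def)
qed

text \<open>No edge inside \<open>A\<close> is bad, and \<open>{b, y}\<close> is not inside
  \<open>A\<close>, so only the first move is restricted: it goes to some \<open>g\<close> other
  than \<open>x\<close>, or straight to \<open>b\<close> when there is no third copy.\<close>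

lemma run_via:
  assumes A: "A \<subseteq> S" "a \<in> A" "b \<in> A" "a \<noteq> b" "\<And>c. c \<in> A \<Longrightarrow> linked FV FE c" "induced (bad FV FE) A = {}"
    and "port a x \<notin> FV" "port b y \<notin> FV" "x \<in> S" "y \<in> S" "x \<noteq> a" "y \<noteq> b"
    and "y \<notin> A" "(\<exists>g\<in>A. g \<noteq> a \<and> g \<noteq> b \<and> g \<noteq> x) \<or> A = {a, b} \<and> x \<noteq> b"
  shows "joins (edges - FE) (region FV A) (port a x) (port b y)"
proof (rule route)
  let ?F = "bad FV FE \<union> {{a, x}, {b, y}}"
  have fin: "finite A" using A(1) finite_S finite_subset by blast
  have good: "{a, g} \<notin> ?F" if "g \<in> A" "g \<noteq> a" "g \<noteq> x" for g
  proof -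
    have "{a, g} \<notin> bad FV FE" using that A induced_doubleton[of a A g "bad FV FE"] by blast
    moreover have "{a, g} \<noteq> {b, y}" using that assms by (auto simp: doubleton_eq_iff)
    ultimately show ?thesis using that by (auto simp: doubleton_eq_iff)
  qed
  show "joins (- ?F) A a b"
    using assms(14)
  proof
    assume "\<exists>g\<in>A. g \<noteq> a \<and> g \<noteq> b \<and> g \<noteq> x"
    then obtain g where g: "g \<in> A" "g \<noteq> a" "g \<noteq> b" "g \<noteq> x" by blast
    have "induced ?F (A - {a}) \<subseteq> induced (bad FV FE) A"
      using assms(13) unfolding induced_def by (auto simp: doubleton_eq_iff)
    then have "induced ?F (A - {a}) = {}" using A(6) by simp
    then have "joins (- ?F) (A - {a}) g b" using g A(3,4) fin by (intro joins_free) simp_all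
    then show ?thesis using good[of g] g A joins_Cons[of a g "- ?F" A b] by simp
  next
    assume "A = {a, b} \<and> x \<noteq> b"
    then have "{a, b} \<notin> ?F" "A - {a} = {b}" using good[of b] A by auto
    then show ?thesis using A joins_Cons[of a b "- ?F" A b] by simp
  qed
qed (simp_all add: assms(1,4,5,7-12))

text \<open>With \<open>x\<close> and \<open>y\<close> outside \<open>A\<close> neither forbidden
  edge lies inside \<open>A\<close>. A single copy is allowed as long as its two ports
  differ.\<close>

lemma run:
  assumes A: "A \<subseteq> S" "a \<in> A" "b \<in> A" "\<And>c. c \<in> A \<Longrightarrow> linked FV FE c" "induced (bad FV FE) A = {}"
    and "port a x \<notin> FV" "port b y \<notin> FV" "x \<in> S" "y \<in> S" "x \<notin> A" "y \<notin> A"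
    and "a = b \<Longrightarrow> A = {a} \<and> x \<noteq> y"
  shows "joins (edges - FE) (region FV A) (port a x) (port b y)"
proof (cases "a = b")
  case True
  then have 1: "A = {a}" "x \<noteq> y" using assms(12) by blast+
  have aS: "a \<in> S" "x \<noteq> a" "y \<noteq> a" using assms(1,2,10,11) by blast+
  have "port a x \<in> V a - FV" "port a y \<in> V a - FV" using port_in[of a] aS assms(6-9) True by auto
  moreover have "port a x \<noteq> port a y" using port_eq[of a x y] aS 1 assms(8,9) by simp
  ultimately show ?thesis using assms(4)[of a] True 1 by (simp add: linked_def)
next
  case False
  have via: "(\<exists>g\<in>A. g \<noteq> a \<and> g \<noteq> b \<and> g \<noteq> x) \<or> A = {a, b} \<and> x \<noteq> b"
    using assms(2,3,10) by blast
  have "x \<noteq> a" "y \<noteq> b" using assms(2,3,10,11) by blast+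
  then show ?thesis using run_via[OF assms(1-3) False assms(4-9) _ _ assms(11) via] by blast
qed

end

lemma joins_split_both:
  assumes "joins E W u v" "s \<in> W" "s \<noteq> u" "s \<noteq> v"
  shows "\<exists>r t. r \<noteq> t \<and> splits E W u v r s \<and> splits E W u v s t \<and> {r, s} \<in> E \<and> {s, t} \<in> E"
proof -
  obtain p where p: "hamiltonian_path W E u v p" using assms unfolding joins_def by blast
  then obtain q q' where pq: "p = q @ s # q'"
    using assms(2) split_list[of s p] by (auto simp: hamiltonian_path_def)
  have ne: "q \<noteq> []" "q' \<noteq> []" using p pq assms(3,4) by (auto simp: hamiltonian_path_def)
  have "splits E W u v (last q) s" using splitsI[of W E u v q "s # q'"] p pq ne by simp
  moreover have "splits E W u v s (hd q')" using splitsI[of W E u v "q @ [s]" q'] p pq ne by simp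
  moreover have "{last q, s} \<in> E" "{s, hd q'} \<in> E" "last q \<noteq> hd q'"
    using p pq ne by (cases q'; auto simp: hamiltonian_path_def is_path_append)+
  ultimately show ?thesis by blast
qed

text \<open>The edge between the ends of a path would close it, and with three or more vertices the
  path cannot contain it. This makes a forbidden end edge harmless when \<open>y\<close> is the
  start of the path.\<close>

lemma joins_remove_ends:
  assumes "joins E W u v" "3 \<le> card W"
  shows "joins (E - {{u, v}}) W u v"
proof -
  obtain p where p: "hamiltonian_path W E u v p" using assms unfolding joins_def by blast
  have l: "3 \<le> length p" using p assms(2) distinct_card[of p] by (simp add: hamiltonian_path_def)
  have "is_path (E - {{u, v}}) p"
  proof (rule is_path_Diff)
    show "is_path E p" using p by (simp add: hamiltonian_path_def)
  next
    fix q x y r assume pq: "p = q @ x # y # r"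
    show "{x, y} \<noteq> {u, v}"
    proof
      assume "{x, y} = {u, v}"
      then have "x = u \<and> y = v \<or> x = v \<and> y = u" by (simp add: doubleton_eq_iff)
      then show False
      proof
        assume a: "x = u \<and> y = v"
        have "q = []" using p pq a by (cases q) (auto simp: hamiltonian_path_def)
        moreover have "r = []" using p pq a by (cases r rule: rev_cases) (auto simp: hamiltonian_path_def)
        ultimately show False using l pq by simp
      next
        assume a: "x = v \<and> y = u"
        have "r = [] \<and> y = v \<or> r \<noteq> [] \<and> last r = v" using p pq by (auto simp: hamiltonian_path_def split: if_splits)
        then show False using p pq a by (auto simp: hamiltonian_path_def)
      qed
    qed
  qed
  then have "hamiltonian_path W (E - {{u, v}}) u v p" using p by (simp add: hamiltonian_path_def)
  then show ?thesis unfolding joins_def by blast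
qed

context cells
begin

text \<open>The path may leave copy \<open>a\<close> immediately, the rest of \<open>a\<close> being visited later: \<open>port a x\<close> is
  then treated as a faulty vertex.\<close>

lemma joins_leave_copy:
  assumes "joins (edges - FE) (region (insert (port a x) FV) S) (port x a) v"
    and "{a, x} \<notin> bad FV FE" "a \<in> S" "x \<in> S" "a \<noteq> x"
  shows "joins (edges - FE) (verts - FV) (port a x) v"
proof (rule joins_Cons)
  show "{port a x, port x a} \<in> edges - FE" using assms good_edge by blast
  have "region (insert (port a x) FV) S = verts - FV - {port a x}"
    unfolding region_S by blast
  then show "joins (edges - FE) (verts - FV - {port a x}) (port x a) v" using assms(1) by simp
  show "port a x \<in> verts - FV" using assms good_edge[of a x FV FE] unfolding verts_def by blast
qed

text \<open>Entering and leaving through the ports towards \<open>a\<close> costs nothing: the two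
  forbidden edges contain \<open>a\<close>, which is not visited.\<close>

lemma outside:
  assumes "joins (- bad FV FE) (S - {a}) c d" "a \<in> S" "c \<noteq> d" "\<And>k. k \<in> S - {a} \<Longrightarrow> linked FV FE k"
    and "{a, c} \<notin> bad FV FE" "{a, d} \<notin> bad FV FE"
  shows "joins (edges - FE) (region FV (S - {a})) (port c a) (port d a)"
proof (rule route)
  have cd: "c \<in> S - {a}" "d \<in> S - {a}" using joins_in[OF assms(1)] by auto
  show "port c a \<notin> FV" "port d a \<notin> FV"
    using good_edge[of c a FV FE] good_edge[of d a FV FE] cd assms by (auto simp: insert_commute)
  show "joins (- (bad FV FE \<union> {{c, a}, {d, a}})) (S - {a}) c d"
    by (rule joins_mono_edges[OF assms(1)]) (auto simp: doubleton_eq_iff)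
  show "a \<noteq> c" "a \<noteq> d" using cd by auto
qed (use assms in auto)

lemma closing:
  assumes "joins (edges - FE) (region FV {a}) (port a c) (port a d)"
    and "joins (edges - FE) (region FV (S - {a})) (port c a) (port d a)"
    and "{a, c} \<notin> bad FV FE" "{a, d} \<notin> bad FV FE" "a \<in> S" "c \<in> S - {a}" "d \<in> S - {a}" "c \<noteq> d"
  shows "hamiltonian (verts - FV) (edges - FE)"
proof -
  have "joins (edges - FE) (region FV ((S - {a}) \<union> {a})) (port c a) (port a c)"
    by (rule glue[OF assms(2) joins_rev[OF assms(1)]]) (use assms in \<open>auto simp: insert_commute\<close>)
  moreover have "(S - {a}) \<union> {a} = S" using assms(5) by blast
  ultimately have 1: "joins (edges - FE) (verts - FV) (port c a) (port a c)" by (simp add: region_S)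
  have g: "port c a \<in> V c - FV" "port a c \<in> V a - FV" "port a d \<in> V a - FV" "{port a c, port c a} \<in> edges - FE"
    using good_edge[of c a FV FE] good_edge[of a c FV FE] good_edge[of a d FV FE] assms(3-7)
    by (auto simp: insert_commute)
  have "port a c \<noteq> port a d" "port c a \<noteq> port a c" "port c a \<noteq> port a d"
    using port_eq[of a c d] port_in[of a c] port_in[of a d] port_notin[of c a a] assms(5-8) by auto
  then have "card {port c a, port a c, port a d} = 3" by simp
  moreover have "{port c a, port a c, port a d} \<subseteq> verts - FV" using g assms(5,6) unfolding verts_def by blast
  ultimately have "3 \<le> card (verts - FV)" using finite_verts by (metis card_mono finite_Diff)
  then show ?thesis using hamiltonianI[OF 1 g(4)] by simp
qed

end

section \<open>The induction hypothesis for the copies and the bookkeeping of faults\<close>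

text \<open>\<open>hc\<close> and \<open>ham\<close> are the induction hypothesis. For
  \<open>f > 0\<close> the second alternative of \<open>vd\<close> is an instance of
  \<open>hc\<close>; for \<open>f = 0\<close> it asks for one vertex fault more.\<close>

locale tolerant_cells = cells S V E port
  for S :: "'c set" and V :: "'c \<Rightarrow> 'v set" and E :: "'c \<Rightarrow> 'v set set" and port :: "'c \<Rightarrow> 'c \<Rightarrow> 'v" +
  fixes f t :: nat
  assumes card_S: "card S = t + 1" and t_ge: "f + 4 \<le> t"
    and hc: "i \<in> S \<Longrightarrow> X \<subseteq> V i \<Longrightarrow> finite Y \<Longrightarrow> card X + card Y \<le> f \<Longrightarrow> u \<in> V i - X \<Longrightarrow> v \<in> V i - X \<Longrightarrow> u \<noteq> v \<Longrightarrow>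
      joins (E i - Y) (V i - X) u v"
    and ham: "i \<in> S \<Longrightarrow> X \<subseteq> V i \<Longrightarrow> finite Y \<Longrightarrow> card X + card Y \<le> f + 1 \<Longrightarrow> hamiltonian (V i - X) (E i - Y)"
    and vd: "f + 7 \<le> t \<or> (\<forall>i\<in>S. \<forall>w\<in>V i. \<forall>u\<in>V i - {w}. \<forall>v\<in>V i - {w}. u \<noteq> v \<longrightarrow> joins (E i) (V i - {w}) u v)"
begin

lemma card_V_t: "i \<in> S \<Longrightarrow> card (V i) = t"
  using card_V[of i] card_S by simp

lemma card_T: "i \<in> S \<Longrightarrow> card (S - {i}) = t"
  using card_S finite_S by simp

end

locale faulty_cells = tolerant_cells S V E port f t
  for S :: "'c set" and V :: "'c \<Rightarrow> 'v set" and E :: "'c \<Rightarrow> 'v set set" and port :: "'c \<Rightarrow> 'c \<Rightarrow> 'v"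
    and f t :: nat +
  fixes FV :: "'v set" and FE :: "'v set set"
  assumes FV: "FV \<subseteq> verts" and FE: "FE \<subseteq> edges"
begin

text \<open>Faulty cross edges are charged to no copy.\<close>

definition phi :: "'c \<Rightarrow> nat" where
  "phi c = card (FV \<inter> V c) + card (FE \<inter> E c)"

lemma finite_F: "finite FV" "finite FE"
  using FV FE finite_verts finite_edges finite_subset by blast+

lemma E_minus_sub: "c \<in> S \<Longrightarrow> E c - (FE \<inter> E c) \<subseteq> edges - FE"
  unfolding edges_def by blast

lemma linked_if: "c \<in> S \<Longrightarrow> phi c \<le> f \<Longrightarrow> linked FV FE c"
  unfolding linked_def
proof (intro ballI impI)
  fix s v assume c: "c \<in> S" "phi c \<le> f" "s \<in> V c - FV" "v \<in> V c - FV" "s \<noteq> v"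
  then have "joins (E c - (FE \<inter> E c)) (V c - (FV \<inter> V c)) s v"
    using hc[of c "FV \<inter> V c" "FE \<inter> E c" s v] finite_F by (simp add: phi_def)
  moreover have "V c - (FV \<inter> V c) = V c - FV" by blast
  ultimately show "joins (edges - FE) (V c - FV) s v"
    using joins_mono[of "E c - (FE \<inter> E c)" _ _ _ "edges - FE"] E_minus_sub[OF c(1)] by (metis subsetD)
qed

lemma hamiltonian_if: "c \<in> S \<Longrightarrow> phi c \<le> f + 1 \<Longrightarrow> hamiltonian (V c - FV) (edges - FE)"
proof -
  assume c: "c \<in> S" "phi c \<le> f + 1"
  then have "hamiltonian (V c - (FV \<inter> V c)) (E c - (FE \<inter> E c))"
    using ham[of c "FV \<inter> V c" "FE \<inter> E c"] finite_F by (simp add: phi_def)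
  moreover have "V c - (FV \<inter> V c) = V c - FV" by blast
  ultimately show ?thesis
    using hamiltonian_mono[of _ "E c - (FE \<inter> E c)" "edges - FE"] E_minus_sub[OF c(1)] by (metis subsetD)
qed

lemma phi_split: "phi a + card (FV - V a) + card (FE - E a) = card FV + card FE"
proof -
  have "card (FV \<inter> V a) + card (FV - V a) = card FV" "card (FE \<inter> E a) + card (FE - E a) = card FE"
    using card_Un_disjoint[of "FV \<inter> V a" "FV - V a"] card_Un_disjoint[of "FE \<inter> E a" "FE - E a"] finite_F
    by (simp_all add: Int_Diff_Un Int_Diff_disjoint)
  then show ?thesis by (simp add: phi_def)
qed

lemma E_disjoint: "i \<in> S \<Longrightarrow> j \<in> S \<Longrightarrow> i \<noteq> j \<Longrightarrow> E i \<inter> E j = {}"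
  using E_sub[of i] E_sub[of j] disjoint_V[of i j] by blast

lemma phi_two: "i \<in> S \<Longrightarrow> j \<in> S \<Longrightarrow> i \<noteq> j \<Longrightarrow> phi i + phi j \<le> card FV + card FE"
proof -
  assume ij: "i \<in> S" "j \<in> S" "i \<noteq> j"
  have "card (FV \<inter> V j) \<le> card (FV - V i)" "card (FE \<inter> E j) \<le> card (FE - E i)"
    by (rule card_mono; use finite_F disjoint_V[OF ij] E_disjoint[OF ij] in blast)+
  then show ?thesis using phi_split[of i] unfolding phi_def by linarith
qed

text \<open>Faults inside \<open>a\<close> are paid by \<open>phi a\<close>, every other fault by at
  most one bad edge. Many faults in \<open>a\<close> thus leave few bad edges that are not due to
  vertices of \<open>a\<close>.\<close>

lemma outer: "a \<in> S \<Longrightarrow> card (bad (FV - V a) FE) + phi a \<le> card FV + card FE"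
  using card_bad[of "FV - V a" FE a] phi_split[of a] finite_F by simp

lemma card_bad_le: "card (bad FV FE) \<le> card FV + card FE"
proof -
  obtain a where "a \<in> S" using card_S by fastforce
  then have "card (bad FV FE) \<le> card FV + card (FE - E a)" using card_bad finite_F by blast
  also have "card (FE - E a) \<le> card FE" using finite_F by (intro card_mono) auto
  finally show ?thesis by simp
qed

lemma bad_outer:
  assumes "e \<in> bad FV FE" "a \<notin> e" "a \<in> S"
  shows "e \<in> bad (FV - V a) FE"
proof -
  obtain i j where ij: "e = {i, j}" "i \<in> S" "j \<in> S" "i \<noteq> j"
    "port i j \<in> FV \<or> port j i \<in> FV \<or> {port i j, port j i} \<in> FE"
    using assms(1) by (rule bad_doubleton)
  moreover have "port i j \<notin> V a" "port j i \<notin> V a"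
    using port_notin[of i j a] port_notin[of j i a] ij assms(2,3) by auto
  ultimately show ?thesis unfolding bad_def by blast
qed

lemma bad_outer_port:
  assumes "{a, j} \<in> bad FV FE" "a \<in> S" "j \<in> S" "j \<noteq> a" "port a j \<notin> FV"
  shows "{a, j} \<in> bad (FV - V a) FE"
  using assms bad_sym[of a j FV FE] bad_sym[of a j "FV - V a" FE] port_notin[of j a a] port_in[of j a] V_unique[of _ j a] by auto

section \<open>No copy with more than f faults\<close>

text \<open>The exceptional case of the two-sided argument forces \<open>x = y\<close>,
  \<open>t = f + 4\<close>, f + 1 bad edges, none of them at \<open>a\<close>, and hence no fault in
  \<open>a\<close>. The path then steps from \<open>u\<close> directly to copy \<open>x\<close>, and
  copy \<open>a\<close> without \<open>u\<close> is visited later by means of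
  \<open>vd\<close>.\<close>

lemma hc_different_copies:
  assumes tot: "card FV + card FE \<le> f + 1" and phi: "\<And>c. c \<in> S \<Longrightarrow> phi c \<le> f"
    and ab: "a \<in> S" "b \<in> S" "a \<noteq> b" and u: "u \<in> V a - FV" and v: "v \<in> V b - FV"
  shows "joins (edges - FE) (verts - FV) u v"
proof -
  obtain x where x: "x \<in> S" "x \<noteq> a" "u = port a x" using port_ex[of a u] u ab by blast
  obtain y where y: "y \<in> S" "y \<noteq> b" "v = port b y" using port_ex[of b v] v ab by blast
  let ?F = "bad FV FE \<union> {{a, x}, {b, y}}"
  let ?I = "induced ?F S - {{a, x}, {b, y}}"
  have sub: "?I \<subseteq> bad FV FE" by (auto simp: induced_def)
  have cb: "card (bad FV FE) \<le> f + 1" using card_bad_le tot by linarith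
  have cI: "card ?I \<le> f + 1" using card_mono[OF finite_bad sub] cb by linarith
  have link: "linked FV FE c" if "c \<in> S" for c using linked_if phi that by blast
  show ?thesis
  proof (cases "x \<noteq> y \<or> card ?I + 5 \<le> card S \<or> (\<exists>e\<in>?I. a \<in> e \<or> b \<in> e)")
    case True
    have "joins (- ?F) S a b"
      by (rule joins_two_sided[OF finite_S ab]) (use True cI card_S t_ge in auto)
    then have "joins (edges - FE) (region FV S) (port a x) (port b y)"
      by (rule route) (use link ab u v x y in auto)
    then show ?thesis using x y by (simp add: region_S)
  next
    case False
    then have xy: "x = y" and none: "\<And>e. e \<in> ?I \<Longrightarrow> a \<notin> e" and c5: "card S < card ?I + 5" by auto
    have t: "t = f + 4" and full: "card ?I = f + 1" using c5 cI card_S t_ge by linarith+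
    then have eq: "?I = bad FV FE" using card_subset_eq[OF finite_bad sub] card_mono[OF finite_bad sub] cb by linarith
    then have none': "a \<notin> e" if "e \<in> bad FV FE" for e using none that by blast
    \<comment> \<open>At most f + 1 faults cause f + 1 bad edges, so no fault is wasted; a faulty
      edge inside \<open>a\<close> would be.\<close>
    have "card (bad FV FE) \<le> card FV + card (FE - E a)" using card_bad finite_F ab by blast
    then have "card (FE - E a) = card FE"
      using full eq tot card_mono[of FE "FE - E a"] finite_F by fastforce
    then have "FE - E a = FE" using card_subset_eq[of FE "FE - E a"] finite_F by blast
    then have FEa: "FE \<inter> E a = {}" by blast
    have FVa: "FV \<inter> V a = {}"
    proof (rule ccontr)
      assume "FV \<inter> V a \<noteq> {}"
      then obtain j where j: "j \<in> S" "j \<noteq> a" "port a j \<in> FV" using port_ex[of a] ab(1) by blast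
      then have "{a, j} \<in> bad FV FE" using bad_sym[of a j] ab(1) by simp
      then show False using none' by blast
    qed
    have VD: "joins (E a) (V a - {u}) p q" if "p \<in> V a - {u}" "q \<in> V a - {u}" "p \<noteq> q" for p q
    proof -
      have "\<not> f + 7 \<le> t" using t by simp
      then show ?thesis using vd ab(1) u that by blast
    qed
    let ?FV' = "insert u FV"
    have link': "linked ?FV' FE c" if "c \<in> S" for c
    proof (cases "c = a")
      case True
      have "V a - ?FV' = V a - {u}" using FVa by blast
      moreover have "joins (edges - FE) (V a - {u}) p q" if "p \<in> V a - {u}" "q \<in> V a - {u}" "p \<noteq> q" for p q
        by (rule joins_mono[OF VD[OF that]]) (use FEa ab(1) edges_def in auto)
      ultimately show ?thesis using True by (simp add: linked_def)
    next
      case False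
      then have "u \<notin> V c" using V_unique[of u a c] u ab(1) that by blast
      then have "V c - ?FV' = V c - FV" by blast
      then show ?thesis using link[OF that] by (simp add: linked_def)
    qed
    have xb: "x \<noteq> b" using xy y(2) by simp
    have bad': "bad ?FV' FE \<subseteq> insert {x, a} (bad FV FE)"
    proof
      fix e assume "e \<in> bad ?FV' FE"
      then obtain i j where ij: "e = {i, j}" "i \<in> S" "j \<in> S" "i \<noteq> j"
        "port i j \<in> ?FV' \<or> port j i \<in> ?FV' \<or> {port i j, port j i} \<in> FE" by (rule bad_doubleton)
      have 1: "{p, q} = {x, a}" if "port p q = u" "p \<in> S" "q \<in> S" "p \<noteq> q" for p q
      proof -
        have "p = a" using that u port_in[of p q] V_unique[of u p a] ab(1) by simp
        then have "q = x" using that x port_eq[of a q x] ab(1) by simp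
        then show ?thesis using \<open>p = a\<close> by blast
      qed
      show "e \<in> insert {x, a} (bad FV FE)"
      proof (cases "{i, j} = {x, a}")
        case False
        then have "port i j \<noteq> u" "port j i \<noteq> u" using 1[of i j] 1[of j i] ij by (auto simp: insert_commute)
        then show ?thesis using ij bad_sym[of i j] by simp
      qed (use ij in simp)
    qed
    \<comment> \<open>Deleting \<open>u\<close> as well makes only \<open>{x, a}\<close> bad, and at
      the new start \<open>x\<close> this edge is exempt.\<close>
    have "card (induced (bad ?FV' FE \<union> {{x, a}}) S - {{x, a}}) \<le> card (bad FV FE)"
      by (rule card_mono[OF finite_bad]) (use bad' in \<open>auto simp: induced_def\<close>)
    then have "card (induced (bad ?FV' FE \<union> {{x, a}}) S - {{x, a}}) + 4 \<le> card S"
      using cb card_S t by linarith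
    then have "joins (- (bad ?FV' FE \<union> {{x, a}})) S x b"
      using joins_one_sided[of S x b "bad ?FV' FE \<union> {{x, a}}" a] finite_S x(1) ab(2) xb by blast
    \<comment> \<open>Because of \<open>x = y\<close>, the edge forbidden at \<open>b\<close> joins
      the two ends of this path and is avoided automatically.\<close>
    then have "joins (- (bad ?FV' FE \<union> {{x, a}}) - {{x, b}}) S x b"
      by (rule joins_remove_ends) (use card_S t in simp)
    moreover have "- (bad ?FV' FE \<union> {{x, a}}) - {{x, b}} = - (bad ?FV' FE \<union> {{x, a}, {b, y}})"
      using xy by (auto simp: insert_commute)
    ultimately have r: "joins (- (bad ?FV' FE \<union> {{x, a}, {b, y}})) S x b" by simp
    have pxa: "{a, x} \<notin> bad FV FE" using none' by blast
    have "port x a \<notin> FV" using pxa bad_sym[of a x FV FE] ab(1) x by simp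
    moreover have "port x a \<noteq> u" using x(1,2) port_notin[of x a a] u ab(1) by auto
    moreover have "v \<noteq> u" using u v ab V_unique[of u a b] by auto
    ultimately have "joins (edges - FE) (region ?FV' S) (port x a) (port b y)"
      by (intro route[OF r]) (use link' ab x y xb v in auto)
    then show ?thesis using joins_leave_copy[of FE a x FV v] pxa ab(1) x y(3) by auto
  qed
qed

end

context faulty_cells
begin

text \<open>A cycle of the contracted graph tolerates \<open>card S - 3\<close> bad edges, which is
  at least f + 2; nothing is forbidden at ends, so it lifts directly.\<close>

lemma hamiltonian_if_spread:
  assumes tot: "card FV + card FE \<le> f + 2" and phi: "\<And>c. c \<in> S \<Longrightarrow> phi c \<le> f"
  shows "hamiltonian (verts - FV) (edges - FE)"
proof -
  have "card (induced (bad FV FE) S) \<le> card (bad FV FE)"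
    by (rule card_mono[OF finite_bad]) (auto simp: induced_def)
  then have "card (induced (bad FV FE) S) + 3 \<le> card S" using card_bad_le tot card_S t_ge by linarith
  then obtain w p q where w: "w \<in> S" "p \<noteq> q" "{w, p} \<notin> bad FV FE" "{w, q} \<notin> bad FV FE"
    "joins (- bad FV FE) (S - {w}) p q"
    using joins_closed[of S "bad FV FE"] finite_S card_S t_ge by auto
  have pq: "p \<in> S - {w}" "q \<in> S - {w}" using joins_in[OF w(5)] by auto
  have link: "linked FV FE c" if "c \<in> S" for c using linked_if phi that by blast
  have "port w p \<in> V w - FV" "port w q \<in> V w - FV" "port w p \<noteq> port w q"
    using good_edge[of w p FV FE] good_edge[of w q FV FE] port_eq[of w p q] w pq by auto
  then have 1: "joins (edges - FE) (region FV {w}) (port w p) (port w q)"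
    using link[OF w(1)] by (simp add: linked_def)
  have "joins (edges - FE) (region FV (S - {w})) (port p w) (port q w)"
    using outside[OF w(5,1,2)] link w by blast
  then show ?thesis using closing[OF 1] w pq by blast
qed

text \<open>A path of copy \<open>a\<close> from \<open>u\<close> to \<open>v\<close> is broken at
  two consecutive vertices with usable cross edges, and all other copies are inserted there.
  \<open>D\<close> collects the intact vertices of \<open>a\<close> whose cross edge is unusable.
  Bad edges away from \<open>a\<close>, the set \<open>D\<close> and the faults of \<open>a\<close>
  share the budget f + 1.\<close>

lemma hc_same_copy:
  assumes tot: "card FV + card FE \<le> f + 1" and phi: "\<And>c. c \<in> S \<Longrightarrow> phi c \<le> f"
    and a: "a \<in> S" and u: "u \<in> V a - FV" and v: "v \<in> V a - FV" and uv: "u \<noteq> v"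
  shows "joins (edges - FE) (verts - FV) u v"
proof -
  let ?R = "S - {a}" and ?W = "V a - FV" and ?G = "edges - FE"
  have link: "linked FV FE c" if "c \<in> S" for c using linked_if phi that by blast
  define O' where "O' = bad (FV - V a) FE"
  have finO: "finite O'" by (simp add: O'_def finite_bad)
  have cO: "card O' + phi a \<le> f + 1" using outer[OF a] tot by (simp add: O'_def)
  define D where "D = {w \<in> ?W. \<exists>j\<in>?R. w = port a j \<and> {a, j} \<in> bad FV FE}"
  have finW: "finite ?W" using finite_V[OF a] by simp
  have finD: "finite D" by (rule finite_subset[OF _ finW]) (auto simp: D_def)
  \<comment> \<open>An intact vertex of \<open>a\<close> lies in \<open>D\<close> only because of a
    fault that is not a vertex of \<open>a\<close>, and the bad edge \<open>{a, j}\<close>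
    determines the vertex.\<close>
  have "card D \<le> card {e \<in> O'. a \<in> e}"
  proof (rule surj_card_le)
    show "D \<subseteq> (\<lambda>e. port a (THE j. j \<noteq> a \<and> j \<in> e)) ` {e \<in> O'. a \<in> e}"
    proof
      fix w assume "w \<in> D"
      then obtain j where j: "j \<in> ?R" "w = port a j" "{a, j} \<in> bad FV FE" "w \<notin> FV" by (auto simp: D_def)
      then have "{a, j} \<in> O'" using bad_outer_port[of a j] a by (simp add: O'_def)
      moreover have "(THE k. k \<noteq> a \<and> k \<in> {a, j}) = j" using j(1) by (intro the_equality) auto
      ultimately show "w \<in> (\<lambda>e. port a (THE j. j \<noteq> a \<and> j \<in> e)) ` {e \<in> O'. a \<in> e}"
        using j(2) by (intro image_eqI[of _ _ "{a, j}"]) auto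
    qed
  qed (use finO in simp)
  then have count: "card {e \<in> O'. a \<notin> e} + card D + phi a \<le> f + 1"
    using card_split_at[OF finO, of a] cO by linarith
  have sub: "induced (bad FV FE) ?R \<subseteq> {e \<in> O'. a \<notin> e}"
    using bad_outer[OF _ _ a] by (auto simp: induced_def O'_def)
  have cI: "card (induced (bad FV FE) ?R) \<le> card {e \<in> O'. a \<notin> e}"
    by (rule card_mono) (use sub finO in auto)
  have finR: "finite ?R" "card ?R = t" using finite_S card_T[OF a] by auto
  have port_W: "\<exists>j\<in>?R. w = port a j" if "w \<in> ?W" for w using port_ex[OF a] that by blast
  have goodD: "{a, j} \<notin> bad FV FE" if "port a j \<in> ?W" "port a j \<notin> D" "j \<in> ?R" for j
    using that by (auto simp: D_def)
  have finish: "joins ?G (verts - FV) u v"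
    if "splits ?G ?W u v (port a c) (port a d)" "c \<in> ?R" "d \<in> ?R" "port a c \<notin> D" "port a d \<notin> D"
      "joins (- bad FV FE) ?R c d" for c d
  proof -
    have in_W: "port a c \<in> ?W" "port a d \<in> ?W" "port a c \<noteq> port a d" using splits_in[OF that(1)] by auto
    have g: "{a, c} \<notin> bad FV FE" "{a, d} \<notin> bad FV FE" using goodD in_W that by auto
    have "joins ?G (region FV ?R) (port c a) (port d a)"
      by (rule outside[OF that(6) a _ _ g]) (use in_W link in auto)
    then have "joins ?G (?W \<union> region FV ?R) u v"
      using splits_joins[OF that(1), of "port c a" "region FV ?R" "port d a"] good_edge[of a c FV FE] good_edge[of a d FV FE]
        g that(2,3) a region_disjoint[of "{a}" ?R FV] by (auto simp: insert_commute)
    moreover have "?W \<union> region FV ?R = verts - FV" using a unfolding region_def verts_def by blast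
    ultimately show ?thesis by simp
  qed
  show ?thesis
  proof (cases "card (induced (bad FV FE) ?R) + 4 \<le> t")
    case True
    have connect: "joins (- bad FV FE) ?R c d" if "c \<in> ?R" "d \<in> ?R" "c \<noteq> d" for c d
    proof (rule joins_one_sided[OF finR(1) that])
      have "card (induced (bad FV FE) ?R - {{c, c}}) \<le> card (induced (bad FV FE) ?R)"
        by (rule card_mono) (use finR in auto)
      then show "card (induced (bad FV FE) ?R - {{c, c}}) + 4 \<le> card ?R" using True finR by linarith
    qed
    have cW: "card ?W + card (FV \<inter> V a) = t"
    proof -
      have "(V a - FV) \<union> (FV \<inter> V a) = V a" "(V a - FV) \<inter> (FV \<inter> V a) = {}" by blast+
      then show ?thesis
        using card_Un_disjoint[of "V a - FV" "FV \<inter> V a"] finite_V[OF a] card_V_t[OF a] by simp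
    qed
    have "card (D \<union> {u, v}) \<le> card D + 2"
      using card_Un_le[of D "{u, v}"] card_insert_le_m1 by (simp add: uv)
    also have "\<dots> < card ?W" using cW count t_ge unfolding phi_def by linarith
    finally have "\<not> ?W \<subseteq> D \<union> {u, v}" using finD by (metis card_mono finite.emptyI finite.insertI finite_UnI not_le)
    then obtain p where p: "p \<in> ?W" "p \<notin> D" "p \<noteq> u" "p \<noteq> v" by blast
    \<comment> \<open>Deleting the edges from \<open>p\<close> to \<open>D\<close> would keep the
      path neighbours of \<open>p\<close> out of \<open>D\<close>, but could need f + 1 faults. One
      vertex \<open>d0\<close> is spared; only one of the two neighbours of \<open>p\<close> can be
      \<open>d0\<close>, so the other is outside \<open>D\<close>.\<close>
    obtain d0 where d0: "D \<noteq> {} \<Longrightarrow> d0 \<in> D" by blast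
    define Y where "Y = (FE \<inter> E a) \<union> (\<lambda>d. {p, d}) ` (D - {d0})"
    have "card Y \<le> card (FE \<inter> E a) + card (D - {d0})"
      unfolding Y_def by (rule order_trans[OF card_Un_le]) (use finD in \<open>auto intro: card_image_le\<close>)
    moreover have "card (FV \<inter> V a) + card (FE \<inter> E a) + card (D - {d0}) \<le> f"
    proof (cases "D = {}")
      case True
      then show ?thesis using phi[OF a] by (simp add: phi_def)
    next
      case False
      then have "card (D - {d0}) + 1 = card D" using d0 finD card_Suc_Diff1[of D d0] by simp
      then show ?thesis using count by (simp add: phi_def)
    qed
    ultimately have "card (FV \<inter> V a) + card Y \<le> f" by linarith
    then have "joins (E a - Y) (V a - (FV \<inter> V a)) u v"
      using finD finite_F u v uv by (intro hc[OF a]) (auto simp: Y_def)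
    moreover have "V a - (FV \<inter> V a) = ?W" by blast
    ultimately obtain r s where rs: "r \<noteq> s" "splits (E a - Y) ?W u v r p" "splits (E a - Y) ?W u v p s"
      "{r, p} \<in> E a - Y" "{p, s} \<in> E a - Y"
      using joins_split_both[of "E a - Y" ?W u v p] p by metis
    have EG: "e \<in> ?G" if "e \<in> E a - Y" for e using that a by (auto simp: Y_def edges_def)
    have sp: "splits ?G ?W u v r p" "splits ?G ?W u v p s"
      using splits_mono[OF rs(2), of ?G] splits_mono[OF rs(3), of ?G] EG by blast+
    have "r = d0" if "r \<in> D" using rs(4) that by (auto simp: Y_def insert_commute)
    moreover have "s = d0" if "s \<in> D" using rs(5) that by (auto simp: Y_def)
    ultimately have "r \<notin> D \<or> s \<notin> D" using rs(1) by blast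
    moreover obtain c where c: "c \<in> ?R" "p = port a c" using port_W p by blast
    ultimately show ?thesis
    proof (elim disjE)
      assume "r \<notin> D"
      moreover obtain d where d: "d \<in> ?R" "r = port a d" using port_W splits_in[OF sp(1)] by blast
      moreover have "c \<noteq> d" using c d splits_in[OF sp(1)] by blast
      ultimately show ?thesis using finish[of d c] sp(1) c p(2) connect[of d c] by blast
    next
      assume "s \<notin> D"
      moreover obtain d where d: "d \<in> ?R" "s = port a d" using port_W splits_in[OF sp(2)] by blast
      moreover have "c \<noteq> d" using c d splits_in[OF sp(2)] by blast
      ultimately show ?thesis using finish[of c d] sp(2) c p(2) connect[of c d] by blast
    qed
  next
    case False
    \<comment> \<open>The other copies now carry the whole budget of f + 1 bad edges, so
      \<open>a\<close> is free of faults and \<open>D\<close> is empty. An end \<open>c\<close> of a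
      bad edge is taken as one end of the detour, where that edge is exempt.\<close>
    then have zero: "card D = 0" "phi a = 0" and cI2: "card (induced (bad FV FE) ?R) \<le> f + 1"
      using count cI t_ge by linarith+
    have D: "D = {}" and FVa: "FV \<inter> V a = {}" using zero finD finite_F by (simp_all add: phi_def)
    have "induced (bad FV FE) ?R \<noteq> {}" using False t_ge by auto
    then obtain e where e: "e \<in> induced (bad FV FE) ?R" by (meson equals0I)
    then obtain c z where cz: "e = {c, z}" "c \<in> ?R" unfolding induced_def by blast
    have connect: "joins (- bad FV FE) ?R c d" if "d \<in> ?R" "d \<noteq> c" for d
    proof (rule joins_one_sided[OF finR(1) cz(2) that(1)])
      have "card (induced (bad FV FE) ?R - {e}) + 1 = card (induced (bad FV FE) ?R)"
        using card_Suc_Diff1[OF _ e] finR by simp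
      then show "card (induced (bad FV FE) ?R - {{c, z}}) + 4 \<le> card ?R" using cI2 finR t_ge cz(1) by simp
    qed (use that in auto)
    define p where "p = port a c"
    have p: "p \<in> ?W" using FVa port_in[of a c] a cz(2) by (auto simp: p_def)
    have P: "joins ?G ?W u v" using link[OF a] u v uv by (simp add: linked_def)
    show ?thesis
    proof (cases "p = v")
      case False
      then obtain s where s: "splits ?G ?W u v p s" using joins_split_after[OF P p] by blast
      obtain d where d: "d \<in> ?R" "s = port a d" using port_W splits_in[OF s] by blast
      moreover have "d \<noteq> c" using d splits_in[OF s] p_def by blast
      ultimately show ?thesis using finish[of c d] s cz(2) connect[of d] D by (simp add: p_def)
    next
      case True
      then obtain s where s: "splits ?G ?W u v s p" using joins_split_before[OF P p] uv by blast
      obtain d where d: "d \<in> ?R" "s = port a d" using port_W splits_in[OF s] by blast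
      moreover have "d \<noteq> c" using d splits_in[OF s] p_def by blast
      ultimately show ?thesis using finish[of d c] s cz(2) joins_rev[OF connect[of d]] D by (simp add: p_def)
    qed
  qed
qed

text \<open>Copy \<open>i\<close> still has a Hamiltonian cycle, and at most one further fault
  exists. The cycle is opened between two neighbours whose cross edges are usable and closed through
  the other copies.\<close>

lemma hamiltonian_if_one_full:
  assumes tot: "card FV + card FE \<le> f + 2" and i: "i \<in> S" "phi i = f + 1"
    and phi: "\<And>c. c \<in> S - {i} \<Longrightarrow> phi c \<le> f"
  shows "hamiltonian (verts - FV) (edges - FE)"
proof -
  let ?T = "S - {i}" and ?W = "V i - FV" and ?G = "edges - FE"
  define O' where "O' = bad (FV - V i) FE"
  have finO: "finite O'" by (simp add: O'_def finite_bad)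
  have cO: "card O' \<le> 1" using outer[OF i(1)] tot i(2) by (simp add: O'_def)
  then have single: "e = e'" if "e \<in> O'" "e' \<in> O'" for e e'
    using that finO card_le_Suc0_iff_eq by (metis One_nat_def)
  have link: "linked FV FE c" if "c \<in> ?T" for c using linked_if phi that by blast
  have hamW: "hamiltonian ?W ?G" using hamiltonian_if[OF i(1)] i(2) by simp
  have finT: "finite ?T" "card ?T = t" using finite_S card_T[OF i(1)] by auto
  have port_W: "\<exists>j\<in>?T. w = port i j" if "w \<in> ?W" for w using port_ex[OF i(1)] that by blast
  have finish: "hamiltonian (verts - FV) ?G"
    if "joins ?G ?W (port i c) (port i d)" "c \<in> ?T" "d \<in> ?T" "c \<noteq> d" "{i, c} \<notin> bad FV FE" "{i, d} \<notin> bad FV FE"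
      "joins (- bad FV FE) ?T c d" for c d
  proof -
    have "joins ?G (region FV ?T) (port c i) (port d i)"
      by (rule outside[OF that(7) i(1)]) (use that link in auto)
    then show ?thesis using closing[of FE FV i c d] that i(1) by simp
  qed
  have nbs: "\<exists>c d. c \<in> ?T \<and> d \<in> ?T \<and> c \<noteq> d \<and> port i c \<noteq> r \<and> port i d \<noteq> r \<and>
      joins ?G ?W w (port i c) \<and> joins ?G ?W w (port i d)" if "w \<in> ?W" "r = w" for w r
    using hamiltonian_two_neighbours[OF hamW that(1)] port_W joins_in that(2) by metis
  have W3: "3 \<le> card ?W" by (rule hamiltonian_card[OF hamW])
  have finW: "finite ?W" using finite_V[OF i(1)] by simp
  show ?thesis
  proof (cases "induced (bad FV FE) ?T = {}")
    case True
    obtain z where z: "\<And>q. q \<in> ?T \<Longrightarrow> port i q \<notin> FV \<Longrightarrow> {i, q} \<in> bad FV FE \<Longrightarrow> port i q = z"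
    proof (cases "\<exists>q0\<in>?T. {i, q0} \<in> O'")
      case True
      then obtain q0 where q0: "q0 \<in> ?T" "{i, q0} \<in> O'" by blast
      have "port i q = port i q0" if "q \<in> ?T" "port i q \<notin> FV" "{i, q} \<in> bad FV FE" for q
      proof -
        have "{i, q} \<in> O'" using bad_outer_port[of i q] that i(1) by (simp add: O'_def)
        then have "{i, q} = {i, q0}" using single q0(2) by blast
        then show ?thesis by (auto simp: doubleton_eq_iff)
      qed
      then show thesis by (rule that)
    next
      case False
      \<comment> \<open>In this case no intact port of \<open>i\<close> has a bad cross edge, so the
        value of \<open>z\<close> is arbitrary.\<close>
      then have "port i q = port i i" if "q \<in> ?T" "port i q \<notin> FV" "{i, q} \<in> bad FV FE" for q
        using bad_outer_port[of i q] that i(1) by (simp add: O'_def)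
      then show thesis by (rule that)
    qed
    have "\<not> ?W \<subseteq> {z}" using W3 card_mono[of "{z}" ?W] by auto
    then obtain w where w: "w \<in> ?W" "w \<noteq> z" by blast
    obtain c where c: "c \<in> ?T" "w = port i c" using port_W w by blast
    obtain d where d: "d \<in> ?T" "port i d \<noteq> w" "joins ?G ?W w (port i d)" "port i d \<noteq> z"
      using nbs[OF w(1) refl] port_eq[of i] i(1) by (metis DiffE insertI1)
    have "joins (- bad FV FE) ?T c d" using finT c d True by (intro joins_free) auto
    moreover have "port i d \<in> ?W" using joins_in[OF d(3)] by blast
    ultimately show ?thesis using finish[of c d] z[of c] z[of d] c d w by auto
  next
    case False
    then obtain e where e: "e \<in> induced (bad FV FE) ?T" by (meson equals0I)
    have subO: "induced (bad FV FE) ?T \<subseteq> O'"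
      using bad_outer[OF _ _ i(1)] by (auto simp: induced_def O'_def)
    then have only: "induced (bad FV FE) ?T = {e}" using e single by blast
    have eO: "e \<in> O'" "i \<notin> e" using e subO by (auto simp: induced_def)
    have good: "{i, q} \<notin> bad FV FE" if "q \<in> ?T" "port i q \<notin> FV" for q
    proof
      assume "{i, q} \<in> bad FV FE"
      then have "{i, q} \<in> O'" using bad_outer_port[of i q] that i(1) by (simp add: O'_def)
      then show False using single eO by blast
    qed
    obtain p z where pz: "e = {p, z}" "p \<in> ?T" "z \<in> ?T" "p \<noteq> z" using e unfolding induced_def by blast
    \<comment> \<open>With one bad edge the other \<open>t\<close> copies stay Hamiltonian-connected
      for \<open>t \<ge> 5\<close>; for \<open>t = 4\<close> the route must start at an end of that
      edge, where it is exempt.\<close>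
    have via: ?thesis if w: "w \<in> ?W" "w = port i c" "c \<in> ?T" and cc: "t \<ge> 5 \<or> c \<in> {p, z}" for w c
    proof -
      obtain d where d: "d \<in> ?T" "port i d \<noteq> w" "joins ?G ?W w (port i d)"
        using nbs[OF w(1) refl] by blast
      have "port i d \<in> ?W" using joins_in[OF d(3)] by blast
      moreover obtain z' where z': "card (induced (bad FV FE) ?T - {{c, z'}}) + 4 \<le> card ?T"
      proof (cases "t \<ge> 5")
        case True
        have "card (induced (bad FV FE) ?T - {{c, c}}) \<le> card {e}"
          unfolding only by (rule card_mono) auto
        then show thesis using True finT by (intro that[of c]) simp
      next
        case False
        then obtain z' where "e = {c, z'}" using cc pz(1) by auto
        then show thesis using only finT t_ge by (intro that[of z']) simp
      qed
      ultimately show ?thesis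
        using finish[of c d] joins_one_sided[OF finT(1) w(3) d(1) _ z'] w d good[of c] good[of d] by auto
    qed
    show ?thesis
    proof (cases "port i p \<in> ?W \<or> port i z \<in> ?W")
      case True
      then show ?thesis using via pz by blast
    next
      case False
      \<comment> \<open>Two deleted vertices and at least three on the cycle force
        \<open>t \<ge> 5\<close>, so here the start may be chosen freely.\<close>
      have "port i p \<in> V i" "port i z \<in> V i" "port i p \<noteq> port i z"
        using pz i(1) port_in[of i] port_eq[of i p z] by auto
      then have "{port i p, port i z} \<union> ?W \<subseteq> V i" "card ({port i p, port i z} \<union> ?W) = 2 + card ?W"
        using False finW by (auto simp: card_Un_disjoint)
      then have "t \<ge> 5" using W3 card_mono[OF finite_V[OF i(1)], of "{port i p, port i z} \<union> ?W"] card_V_t[OF i(1)] by linarith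
      moreover obtain w where "w \<in> ?W" using W3 by (metis all_not_in_conv card.empty not_numeral_le_zero)
      ultimately show ?thesis using via port_W by blast
    qed
  qed
qed

end

section \<open>All faults in one copy\<close>

text \<open>No cross edge is faulty and the other copies are clean. The contracted graph on
  \<open>T\<close> is thus complete, and \<open>{i, q}\<close> is bad exactly when
  \<open>port i q\<close> is a faulty vertex.\<close>

locale one_faulty = faulty_cells S V E port f t FV FE
  for S :: "'c set" and V :: "'c \<Rightarrow> 'v set" and E :: "'c \<Rightarrow> 'v set set" and port :: "'c \<Rightarrow> 'c \<Rightarrow> 'v"
    and f t FV FE +
  fixes i :: 'c
  assumes i: "i \<in> S" and FVi: "FV \<subseteq> V i" and FEi: "FE \<subseteq> E i"
begin

abbreviation "T \<equiv> S - {i}"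
abbreviation "W \<equiv> V i - FV"
abbreviation "G \<equiv> edges - FE"

lemma V_clean: "c \<in> T \<Longrightarrow> V c - FV = V c"
  using FVi i disjoint_V[of c i] by blast

lemma E_clean: "c \<in> T \<Longrightarrow> E c \<subseteq> G"
  using FEi i E_disjoint[of c i] unfolding edges_def by blast

lemma link: "c \<in> T \<Longrightarrow> linked FV FE c"
proof -
  assume c: "c \<in> T"
  have "joins G (V c) s v" if "s \<in> V c" "v \<in> V c" "s \<noteq> v" for s v
    using joins_mono[of "E c" "V c" s v G] hc[of c "{}" "{}" s v] E_clean[OF c] c that by auto
  then show ?thesis using V_clean[OF c] by (simp add: linked_def)
qed

lemma port_clean: "c \<in> T \<Longrightarrow> d \<in> S \<Longrightarrow> d \<noteq> c \<Longrightarrow> port c d \<notin> FV"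
  using FVi i port_notin[of c d i] by auto

lemma not_bad: "p \<in> T \<Longrightarrow> q \<in> T \<Longrightarrow> p \<noteq> q \<Longrightarrow> {p, q} \<notin> bad FV FE"
  using bad_sym[of p q FV FE] port_clean[of p q] port_clean[of q p] FEi cross_notin_E[of p q i] i by auto

lemma bad_i: "q \<in> T \<Longrightarrow> {i, q} \<in> bad FV FE \<longleftrightarrow> port i q \<in> FV"
  using bad_sym[of i q FV FE] port_clean[of q i] FEi cross_notin_E[of i q i] i by auto

lemma bad_T: "A \<subseteq> T \<Longrightarrow> induced (bad FV FE) A = {}"
  using not_bad unfolding induced_def by blast

lemma port_W: "w \<in> W \<Longrightarrow> \<exists>j\<in>T. w = port i j"
  using port_ex[OF i] by blast

lemma W_port: "q \<in> T \<Longrightarrow> port i q \<in> W \<longleftrightarrow> port i q \<notin> FV"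
  using port_in[of i q] i by auto

lemma finite_T: "finite T" "card T = t"
  using finite_S card_T[OF i] by auto

lemma T_minus: "finite X \<Longrightarrow> card X < t \<Longrightarrow> \<exists>g\<in>T. g \<notin> X"
  using card_mono[of X T] finite_T by (metis not_le subsetI)

lemma region_T: "W \<union> region FV T = verts - FV"
  using i unfolding region_def verts_def by blast

lemma run_T:
  assumes "A \<subseteq> T" "a \<in> A" "b \<in> A" "x \<in> S" "y \<in> S" "x \<notin> A" "y \<notin> A" "a = b \<Longrightarrow> A = {a} \<and> x \<noteq> y"
  shows "joins G (region FV A) (port a x) (port b y)"
proof (rule run)
  show "port a x \<notin> FV" "port b y \<notin> FV" using assms port_clean by blast+
  show "induced (bad FV FE) A = {}" by (rule bad_T[OF assms(1)])
  show "linked FV FE c" if "c \<in> A" for c using link that assms(1) by blast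
qed (use assms in auto)

lemma run_via_T:
  assumes "A \<subseteq> T" "a \<in> A" "b \<in> A" "a \<noteq> b" "x \<in> S" "y \<in> S" "x \<noteq> a" "y \<notin> A"
    and "(\<exists>g\<in>A. g \<noteq> a \<and> g \<noteq> b \<and> g \<noteq> x) \<or> A = {a, b} \<and> x \<noteq> b"
  shows "joins G (region FV A) (port a x) (port b y)"
proof (rule run_via)
  show "port a x \<notin> FV" "port b y \<notin> FV" using assms port_clean by blast+
  show "induced (bad FV FE) A = {}" by (rule bad_T[OF assms(1)])
  show "linked FV FE c" if "c \<in> A" for c using link that assms(1) by blast
  show "y \<noteq> b" using assms by blast
qed (use assms in auto)

lemma around: "c \<in> T \<Longrightarrow> d \<in> T \<Longrightarrow> c \<noteq> d \<Longrightarrow> joins G (region FV T) (port c i) (port d i)"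
  using i by (intro run_T) auto

text \<open>\<open>nb e e'\<close>: copy \<open>i\<close> can be traversed between the copies \<open>e\<close> and \<open>e'\<close>.\<close>

definition nb :: "'c \<Rightarrow> 'c \<Rightarrow> bool" where
  "nb e e' \<longleftrightarrow> e \<in> T \<and> e' \<in> T \<and> e \<noteq> e' \<and> joins G W (port i e) (port i e')"

lemma nb_sym: "nb e e' \<Longrightarrow> nb e' e"
  unfolding nb_def using joins_rev by metis

lemma nb_ports: "nb e e' \<Longrightarrow> port i e \<notin> FV \<and> port i e' \<notin> FV"
  unfolding nb_def using joins_in by fast

lemma nb_T: "nb e e' \<Longrightarrow> e \<in> T \<and> e' \<in> T \<and> e \<noteq> e'"
  unfolding nb_def by blast

lemma nb_two:
  assumes "hamiltonian W G" "e \<in> T" "port i e \<notin> FV"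
  shows "\<exists>e1 e2. e1 \<noteq> e2 \<and> nb e e1 \<and> nb e e2"
proof -
  obtain s s' where s: "s \<noteq> s'" "s \<noteq> port i e" "s' \<noteq> port i e" "joins G W (port i e) s" "joins G W (port i e) s'"
    using hamiltonian_two_neighbours[OF assms(1)] W_port[OF assms(2)] assms(3) by blast
  obtain e1 where e1: "e1 \<in> T" "s = port i e1" using port_W[of s] joins_in[OF s(4)] by blast
  obtain e2 where e2: "e2 \<in> T" "s' = port i e2" using port_W[of s'] joins_in[OF s(5)] by blast
  have "nb e e1" "nb e e2" "e1 \<noteq> e2" using s assms(2) e1 e2 by (auto simp: nb_def)
  then show ?thesis by blast
qed

lemma nb_other:
  assumes "hamiltonian W G" "e \<in> T" "port i e \<notin> FV"
  shows "\<exists>e'. nb e e' \<and> e' \<noteq> z"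
  using nb_two[OF assms] by metis

lemma through:
  assumes "joins G (region FV A) p (port e i)" "joins G (region FV B) (port e' i) q" "nb e e'"
    and "e \<in> A" "e' \<in> B" "A \<subseteq> T" "B \<subseteq> T" "A \<inter> B = {}" "A \<union> B = R - {i}" "i \<in> R"
  shows "joins G (region FV R) p q"
proof -
  have g: "{e, i} \<notin> bad FV FE" "{i, e'} \<notin> bad FV FE"
    using bad_i[of e] bad_i[of e'] nb_ports[OF assms(3)] nb_T[OF assms(3)] by (simp_all add: insert_commute)
  have "joins G (region FV ({i} \<union> B)) (port i e) q"
    by (rule glue[OF _ assms(2) g(2)]) (use assms i nb_def in auto)
  then have "joins G (region FV (A \<union> ({i} \<union> B))) p q"
    by (rule glue[OF assms(1) _ g(1)]) (use assms i in auto)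
  moreover have "A \<union> ({i} \<union> B) = R" using assms(9,10) by blast
  ultimately show ?thesis by simp
qed

lemma whole: "joins G (region FV S) p q \<Longrightarrow> joins G (verts - FV) p q"
  by (simp add: region_S)

text \<open>One of the f + 1 faults is forgiven so that \<open>hc\<close> applies. The path breaks
  into two pieces at this fault, and the gap is bridged through all other copies, since every
  surviving vertex of copy \<open>i\<close> has a usable cross edge.\<close>

lemma hc_inside:
  assumes tot: "card FV + card FE = f + 1" and uv: "u \<in> W" "v \<in> W" "u \<noteq> v"
  shows "joins G (verts - FV) u v"
proof -
  have sub: "e \<in> G" if "e \<in> E i" "e \<notin> FE" for e using that i by (auto simp: edges_def)
  have "\<exists>s s'. splits G W u v s s'"
  proof (cases "FV = {}")
    case True
    then have "FE \<noteq> {}" using tot by auto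
    then obtain e where e: "e \<in> FE" by blast
    have "card FV + card (FE - {e}) \<le> f" using e tot finite_F card_Suc_Diff1[of FE e] by simp
    then have "joins (E i - (FE - {e})) W u v" using hc[OF i FVi] uv finite_F by simp
    then obtain s s' where "splits (E i - (FE - {e}) - {e}) W u v s s'" using joins_split_edge uv(3) by metis
    then have "splits G W u v s s'" by (rule splits_mono) (use sub in blast)
    then show ?thesis by blast
  next
    case False
    then obtain w where w: "w \<in> FV" by blast
    have "card (FV - {w}) + card FE \<le> f" using w tot finite_F card_Suc_Diff1[of FV w] by simp
    then have "joins (E i - FE) (V i - (FV - {w})) u v" using hc[OF i, of "FV - {w}" FE u v] FVi uv finite_F by auto
    then obtain s s' where "splits (E i - FE) (V i - (FV - {w}) - {w}) u v s s'"
      using joins_split_vertex[of "E i - FE" "V i - (FV - {w})" u v w] w uv FVi by blast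
    moreover have "V i - (FV - {w}) - {w} = W" using w by blast
    ultimately have "splits (E i - FE) W u v s s'" by simp
    then have "splits G W u v s s'" by (rule splits_mono) (use sub in blast)
    then show ?thesis by blast
  qed
  then obtain s s' where s: "splits G W u v s s'" by blast
  obtain c where c: "c \<in> T" "s = port i c" using port_W[of s] splits_in[OF s] by blast
  obtain d where d: "d \<in> T" "s' = port i d" using port_W[of s'] splits_in[OF s] by blast
  note cd = c d
  have "c \<noteq> d" using cd splits_in[OF s] by blast
  then have "joins G (W \<union> region FV T) u v"
    using splits_joins[OF s, of "port c i" "region FV T" "port d i"] around[of c d] cd i
      good_edge[of i c FV FE] good_edge[of d i FV FE] bad_i[of c] bad_i[of d] splits_in[OF s]
      region_disjoint[of "{i}" T FV] by (auto simp: insert_commute)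
  then show ?thesis by (simp add: region_T)
qed

text \<open>Again one fault is forgiven, now to get a Hamiltonian cycle; opening it at that fault
  leaves a path of \<open>W\<close> that is closed through the other copies.\<close>

lemma hamiltonian_inside:
  assumes tot: "card FV + card FE = f + 2"
  shows "hamiltonian (verts - FV) G"
proof -
  have sub: "e \<in> G" if "e \<in> E i" "e \<notin> FE" for e using that i by (auto simp: edges_def)
  have "\<exists>s s'. s \<noteq> s' \<and> joins G W s s'"
  proof (cases "FV = {}")
    case True
    then have "FE \<noteq> {}" using tot by auto
    then obtain e where e: "e \<in> FE" by blast
    have "card FV + card (FE - {e}) \<le> f + 1" using e tot finite_F card_Suc_Diff1[of FE e] by simp
    then have "hamiltonian W (E i - (FE - {e}))" using ham[OF i FVi] finite_F by simp
    then obtain s s' where s: "s \<noteq> s'" "joins (E i - (FE - {e}) - {e}) W s s'" using hamiltonian_avoiding_edge by metis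
    from s(2) have "joins G W s s'" by (rule joins_mono) (use sub in blast)
    then show ?thesis using s(1) by blast
  next
    case False
    then obtain w where w: "w \<in> FV" by blast
    have "card (FV - {w}) + card FE \<le> f + 1" using w tot finite_F card_Suc_Diff1[of FV w] by simp
    then have "hamiltonian (V i - (FV - {w})) (E i - FE)" using ham[OF i, of "FV - {w}" FE] FVi finite_F by auto
    then obtain s s' where s: "s \<noteq> s'" "joins (E i - FE) (V i - (FV - {w}) - {w}) s s'"
      using hamiltonian_two_neighbours[of "V i - (FV - {w})" "E i - FE" w] w FVi by blast
    moreover have "V i - (FV - {w}) - {w} = W" using w by blast
    ultimately have "joins (E i - FE) W s s'" by simp
    then have "joins G W s s'" by (rule joins_mono) (use sub in blast)
    then show ?thesis using s(1) by blast
  qed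
  then obtain s s' where s: "s \<noteq> s'" "joins G W s s'" by blast
  obtain c where c: "c \<in> T" "s = port i c" using port_W[of s] joins_in[OF s(2)] by blast
  obtain d where d: "d \<in> T" "s' = port i d" using port_W[of s'] joins_in[OF s(2)] by blast
  note cd = c d
  have "c \<noteq> d" using cd s by blast
  then show ?thesis using closing[of FE FV i c d] s cd around[of c d] bad_i[of c] bad_i[of d] joins_in[OF s(2)] i by auto
qed

text \<open>From \<open>u\<close> the cycle of copy \<open>i\<close> is followed to a neighbour
  whose cross edge leads to some \<open>e\<close> other than \<open>b\<close>. The route from
  \<open>e\<close> to \<open>b\<close> is built backwards, its first move avoiding
  \<open>y\<close>.\<close>

lemma hc_to_inside:
  assumes ham_W: "hamiltonian W G" and b: "b \<in> T" and u: "u \<in> W" and v: "v \<in> V b"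
  shows "joins G (verts - FV) u v"
proof -
  obtain y where y: "y \<in> S" "y \<noteq> b" "v = port b y" using port_ex[of b v] v b by blast
  obtain c where c: "c \<in> T" "u = port i c" using port_W u by blast
  then obtain e where e: "nb c e" "e \<noteq> b" using nb_other[OF ham_W, of c b] u by blast
  have "card {b, e, y} \<le> 3" by (simp add: card_insert_if)
  then obtain g where "g \<in> T" "g \<notin> {b, e, y}" using T_minus[of "{b, e, y}"] t_ge by auto
  then have "joins G (region FV T) (port b y) (port e i)"
    using b y e nb_T[OF e(1)] i by (intro run_via_T) auto
  then have "joins G (region FV T) (port e i) v" using joins_rev y by metis
  moreover have "joins G (region FV {i}) u (port i e)" using e c by (simp add: nb_def)
  ultimately have "joins G (region FV ({i} \<union> T)) u v"
    using glue[of FE FV "{i}" u i e T v] bad_i[of e] nb_ports[OF e(1)] nb_T[OF e(1)] i by auto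
  moreover have "{i} \<union> T = S" using i by blast
  ultimately show ?thesis using whole by simp
qed

text \<open>A path of copy \<open>a\<close> is broken and the detour has to include copy
  \<open>i\<close>. If \<open>port i a\<close> is intact, the break is put next to
  \<open>port a i\<close> and the detour starts in \<open>i\<close>. Otherwise the break avoids
  \<open>port a i\<close>, and \<open>i\<close> is visited in the middle of the detour.\<close>

lemma hc_other_copy:
  assumes ham_W: "hamiltonian W G" and a: "a \<in> T" and uv: "u \<in> V a" "v \<in> V a" "u \<noteq> v"
  shows "joins G (verts - FV) u v"
proof -
  have P: "joins G (V a) u v" if "u \<in> V a" "v \<in> V a" "u \<noteq> v" for u v
    using link[OF a] V_clean[OF a] that by (simp add: linked_def)
  have aS: "a \<in> S" "a \<noteq> i" using a by auto
  have reg: "V a \<union> region FV (S - {a}) = verts - FV"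
    using V_clean[OF a] a unfolding region_def verts_def by blast
  have disj: "V a \<inter> region FV (S - {a}) = {}"
    using region_disjoint[of "{a}" "S - {a}" FV] V_clean[OF a] a by auto
  have edge: "{port a c, port c a} \<in> G" if "c \<in> S" "c \<noteq> a" "c = i \<Longrightarrow> port i a \<notin> FV" for c
    using good_edge[of a c FV FE] not_bad[of a c] bad_i[OF a] that a by (cases "c = i") (auto simp: insert_commute)
  have finish: "joins G (verts - FV) u v"
    if "splits G (V a) u v (port a c) (port a d)" "joins G (region FV (S - {a})) (port c a) (port d a)"
      "c \<in> S" "d \<in> S" "c \<noteq> a" "d \<noteq> a" "c = i \<or> d = i \<Longrightarrow> port i a \<notin> FV" for u v c d
  proof -
    have "{port d a, port a d} \<in> G" using edge[of d] that by (auto simp: insert_commute)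
    then show ?thesis using splits_joins[OF that(1) edge that(2) _ disj] that reg by auto
  qed
  show ?thesis
  proof (cases "port i a \<in> FV")
    case False
    have main: "joins G (verts - FV) u v" if uv: "u \<in> V a" "v \<in> V a" "u \<noteq> v" "v \<noteq> port a i" for u v
    proof -
      have p: "port a i \<in> V a" using port_in[of a i] aS i by auto
      obtain p' where p': "splits G (V a) u v (port a i) p'"
        using joins_split_after[OF P[OF uv(1-3)] p] uv(4) by metis
      obtain d where d: "d \<in> S" "d \<noteq> a" "p' = port a d" using port_ex[of a p'] splits_in[OF p'] aS by blast
      have di: "d \<noteq> i" using d splits_in[OF p'] by blast
      obtain e where e: "nb a e" "e \<noteq> d" using nb_other[OF ham_W a False, of d] by blast
      have "joins G (region FV (T - {a})) (port e i) (port d a)"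
        by (rule run_T) (use e nb_T[OF e(1)] d di i aS in auto)
      moreover have "joins G (region FV {i}) (port i a) (port i e)" using e by (simp add: nb_def)
      ultimately have "joins G (region FV ({i} \<union> (T - {a}))) (port i a) (port d a)"
        using glue[of FE FV "{i}" "port i a" i e "T - {a}" "port d a"] bad_i[of e] nb_ports[OF e(1)] nb_T[OF e(1)] i by auto
      moreover have "{i} \<union> (T - {a}) = S - {a}" using i aS by blast
      ultimately show ?thesis using finish[of u v i d] p' d aS i False by auto
    qed
    show ?thesis
    proof (cases "v = port a i")
      case True
      then show ?thesis using main[of v u] uv joins_rev[of G _ v u] by auto
    qed (use main uv in blast)
  next
    case True
    have "4 \<le> card (V a)" using card_V_t[of a] t_ge a by simp
    then obtain s s' where s: "splits G (V a) u v s s'" "s \<noteq> port a i" "s' \<noteq> port a i"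
      using joins_split_avoiding[OF P[OF uv]] by metis
    obtain c where c: "c \<in> S" "c \<noteq> a" "s = port a c" using port_ex[of a s] splits_in[OF s(1)] aS by blast
    obtain d where d: "d \<in> S" "d \<noteq> a" "s' = port a d" using port_ex[of a s'] splits_in[OF s(1)] aS by blast
    have cd: "c \<in> T - {a}" "d \<in> T - {a}" "c \<noteq> d" using c d s splits_in[OF s(1)] by auto
    \<comment> \<open>\<open>W\<close> carries a cycle and has a third vertex, which gives
      \<open>e\<close> different from \<open>c\<close> and \<open>d\<close>. Its neighbour
      \<open>e'\<close> may be \<open>c\<close> or \<open>d\<close>, whence the three orders of
      visit below.\<close>
    have "\<not> W \<subseteq> {port i c, port i d}"
      using hamiltonian_card[OF ham_W] card_mono[of "{port i c, port i d}" W] by (auto simp: card_insert_if split: if_splits)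
    then obtain e where e: "e \<in> T" "port i e \<notin> FV" "e \<noteq> c" "e \<noteq> d" using port_W by blast
    then obtain e' where e': "nb e e'" using nb_two[OF ham_W] by blast
    have ea: "e \<noteq> a" "e' \<noteq> a" "e' \<in> T" "e \<noteq> e'" using True e nb_ports[OF e'] nb_T[OF e'] by auto
    have "joins G (region FV (S - {a})) (port c a) (port d a)"
    proof -
      consider "e' = c" | "e' = d" | "e' \<noteq> c" "e' \<noteq> d" by blast
      then show ?thesis
      proof cases
        case 1
        have "joins G (region FV {c}) (port c a) (port c i)"
          by (rule run_T) (use cd aS i in auto)
        moreover have "joins G (region FV (T - {a, c})) (port e i) (port d a)"
          by (rule run_T) (use e ea cd aS i in auto)
        ultimately show ?thesis by (rule through) (use nb_sym[OF e'] 1 cd e ea aS i in auto)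
      next
        case 2
        have "joins G (region FV {d}) (port d i) (port d a)"
          by (rule run_T) (use cd aS i in auto)
        moreover have "joins G (region FV (T - {a, d})) (port c a) (port e i)"
          by (rule run_T) (use e ea cd aS i in auto)
        ultimately show ?thesis
          using through[of "T - {a, d}" "port c a" e "{d}" d "port d a" "S - {a}"] e' 2 cd e ea aS i by auto
      next
        case 3
        have "joins G (region FV {c, e}) (port c a) (port e i)"
          by (rule run_T) (use e ea cd aS i in auto)
        moreover have "joins G (region FV (T - {a, c, e})) (port e' i) (port d a)"
          by (rule run_T) (use e ea cd aS i 3 in auto)
        ultimately show ?thesis by (rule through) (use e' 3 cd e ea aS i in auto)
      qed
    qed
    then show ?thesis using finish[of u v c d] s c d cd by auto
  qed
qed

end

section \<open>End vertices in two different fault-free copies\<close>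

context one_faulty
begin

text \<open>Serves the paths that leave copy \<open>a\<close> at once: their first vertex
  \<open>u\<close> is treated as one more deleted vertex, which affects only its own copy.\<close>

lemma linked_insert:
  assumes VD: "\<forall>i\<in>S. \<forall>w\<in>V i. \<forall>u\<in>V i - {w}. \<forall>v\<in>V i - {w}. u \<noteq> v \<longrightarrow> joins (E i) (V i - {w}) u v"
    and a: "a \<in> T" "u \<in> V a" and c: "c \<in> T"
  shows "linked (insert u FV) FE c"
proof (cases "c = a")
  case True
  have "V a - insert u FV = V a - {u}" using V_clean[OF a(1)] by blast
  moreover have "joins G (V a - {u}) p q" if "p \<in> V a - {u}" "q \<in> V a - {u}" "p \<noteq> q" for p q
  proof -
    have "joins (E a) (V a - {u}) p q" using VD that a by blast
    then show ?thesis by (rule joins_mono) (use E_clean[OF a(1)] in blast)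
  qed
  ultimately show ?thesis using True by (simp add: linked_def)
next
  case False
  then have "u \<notin> V c" using a c V_unique[of u a c] by blast
  then have "V c - insert u FV = V c - FV" by blast
  then show ?thesis using link[OF c] by (simp add: linked_def)
qed

lemma bad_insert:
  assumes "A \<subseteq> T" "a \<in> T" "x \<in> S" "x \<noteq> a" "x \<notin> A \<or> a \<notin> A"
  shows "induced (bad (insert (port a x) FV) FE) A = {}"
proof -
  have "{p, q} \<notin> bad (insert (port a x) FV) FE" if "p \<in> A" "q \<in> A" "p \<noteq> q" for p q
  proof -
    have pq: "p \<in> T" "q \<in> T" using that assms(1) by auto
    have eq: "p = a \<and> q = x" if "port p q = port a x" "p \<in> T" "q \<in> T" "p \<noteq> q" for p q
    proof -
      have "p = a" using that assms port_in[of p q] port_in[of a x] V_unique[of "port a x" p a] by auto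
      then show ?thesis using that assms port_eq[of a q x] by auto
    qed
    have "port p q \<noteq> port a x" "port q p \<noteq> port a x"
      using eq[of p q] eq[of q p] pq that assms(5) by auto
    then show ?thesis using not_bad[OF pq that(3)] bad_sym[of p q] pq that(3) by simp
  qed
  then show ?thesis unfolding induced_def by blast
qed

lemma region_insert_i: "u \<in> V a \<Longrightarrow> a \<in> T \<Longrightarrow> region (insert u FV) {i} = W"
  using V_unique[of u a i] i by auto

lemma bad_insert_i:
  assumes "a \<in> T" "x \<in> S" "x \<noteq> a" "e \<in> T" "port i e \<notin> FV" "e \<noteq> a \<or> x \<noteq> i"
  shows "{i, e} \<notin> bad (insert (port a x) FV) FE"
proof -
  have "port i e \<noteq> port a x" using assms i port_in[of i e] port_notin[of a x i] by auto
  moreover have "port e i \<noteq> port a x"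
  proof
    assume eq: "port e i = port a x"
    then have "e = a" using assms i port_in[of e i] port_in[of a x] V_unique[of "port a x" e a] by auto
    then show False using eq assms i port_eq[of a i x] by auto
  qed
  ultimately show ?thesis using bad_i[OF assms(4)] bad_sym[of i e] assms i by auto
qed

end

text \<open>A Hamiltonian path between two fault-free copies \<open>a\<close> and \<open>b\<close> while all faults are in copy \<open>i\<close>.
  The copies \<open>x\<close> and \<open>y\<close> are those to which the end vertices are attached.\<close>

locale two_ends = one_faulty S V E port f t FV FE i
  for S :: "'c set" and V :: "'c \<Rightarrow> 'v set" and E :: "'c \<Rightarrow> 'v set set" and port :: "'c \<Rightarrow> 'c \<Rightarrow> 'v"
    and f t FV FE i +
  fixes a b x y :: 'c
  assumes ab: "a \<in> T" "b \<in> T" "a \<noteq> b" and x: "x \<in> S" "x \<noteq> a" and y: "y \<in> S" "y \<noteq> b"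
    and hamW: "hamiltonian W G"
begin

abbreviation "goal \<equiv> joins G (verts - FV) (port a x) (port b y)"

lemma two_ends_swap: "two_ends S V E port f t FV FE i b a y x"
  using two_ends_axioms ab unfolding two_ends_def two_ends_axioms_def by auto

lemma run_to_end:
  assumes "A \<subseteq> T" "e \<in> A" "b \<in> A" "e \<noteq> b" "(\<exists>g\<in>A. g \<noteq> b \<and> g \<noteq> e \<and> g \<noteq> y) \<or> A = {b, e} \<and> y \<noteq> e"
  shows "joins G (region FV A) (port e i) (port b y)"
  by (rule joins_rev, rule run_via_T) (use assms y i in auto)

text \<open>Order of visit: \<open>a\<close>, \<open>e\<close>, \<open>i\<close>, \<open>e'\<close>,
  the remaining copies, \<open>b\<close>. The copy \<open>g\<close> guarantees that \<open>b\<close>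
  can be entered from a copy other than \<open>y\<close>.\<close>

lemma interior_edge:
  assumes nb: "nb e e'" and e: "e \<noteq> a" "e \<noteq> b" "e' \<noteq> a" "e' \<noteq> b" "e \<noteq> x"
    and g: "g \<in> T" "g \<notin> {a, b, e, e', y}"
  shows goal
proof (rule whole, rule through[OF _ _ nb])
  note nT = nb_T[OF nb]
  show "joins G (region FV {a, e}) (port a x) (port e i)"
    by (rule run_via_T) (use nT ab e x i in auto)
  show "joins G (region FV (T - {a, e})) (port e' i) (port b y)"
    by (rule run_to_end) (use nT ab e g in auto)
qed (use nb_T[OF nb] ab e i in auto)

text \<open>Order of visit: \<open>a\<close>, \<open>i\<close>, \<open>e'\<close>, the remaining
  copies, \<open>b\<close>. Copy \<open>a\<close> is left through \<open>port a i\<close>, which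
  differs from the start vertex by \<open>x \<noteq> i\<close>.\<close>

lemma first_edge:
  assumes nb: "nb a e'" and e: "e' \<noteq> b" "x \<noteq> i" and g: "g \<in> T" "g \<notin> {a, b, e', y}"
  shows goal
proof (rule whole, rule through[OF _ _ nb])
  note nT = nb_T[OF nb]
  show "joins G (region FV {a}) (port a x) (port a i)"
    by (rule run_T) (use ab e x i in auto)
  show "joins G (region FV (T - {a})) (port e' i) (port b y)"
    by (rule run_to_end) (use nT ab e g in auto)
qed (use nb_T[OF nb] ab e i in auto)

text \<open>The start vertex is itself the port towards \<open>i\<close>. It is left immediately;
  after copy \<open>i\<close> the route through \<open>T\<close> also covers the rest of
  \<open>a\<close>.\<close>

lemma via_i:
  assumes VD: "\<forall>i\<in>S. \<forall>w\<in>V i. \<forall>u\<in>V i - {w}. \<forall>v\<in>V i - {w}. u \<noteq> v \<longrightarrow> joins (E i) (V i - {w}) u v"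
    and nb: "nb a e'" and e: "e' \<noteq> b" and xi: "x = i"
  shows goal
proof (rule joins_leave_copy)
  note nT = nb_T[OF nb]
  let ?FV = "insert (port a x) FV"
  have u: "port a x \<in> V a" using port_in[of a x] ab x by auto
  have "card {b, e', y} \<le> 3" by (simp add: card_insert_if)
  then obtain g where g: "g \<in> T" "g \<notin> {b, e', y}" using T_minus[of "{b, e', y}"] t_ge by auto
  have ne: "port b y \<noteq> port a x" "port e' i \<noteq> port a x"
    using port_in[of a x] port_notin[of b y a] port_notin[of e' i a] ab x y nT i by auto
  have "joins G (region ?FV T) (port b y) (port e' i)"
  proof (rule run_via)
    show "port b y \<notin> ?FV" "port e' i \<notin> ?FV" using ne port_clean[of b y] port_clean[of e' i] ab y nT i by auto
    show "linked ?FV FE c" if "c \<in> T" for c using linked_insert[OF VD ab(1) u that] .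
    show "induced (bad ?FV FE) T = {}" by (rule bad_insert) (use ab x xi in auto)
    show "(\<exists>g\<in>T. g \<noteq> b \<and> g \<noteq> e' \<and> g \<noteq> y) \<or> T = {b, e'} \<and> y \<noteq> e'" using g by auto
  qed (use ab nT e y i in auto)
  then have 2: "joins G (region ?FV T) (port e' i) (port b y)" by (rule joins_rev)
  have 1: "joins G (region ?FV {i}) (port x a) (port i e')"
    using nb region_insert_i[OF u ab(1)] xi by (simp add: nb_def)
  have "{i, e'} \<notin> bad ?FV FE"
    by (rule bad_insert_i) (use ab x nT nb_ports[OF nb] in auto)
  then have "joins G (region ?FV ({i} \<union> T)) (port x a) (port b y)"
    using glue[OF 1 2] nT i by auto
  moreover have "{i} \<union> T = S" using i by blast
  ultimately show "joins G (region ?FV S) (port x a) (port b y)" by simp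
  show "{a, x} \<notin> bad FV FE" using bad_i[OF ab(1)] nb_ports[OF nb] xi by (simp add: insert_commute)
qed (use ab x in auto)

text \<open>Order of visit: the vertex \<open>port a x\<close> alone, \<open>x\<close>,
  \<open>e'\<close>, \<open>i\<close>, the rest of \<open>a\<close>, \<open>b\<close>.\<close>

lemma via_common:
  assumes VD: "\<forall>i\<in>S. \<forall>w\<in>V i. \<forall>u\<in>V i - {w}. \<forall>v\<in>V i - {w}. u \<noteq> v \<longrightarrow> joins (E i) (V i - {w}) u v"
    and nb: "nb a e'" and e: "e' \<noteq> b" and xy: "x = y" "x \<in> T" "x \<noteq> e'" and TT: "T = {a, b, e', x}"
  shows goal
proof (rule joins_leave_copy)
  note nT = nb_T[OF nb]
  let ?FV = "insert (port a x) FV"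
  have u: "port a x \<in> V a" using port_in[of a x] ab x by auto
  have lk: "linked ?FV FE c" if "c \<in> T" for c using linked_insert[OF VD ab(1) u that] .
  have ne: "port p q \<noteq> port a x" if "p \<in> S" "q \<in> S" "p \<noteq> q" "p \<noteq> a \<or> q \<noteq> x" for p q
    using that u port_notin[of p q a] port_eq[of a q x] ab x by (cases "p = a") auto
  have "joins G (region ?FV {x, e'}) (port x a) (port e' i)"
  proof (rule run)
    show "port x a \<notin> ?FV" "port e' i \<notin> ?FV"
      using ne[of x a] ne[of e' i] port_clean[of x a] port_clean[of e' i] ab x xy nT i by auto
    show "linked ?FV FE c" if "c \<in> {x, e'}" for c using lk that xy nT by auto
    show "induced (bad ?FV FE) {x, e'} = {}" by (rule bad_insert) (use ab x xy nT in auto)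
  qed (use ab nT e x xy i in auto)
  moreover have "joins G (region ?FV {a, b}) (port a i) (port b y)"
  proof (rule run)
    show "port a i \<notin> ?FV" "port b y \<notin> ?FV"
      using ne[of a i] ne[of b y] port_clean[of a i] port_clean[of b y] ab x y xy nT i by auto
    show "linked ?FV FE c" if "c \<in> {a, b}" for c using lk that ab by auto
    show "induced (bad ?FV FE) {a, b} = {}" by (rule bad_insert) (use ab x xy y nT in auto)
  qed (use ab nT e x y xy i in auto)
  moreover have "joins G (region ?FV {i}) (port i e') (port i a)"
    using nb_sym[OF nb] region_insert_i[OF u ab(1)] by (simp add: nb_def)
  moreover have g: "{i, e'} \<notin> bad ?FV FE" "{i, a} \<notin> bad ?FV FE"
    by (rule bad_insert_i; use ab x xy nT nb_ports[OF nb] in auto)+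
  ultimately have "joins G (region ?FV ({x, e'} \<union> ({i} \<union> {a, b}))) (port x a) (port b y)"
    using glue[of FE ?FV "{i}" "port i e'" i a "{a, b}" "port b y"]
      glue[of FE ?FV "{x, e'}" "port x a" e' i "{i} \<union> {a, b}" "port b y"] ab nT xy x y e i
    by (auto simp: insert_commute)
  moreover have "{x, e'} \<union> ({i} \<union> {a, b}) = S" using TT i by blast
  ultimately show "joins G (region ?FV S) (port x a) (port b y)" by simp
  show "{a, x} \<notin> bad FV FE" using not_bad[of a x] ab x xy by simp
qed (use ab x in auto)

text \<open>Usually copy \<open>i\<close> is visited directly after the start, or after
  \<open>a\<close>. Only four fault-free copies, all of them among \<open>a\<close>,
  \<open>b\<close>, \<open>e\<close>, \<open>y\<close>, leave no room for this, and then the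
  adjacencies on the cycle of copy \<open>i\<close> determine the order.\<close>

lemma goal_if_first:
  assumes VD: "\<forall>i\<in>S. \<forall>w\<in>V i. \<forall>u\<in>V i - {w}. \<forall>v\<in>V i - {w}. u \<noteq> v \<longrightarrow> joins (E i) (V i - {w}) u v"
    and pa: "port i a \<notin> FV"
  shows goal
proof (cases "x = i")
  case True
  obtain e where "nb a e" "e \<noteq> b" using nb_other[OF hamW ab(1) pa] by metis
  then show ?thesis using via_i[OF VD] True by blast
next
  case xi: False
  show ?thesis
  proof (cases "\<exists>e g. nb a e \<and> e \<noteq> b \<and> g \<in> T \<and> g \<notin> {a, b, e, y}")
    case True
    then show ?thesis using first_edge xi by blast
  next
    case False
    obtain e where e: "nb a e" "e \<noteq> b" using nb_other[OF hamW ab(1) pa] by metis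
    have nT: "e \<in> T" "a \<noteq> e" using nb_T[OF e(1)] by auto
    \<comment> \<open>From here on \<open>t = 4\<close>, and the two cycle neighbours of
      \<open>a\<close> in copy \<open>i\<close> turn out to be \<open>e\<close> and
      \<open>b\<close>.\<close>
    have T4: "T \<subseteq> {a, b, e, y}" using False e by blast
    have distinct: "y \<in> T" "y \<noteq> a" "y \<noteq> e"
    proof -
      have "card {a, b, e} < t" using t_ge by (simp add: card_insert_if)
      then obtain g where g: "g \<in> T" "g \<notin> {a, b, e}" using T_minus[of "{a, b, e}"] by blast
      then have "g = y" using T4 by blast
      then show "y \<in> T" "y \<noteq> a" "y \<noteq> e" using g by auto
    qed
    have TT: "T = {a, b, e, y}" using T4 ab nT distinct by blast
    have nay: "\<not> nb a y"
    proof
      assume "nb a y"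
      then have "T \<subseteq> {a, b, y}" using False distinct y by blast
      then show False using nT e(2) distinct by blast
    qed
    have nab: "nb a b"
    proof -
      obtain e1 where e1: "nb a e1" "e1 \<noteq> e" using nb_other[OF hamW ab(1) pa] by metis
      then have "e1 \<in> {a, b, e, y}" "e1 \<noteq> a" using nb_T[OF e1(1)] unfolding TT by auto
      then have "e1 = b" using e1 nay by auto
      then show ?thesis using e1 by simp
    qed
    show ?thesis
    proof (cases "x = y")
      case True
      then show ?thesis using via_common[OF VD e] distinct TT by simp
    next
      case xy: False
      show ?thesis
      proof (cases "nb e b")
        case True
        \<comment> \<open>Order of visit: \<open>a\<close>, \<open>y\<close>, \<open>e\<close>,
          \<open>i\<close>, \<open>b\<close>.\<close>
        have 1: "joins G (region FV {a, y, e}) (port a x) (port e i)"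
          by (rule run_via_T) (use ab nT e(2) distinct x y xy i in auto)
        have 2: "joins G (region FV {b}) (port b i) (port b y)"
          by (rule run_T) (use ab distinct y i in auto)
        show ?thesis
          by (rule whole, rule through[OF 1 2 True]) (use TT ab nT e distinct y i in auto)
      next
        case False
        \<comment> \<open>Since \<open>e\<close> and \<open>b\<close> are not known to be
          neighbours, the second neighbour of \<open>b\<close> must be \<open>y\<close>, and the
          second neighbour of \<open>y\<close> must be \<open>e\<close>. Order of visit:
          \<open>a\<close>, \<open>y\<close>, \<open>i\<close>, \<open>e\<close>,
          \<open>b\<close>.\<close>
        obtain e2 where e2: "nb b e2" "e2 \<noteq> a" using nb_other[OF hamW ab(2)] nb_ports[OF nab] by metis
        have "e2 \<in> {a, b, e, y}" "e2 \<noteq> b" using nb_T[OF e2(1)] unfolding TT by auto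
        then have "e2 = y" using e2 False nb_sym[of b e] by auto
        then have "port i y \<notin> FV" using nb_ports[OF e2(1)] by simp
        then obtain e3 where e3: "nb y e3" "e3 \<noteq> b" using nb_other[OF hamW distinct(1)] by metis
        then have "e3 \<in> {a, b, e, y}" "e3 \<noteq> y" using nb_T[OF e3(1)] unfolding TT by auto
        then have "e3 = e" using e3 nay nb_sym[of y a] by auto
        then have ye: "nb y e" using e3 by simp
        have 1: "joins G (region FV {a, y}) (port a x) (port y i)"
          by (rule run_via_T) (use ab nT e(2) distinct x y xy i in auto)
        have 2: "joins G (region FV {b, e}) (port e i) (port b y)"
          by (rule run_to_end) (use ab nT e(2) distinct in auto)
        show ?thesis
          by (rule whole, rule through[OF 1 2 ye]) (use TT ab nT e distinct y i in auto)
      qed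
    qed
  qed
qed

text \<open>All surviving ports of \<open>i\<close> lead away from \<open>a\<close> and
  \<open>b\<close>, so any edge of the cycle will do. Taking \<open>e' = y\<close> whenever
  \<open>port i y\<close> survives ensures that a third surviving port leads to a copy
  \<open>g\<close> other than \<open>y\<close>.\<close>

lemma goal_if_none:
  assumes "port i a \<in> FV" "port i b \<in> FV"
  shows goal
proof -
  have W3: "3 \<le> card W" by (rule hamiltonian_card[OF hamW])
  obtain e' where e': "e' \<in> T" "port i e' \<notin> FV" "y \<in> T \<and> port i y \<notin> FV \<Longrightarrow> e' = y"
  proof (cases "y \<in> T \<and> port i y \<notin> FV")
    case False
    obtain w where "w \<in> W" using W3 by (metis all_not_in_conv card.empty not_numeral_le_zero)
    then obtain q where "q \<in> T" "port i q \<notin> FV" using port_W[of w] by blast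
    then show thesis by (rule that) (use False in simp)
  next
    case True
    then show thesis by (intro that[of y]) simp_all
  qed
  obtain e where e: "nb e' e" "e \<noteq> x" using nb_other[OF hamW e'(1,2)] by metis
  have "\<not> W \<subseteq> {port i e, port i e'}"
    using W3 card_mono[of "{port i e, port i e'}" W] by (auto simp: card_insert_if split: if_splits)
  then obtain g where g: "g \<in> T" "port i g \<notin> FV" "g \<noteq> e" "g \<noteq> e'" using port_W by blast
  have "g \<noteq> y" using e'(3) g by blast
  moreover have "e \<noteq> a" "e \<noteq> b" "e' \<noteq> a" "e' \<noteq> b" "g \<noteq> a" "g \<noteq> b"
    using assms nb_ports[OF e(1)] g(2) by auto
  ultimately show ?thesis using interior_edge[OF nb_sym[OF e(1)], of g] e(2) g by auto
qed

text \<open>The origin of \<open>f + 7\<close>: after f + 1 faults at least six vertices remain, so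
  the cycle has three disjoint edges, one of which avoids the ports towards \<open>a\<close> and
  \<open>b\<close>.\<close>

lemma goal_if_large:
  assumes t: "f + 7 \<le> t" and tot: "card FV + card FE \<le> f + 1"
  shows goal
proof -
  have "card W + card FV = t" using card_Diff_subset[OF _ FVi] card_mono[OF _ FVi] finite_F finite_V[OF i] card_V_t[OF i] by simp
  then have "6 \<le> card W" using t tot by linarith
  then obtain s s' where s: "s \<noteq> s'" "{s, s'} \<inter> {port i a, port i b} = {}" "joins G W s s'"
    using hamiltonian_avoiding_two[OF hamW] by metis
  obtain c where c: "c \<in> T" "s = port i c" using port_W joins_in[OF s(3)] by blast
  obtain d where d: "d \<in> T" "s' = port i d" using port_W joins_in[OF s(3)] by blast
  have cd: "nb c d" using s c d by (auto simp: nb_def)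
  have ne: "c \<noteq> a" "c \<noteq> b" "d \<noteq> a" "d \<noteq> b" using s c d by auto
  have "card {a, b, c, d, y} \<le> 5" by (simp add: card_insert_if)
  then obtain g where g: "g \<in> T" "g \<notin> {a, b, c, d, y}" using T_minus[of "{a, b, c, d, y}"] t by auto
  show ?thesis
  proof (cases "c = x")
    case False
    then show ?thesis using interior_edge[OF cd, of g] ne g by auto
  next
    case True
    then have "d \<noteq> x" using nb_T[OF cd] by blast
    then show ?thesis using interior_edge[OF nb_sym[OF cd], of g] ne g by auto
  qed
qed

end

lemma (in one_faulty) hc_two_others:
  assumes hamW: "hamiltonian W G" and tot: "card FV + card FE \<le> f + 1"
    and ab: "a \<in> T" "b \<in> T" "a \<noteq> b" and u: "u \<in> V a" and v: "v \<in> V b"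
  shows "joins G (verts - FV) u v"
proof -
  obtain x where x: "x \<in> S" "x \<noteq> a" "u = port a x" using port_ex[of a u] u ab by blast
  obtain y where y: "y \<in> S" "y \<noteq> b" "v = port b y" using port_ex[of b v] v ab by blast
  note uv = x(3) y(3)
  interpret two_ends S V E port f t FV FE i a b x y
    by unfold_locales (use ab x y hamW in auto)
  interpret swap: two_ends S V E port f t FV FE i b a y x
    by (rule two_ends_swap)
  show ?thesis
  proof (cases "f + 7 \<le> t")
    case True
    then show ?thesis using goal_if_large tot unfolding uv by blast
  next
    case False
    then have VD: "\<forall>i\<in>S. \<forall>w\<in>V i. \<forall>u\<in>V i - {w}. \<forall>v\<in>V i - {w}. u \<noteq> v \<longrightarrow> joins (E i) (V i - {w}) u v"
      using vd by blast
    consider "port i a \<notin> FV" | "port i b \<notin> FV" | "port i a \<in> FV" "port i b \<in> FV" by blast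
    then show ?thesis
    proof cases
      case 1
      then show ?thesis using goal_if_first[OF VD] unfolding uv by blast
    next
      case 2
      then show ?thesis using joins_rev[OF swap.goal_if_first[OF VD]] unfolding uv by blast
    next
      case 3
      then show ?thesis using goal_if_none unfolding uv by blast
    qed
  qed
qed

section \<open>One fault in each of two copies\<close>

text \<open>Covers the only way in which two copies can exceed their share: \<open>f = 0\<close>,
  two faults, one in each copy. Both copies still have Hamiltonian cycles.\<close>

locale two_faulty = faulty_cells S V E port f t FV FE
  for S :: "'c set" and V :: "'c \<Rightarrow> 'v set" and E :: "'c \<Rightarrow> 'v set set" and port :: "'c \<Rightarrow> 'c \<Rightarrow> 'v"
    and f t FV FE +
  fixes i j :: 'c
  assumes ij: "i \<in> S" "j \<in> S" "i \<noteq> j" and FVij: "FV \<subseteq> V i \<union> V j" and FEij: "FE \<subseteq> E i \<union> E j"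
    and hami: "hamiltonian (V i - FV) (edges - FE)" and hamj: "hamiltonian (V j - FV) (edges - FE)"
    and one: "phi i = 1" "phi j = 1"
begin

abbreviation "U \<equiv> S - {i, j}"
abbreviation "G \<equiv> edges - FE"

lemma two_faulty_swap: "two_faulty S V E port f t FV FE j i"
  using two_faulty_axioms unfolding two_faulty_def two_faulty_axioms_def by auto

lemma port_clean: "c \<in> U \<Longrightarrow> d \<in> S \<Longrightarrow> d \<noteq> c \<Longrightarrow> port c d \<notin> FV"
  using FVij ij port_notin[of c d i] port_notin[of c d j] by auto

lemma cross_clean: "p \<in> S \<Longrightarrow> q \<in> S \<Longrightarrow> p \<noteq> q \<Longrightarrow> {port p q, port q p} \<notin> FE"
  using FEij ij cross_notin_E[of p q i] cross_notin_E[of p q j] by blast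

lemma not_bad: "p \<in> U \<Longrightarrow> q \<in> U \<Longrightarrow> p \<noteq> q \<Longrightarrow> {p, q} \<notin> bad FV FE"
  using bad_sym[of p q FV FE] port_clean[of p q] port_clean[of q p] cross_clean[of p q] by auto

lemma bad_out: "p \<in> S \<Longrightarrow> q \<in> U \<Longrightarrow> p \<noteq> q \<Longrightarrow> {p, q} \<in> bad FV FE \<longleftrightarrow> port p q \<in> FV"
  using bad_sym[of p q FV FE] port_clean[of q p] cross_clean[of p q] by auto

lemma link: "c \<in> U \<Longrightarrow> linked FV FE c"
proof -
  assume c: "c \<in> U"
  have "FV \<inter> V c = {}" using FVij c ij disjoint_V[of c i] disjoint_V[of c j] by blast
  moreover have "FE \<inter> E c = {}" using FEij c ij E_disjoint[of c i] E_disjoint[of c j] by blast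
  ultimately have "phi c = 0" by (simp add: phi_def)
  then show ?thesis using linked_if[of c] c by simp
qed

lemma run_U:
  assumes "A \<subseteq> U" "a \<in> A" "b \<in> A" "x \<in> S" "y \<in> S" "x \<notin> A" "y \<notin> A" "a = b \<Longrightarrow> A = {a} \<and> x \<noteq> y"
  shows "joins G (region FV A) (port a x) (port b y)"
proof (rule run)
  show "port a x \<notin> FV" "port b y \<notin> FV" using assms port_clean by blast+
  show "induced (bad FV FE) A = {}" using not_bad assms(1) unfolding induced_def by blast
  show "linked FV FE c" if "c \<in> A" for c using link that assms(1) by blast
qed (use assms in auto)

definition nbr :: "'c \<Rightarrow> 'c \<Rightarrow> 'c \<Rightarrow> bool" where
  "nbr k e e' \<longleftrightarrow> e \<in> S - {k} \<and> e' \<in> S - {k} \<and> e \<noteq> e' \<and> port k e \<notin> FV \<and> port k e' \<notin> FV \<and>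
     joins G (region FV {k}) (port k e) (port k e')"

lemma nbr_sym: "nbr k e e' \<Longrightarrow> nbr k e' e"
  unfolding nbr_def using joins_rev by metis

lemma nbr_other:
  assumes "hamiltonian (V k - FV) G" "k \<in> S" "e \<in> S - {k}" "port k e \<notin> FV"
  shows "\<exists>e'. nbr k e e' \<and> e' \<noteq> z"
proof -
  have "port k e \<in> V k - FV" using assms port_in[of k e] by auto
  then obtain s s' where s: "s \<noteq> s'" "s \<noteq> port k e" "s' \<noteq> port k e"
    "joins G (V k - FV) (port k e) s" "joins G (V k - FV) (port k e) s'"
    using hamiltonian_two_neighbours[OF assms(1)] by blast
  obtain e1 where e1: "e1 \<in> S" "e1 \<noteq> k" "s = port k e1" using port_ex[of k s] joins_in[OF s(4)] assms(2) by blast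
  obtain e2 where e2: "e2 \<in> S" "e2 \<noteq> k" "s' = port k e2" using port_ex[of k s'] joins_in[OF s(5)] assms(2) by blast
  have "nbr k e e1" "nbr k e e2" "e1 \<noteq> e2"
    using s e1 e2 assms joins_in[OF s(4)] joins_in[OF s(5)] by (auto simp: nbr_def)
  then show ?thesis by metis
qed

lemma close:
  assumes "joins G (region FV S) (port i e) (port e i)" "e \<in> U" "port i e \<notin> FV"
  shows "hamiltonian (verts - FV) G"
proof (rule hamiltonianI)
  show "joins G (verts - FV) (port i e) (port e i)" using assms(1) by (simp add: region_S)
  have "{e, i} \<notin> bad FV FE" using bad_out[of i e] assms ij by (auto simp: insert_commute)
  then show "{port e i, port i e} \<in> G" using good_edge[of e i] assms(2) ij by auto
  have "V i - FV \<subseteq> verts - FV" using ij(1) unfolding verts_def by blast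
  then show "3 \<le> card (verts - FV)"
    using hamiltonian_card[OF hami] card_mono[of "verts - FV" "V i - FV"] finite_verts by simp
qed

text \<open>Cyclic order of visit: \<open>i\<close>, \<open>j\<close>, \<open>g\<close>, the
  remaining copies ending with \<open>e\<close>, and back to \<open>i\<close>; all that is required
  is \<open>g \<noteq> e\<close>.\<close>

lemma hamiltonian_if_direct:
  assumes "port i j \<notin> FV" "port j i \<notin> FV"
  shows "hamiltonian (verts - FV) G"
proof -
  obtain e where e: "nbr i j e" using nbr_other[OF hami] ij assms(1) by blast
  obtain g where g: "nbr j i g" "g \<noteq> e" using nbr_other[OF hamj, of i e] ij assms(2) by blast
  have eg: "e \<in> U" "g \<in> U" "port i e \<notin> FV" "port j g \<notin> FV" using e g by (auto simp: nbr_def)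
  have b: "{i, j} \<notin> bad FV FE" using bad_sym[of i j] cross_clean[of i j] ij assms by simp
  have bg: "{j, g} \<notin> bad FV FE" using bad_out[of j g] eg ij by auto
  have r: "joins G (region FV U) (port g j) (port e i)"
    by (rule run_U) (use eg g ij in auto)
  have 1: "joins G (region FV {i}) (port i e) (port i j)" using nbr_sym[OF e] by (simp add: nbr_def)
  have 2: "joins G (region FV {j}) (port j i) (port j g)" using g by (simp add: nbr_def)
  have 3: "joins G (region FV ({j} \<union> U)) (port j i) (port e i)"
    by (rule glue[OF 2 r bg]) (use eg ij in auto)
  have "joins G (region FV ({i} \<union> ({j} \<union> U))) (port i e) (port e i)"
    by (rule glue[OF 1 3 b]) (use ij in auto)
  moreover have "{i} \<union> ({j} \<union> U) = S" using ij by blast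
  ultimately show ?thesis using close[of e] eg by simp
qed

text \<open>The vertex \<open>port i j\<close> is the only fault in \<open>i\<close>, so all other
  ports of \<open>i\<close> are intact. Cyclic order of visit: \<open>i\<close>, \<open>e'\<close>,
  \<open>g\<close>, \<open>j\<close>, \<open>g'\<close>, the remaining copies ending with
  \<open>e\<close>; the copies \<open>e'\<close> and \<open>g\<close> may coincide.\<close>

lemma hamiltonian_if_indirect:
  assumes pij: "port i j \<in> FV"
  shows "hamiltonian (verts - FV) G"
proof -
  have ok: "port i q \<notin> FV" if "q \<in> U" for q
  proof
    assume "port i q \<in> FV"
    then have "{port i j, port i q} \<subseteq> FV \<inter> V i" using pij port_in[of i] ij that by auto
    then have "card {port i j, port i q} \<le> 1"
      using one(1) card_mono[of "FV \<inter> V i" "{port i j, port i q}"] finite_F unfolding phi_def by simp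
    then show False using port_eq[of i j q] ij that by (auto simp: card_insert_if split: if_splits)
  qed
  have "\<not> V j - FV \<subseteq> {port j i}"
    using hamiltonian_card[OF hamj] card_mono[of "{port j i}" "V j - FV"] by auto
  then obtain g where g: "g \<in> U" "port j g \<notin> FV" using port_ex[of j] ij by blast
  then obtain g' where g': "nbr j g g'" "g' \<noteq> i" using nbr_other[OF hamj, of g i] ij by blast
  then have g'U: "g' \<in> U" "g \<noteq> g'" by (auto simp: nbr_def)
  have "card U + 2 = t + 1" using ij card_S finite_S t_ge by (simp add: card_Diff_subset)
  then have "card {g, g'} < card U" using t_ge by (simp add: card_insert_if)
  then have "\<not> U \<subseteq> {g, g'}" using card_mono[of "{g, g'}" U] by (metis finite.emptyI finite.insertI not_le)
  then obtain e where e: "e \<in> U" "e \<noteq> g" "e \<noteq> g'" by blast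
  obtain e' where e': "nbr i e e'" using nbr_other[OF hami, of e] ok[OF e(1)] e(1) ij by blast
  have e'U: "e' \<in> U" "e \<noteq> e'" using e' pij by (auto simp: nbr_def)
  have main: ?thesis if gg: "nbr j g g'" "g \<in> U" "g' \<in> U" "g \<noteq> g'" "e \<noteq> g" "e \<noteq> g'" "e' \<noteq> g'" for g g'
  proof -
    have b: "{i, e'} \<notin> bad FV FE" "{g, j} \<notin> bad FV FE" "{j, g'} \<notin> bad FV FE"
      using bad_out[of i e'] bad_out[of j g] bad_out[of j g'] ok e'U gg ij by (auto simp: nbr_def insert_commute)
    let ?A = "{e', g}"
    have 1: "joins G (region FV {i}) (port i e) (port i e')" using e' by (simp add: nbr_def)
    have 2: "joins G (region FV ?A) (port e' i) (port g j)"
      by (rule run_U) (use e'U gg ij in auto)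
    have 3: "joins G (region FV {j}) (port j g) (port j g')" using gg(1) by (simp add: nbr_def)
    have 4: "joins G (region FV (U - ?A)) (port g' j) (port e i)"
      by (rule run_U) (use e'U gg e ij in auto)
    have 5: "joins G (region FV ({j} \<union> (U - ?A))) (port j g) (port e i)"
      by (rule glue[OF 3 4 b(3)]) (use gg ij in auto)
    have 6: "joins G (region FV (?A \<union> ({j} \<union> (U - ?A)))) (port e' i) (port e i)"
      by (rule glue[OF 2 5 b(2)]) (use gg e'U ij in auto)
    have "joins G (region FV ({i} \<union> (?A \<union> ({j} \<union> (U - ?A))))) (port i e) (port e i)"
      by (rule glue[OF 1 6 b(1)]) (use gg e'U ij in auto)
    moreover have "{i} \<union> (?A \<union> ({j} \<union> (U - ?A))) = S" using ij e'U gg by blast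
    ultimately show ?thesis using close[of e] e(1) ok[OF e(1)] by simp
  qed
  \<comment> \<open>Only \<open>e' = g'\<close> is excluded, and interchanging \<open>g\<close> and
    \<open>g'\<close> removes this obstruction.\<close>
  show ?thesis
  proof (cases "e' = g'")
    case True
    then show ?thesis using main[OF nbr_sym[OF g'(1)]] g g'U e by metis
  next
    case False
    then show ?thesis using main[OF g'(1)] g g'U e by metis
  qed
qed

end

section \<open>The inductive step for an arbitrary fault set\<close>

context faulty_cells
begin

lemma hamiltonian_if_two_full:
  assumes tot: "card FV + card FE \<le> 2" and ij: "i \<in> S" "j \<in> S" "i \<noteq> j" and phi: "1 \<le> phi i" "1 \<le> phi j"
  shows "hamiltonian (verts - FV) (edges - FE)"
proof -
  have p: "phi i = 1" "phi j = 1" "card FV + card FE = 2" using phi_two[OF ij] phi tot by linarith+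
  have "FV \<inter> V j \<subseteq> FV - V i" "FE \<inter> E j \<subseteq> FE - E i"
    using disjoint_V[OF ij] E_disjoint[OF ij] by blast+
  moreover have "card (FV \<inter> V j) + card (FE \<inter> E j) = card (FV - V i) + card (FE - E i)"
    using phi_split[of i] p unfolding phi_def[of j] by linarith
  moreover have "card (FV \<inter> V j) \<le> card (FV - V i)" "card (FE \<inter> E j) \<le> card (FE - E i)"
    using calculation(1,2) finite_F by (simp_all add: card_mono)
  ultimately have "FV \<inter> V j = FV - V i" "FE \<inter> E j = FE - E i"
    using card_subset_eq[of "FV - V i" "FV \<inter> V j"] card_subset_eq[of "FE - E i" "FE \<inter> E j"] finite_F by auto
  then have sub: "FV \<subseteq> V i \<union> V j" "FE \<subseteq> E i \<union> E j" by blast+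
  interpret two_faulty S V E port f t FV FE i j
    by unfold_locales (use ij sub p hamiltonian_if[of i] hamiltonian_if[of j] in auto)
  interpret swap: two_faulty S V E port f t FV FE j i by (rule two_faulty_swap)
  show ?thesis using hamiltonian_if_direct hamiltonian_if_indirect swap.hamiltonian_if_indirect by blast
qed

lemma all_in_one:
  assumes "i \<in> S" "card FV + card FE \<le> phi i"
  shows "one_faulty S V E port f t FV FE i"
proof
  have "card (FV - V i) = 0" "card (FE - E i) = 0" using phi_split[of i] assms(2) by linarith+
  then show "FV \<subseteq> V i" "FE \<subseteq> E i" using finite_F by auto
qed (rule assms(1))

lemma joins_step:
  assumes tot: "card FV + card FE \<le> f + 1" and uv: "u \<in> verts - FV" "v \<in> verts - FV" "u \<noteq> v"
  shows "joins (edges - FE) (verts - FV) u v"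
proof -
  obtain a where a: "a \<in> S" "u \<in> V a" using uv(1) unfolding verts_def by blast
  obtain b where b: "b \<in> S" "v \<in> V b" using uv(2) unfolding verts_def by blast
  show ?thesis
  proof (cases "\<forall>c\<in>S. phi c \<le> f")
    case True
    then show ?thesis
      using hc_different_copies[OF tot, of a b u v] hc_same_copy[OF tot, of a u v] a b uv by (cases "a = b") auto
  next
    case False
    then obtain i where i: "i \<in> S" "f + 1 \<le> phi i" by force
    have eq: "card FV + card FE = f + 1" using phi_split[of i] tot i by linarith
    interpret one_faulty S V E port f t FV FE i
      by (rule all_in_one) (use i eq in auto)
    have hamW: "hamiltonian (V i - FV) (edges - FE)"
      by (rule hamiltonian_if[OF i(1)]) (use phi_split[of i] eq in linarith)
    consider "a = i" "b = i" | "a = i" "b \<noteq> i" | "a \<noteq> i" "b = i" | "a \<noteq> i" "b \<noteq> i" "a = b" | "a \<noteq> i" "b \<noteq> i" "a \<noteq> b"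
      by blast
    then show ?thesis
    proof cases
      case 1
      then show ?thesis using hc_inside[OF eq, of u v] a b uv by simp
    next
      case 2
      then show ?thesis using hc_to_inside[OF hamW, of b u v] a b uv by simp
    next
      case 3
      then show ?thesis using joins_rev[OF hc_to_inside[OF hamW, of a v u]] a b uv by simp
    next
      case 4
      then show ?thesis using hc_other_copy[OF hamW, of a u v] a b uv by simp
    next
      case 5
      then show ?thesis using hc_two_others[OF hamW, of a b u v] a b uv eq by simp
    qed
  qed
qed

lemma hamiltonian_step:
  assumes tot: "card FV + card FE \<le> f + 2"
  shows "hamiltonian (verts - FV) (edges - FE)"
proof (cases "\<forall>c\<in>S. phi c \<le> f")
  case True
  then show ?thesis using hamiltonian_if_spread[OF tot] by blast
next
  case False
  then obtain i where i: "i \<in> S" "f + 1 \<le> phi i" by force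
  have le: "phi i \<le> f + 2" using phi_split[of i] tot by linarith
  show ?thesis
  proof (cases "phi i = f + 2")
    case True
    then have eq: "card FV + card FE = f + 2" using phi_split[of i] tot by linarith
    interpret one_faulty S V E port f t FV FE i
      by (rule all_in_one) (use i eq True in auto)
    show ?thesis by (rule hamiltonian_inside[OF eq])
  next
    case False
    then have eq: "phi i = f + 1" using le i by simp
    show ?thesis
    proof (cases "\<forall>c\<in>S - {i}. phi c \<le> f")
      case True
      then show ?thesis using hamiltonian_if_one_full[OF tot i(1) eq] by blast
    next
      case False
      then obtain j where j: "j \<in> S" "i \<noteq> j" "f + 1 \<le> phi j" by force
      \<comment> \<open>Two copies with at least f + 1 faults each among at most f + 2 faults leave
        only \<open>f = 0\<close>.\<close>
      then have "f = 0" using phi_two[of i j] i eq tot by simp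
      then show ?thesis using hamiltonian_if_two_full[of i j] tot i j by simp
    qed
  qed
qed

end

section \<open>Transfer to DCell\<close>

text \<open>\<open>Y\<close> is any finite set, not necessarily a set of edges, so that pairs such
  as \<open>{p, d}\<close> can be forbidden without deciding whether they are edges.\<close>

definition tolerantly_connected :: "nat \<Rightarrow> 'a set \<Rightarrow> 'a set set \<Rightarrow> bool" where
  "tolerantly_connected f V E \<longleftrightarrow> (\<forall>X Y u v. X \<subseteq> V \<longrightarrow> finite Y \<longrightarrow> card X + card Y \<le> f \<longrightarrow>
     u \<in> V - X \<longrightarrow> v \<in> V - X \<longrightarrow> u \<noteq> v \<longrightarrow> joins (E - Y) (V - X) u v)"

definition tolerantly_hamiltonian :: "nat \<Rightarrow> 'a set \<Rightarrow> 'a set set \<Rightarrow> bool" where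
  "tolerantly_hamiltonian f V E \<longleftrightarrow> (\<forall>X Y. X \<subseteq> V \<longrightarrow> finite Y \<longrightarrow> card X + card Y \<le> f \<longrightarrow>
     hamiltonian (V - X) (E - Y))"

lemma joins_image:
  assumes "joins E W u v" "inj_on h W"
    and "\<And>x y. {x, y} \<in> E \<Longrightarrow> x \<in> W \<Longrightarrow> y \<in> W \<Longrightarrow> x \<noteq> y \<Longrightarrow> {h x, h y} \<in> E'"
  shows "joins E' (h ` W) (h u) (h v)"
proof -
  obtain p where p: "hamiltonian_path W E u v p" using assms unfolding joins_def by blast
  have "is_path E' (map h p)" using p assms(3)
    unfolding hamiltonian_path_def is_path_def by (auto simp: nth_eq_iff_index_eq)
  then have "hamiltonian_path (h ` W) E' (h u) (h v) (map h p)"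
    using p assms(2) by (auto simp: hamiltonian_path_def hd_map last_map distinct_map)
  then show ?thesis unfolding joins_def by blast
qed

lemma hamiltonian_image:
  assumes "hamiltonian W E" "inj_on h W"
    and "\<And>x y. {x, y} \<in> E \<Longrightarrow> x \<in> W \<Longrightarrow> y \<in> W \<Longrightarrow> x \<noteq> y \<Longrightarrow> {h x, h y} \<in> E'"
  shows "hamiltonian (h ` W) E'"
proof -
  obtain c where c: "hamiltonian_cycle W E c" using assms unfolding hamiltonian_def by blast
  then have ne: "c \<noteq> []" by (auto simp: hamiltonian_cycle_def)
  have "joins E' (h ` W) (h (hd c)) (h (last c))"
    by (rule joins_image[OF hamiltonian_cycle_joins[OF c] assms(2,3)])
  moreover have "{h (last c), h (hd c)} \<in> E'"
  proof (rule assms(3))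
    show "last c \<noteq> hd c" using c by (cases c; cases "tl c") (auto simp: hamiltonian_cycle_def)
  qed (use c ne in \<open>auto simp: hamiltonian_cycle_def\<close>)
  moreover have "3 \<le> card (h ` W)" using hamiltonian_card[OF assms(1)] card_image[OF assms(2)] by simp
  ultimately show ?thesis by (rule hamiltonianI)
qed

lemma fault_hamiltonian_connectedI:
  assumes "tolerantly_connected f V E" "finite E"
  shows "fault_hamiltonian_connected (int f) V E"
  unfolding fault_hamiltonian_connected_def hamiltonian_connected_def del_verts_def joins_def[symmetric]
proof (intro allI impI ballI)
  fix FV FE u v
  assume F: "FV \<subseteq> V" "FE \<subseteq> E" "int (card FV + card FE) \<le> int f" and uv: "u \<in> V - FV" "v \<in> V - FV" "u \<noteq> v"
  have "finite FE" using F(2) assms(2) finite_subset by blast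
  moreover have "card FV + card FE \<le> f" using F(3) by linarith
  ultimately have "joins (E - FE) (V - FV) u v"
    using assms(1) F uv unfolding tolerantly_connected_def by blast
  then show "joins (del_edges E FV FE) (V - FV) u v"
    by (rule joins_mono) (auto simp: del_edges_def)
qed

lemma fault_hamiltonianI:
  assumes "tolerantly_hamiltonian f V E" "finite E"
  shows "fault_hamiltonian (int f) V E"
  unfolding fault_hamiltonian_def del_verts_def
proof (intro allI impI)
  fix FV FE
  assume F: "FV \<subseteq> V" "FE \<subseteq> E" "int (card FV + card FE) \<le> int f"
  have "finite FE" using F(2) assms(2) finite_subset by blast
  moreover have "card FV + card FE \<le> f" using F(3) by linarith
  ultimately have "hamiltonian (V - FV) (E - FE)"
    using assms(1) F unfolding tolerantly_hamiltonian_def by blast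
  then show "hamiltonian (V - FV) (del_edges E FV FE)"
    by (rule hamiltonian_mono) (auto simp: del_edges_def)
qed

lemma fault_vacuous:
  assumes "f < 0"
  shows "fault_hamiltonian f V E" "fault_hamiltonian_connected f V E"
  using assms by (auto simp: fault_hamiltonian_def fault_hamiltonian_connected_def)

lemma length_dc_verts: "v \<in> dc_verts n k \<Longrightarrow> length v = Suc k"
  by (induction k arbitrary: v) auto

lemma dc_uid_Cons: "v \<in> dc_verts n k \<Longrightarrow> dc_uid n (a # v) = a * dc_t n k + dc_uid n v"
  using length_dc_verts[of v n k] by (cases v) auto

text \<open>The identifier of a tail is smaller than \<open>dc_t n k\<close>, so quotient and
  remainder modulo \<open>dc_t n k\<close> recover the leading entry and the identifier of the
  tail.\<close>

lemma dc_uid_bij: "bij_betw (dc_uid n) (dc_verts n k) {..<dc_t n k}"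
proof (induction k)
  case 0
  show ?case by (rule bij_betw_byWitness[of _ "\<lambda>a. [a]"]) auto
next
  case (Suc k)
  let ?t = "dc_t n k"
  have lt: "dc_uid n v < ?t" if "v \<in> dc_verts n k" for v using Suc that by (auto simp: bij_betw_def)
  show ?case
  proof (rule bij_betw_imageI)
    show "inj_on (dc_uid n) (dc_verts n (Suc k))"
    proof (rule inj_onI)
      fix v w assume "v \<in> dc_verts n (Suc k)" "w \<in> dc_verts n (Suc k)" and eq: "dc_uid n v = dc_uid n w"
      then obtain a v' b w' where vw: "v = a # v'" "w = b # w'" "v' \<in> dc_verts n k" "w' \<in> dc_verts n k" by auto
      then have e: "a * ?t + dc_uid n v' = b * ?t + dc_uid n w'" using eq dc_uid_Cons by metis
      have "(a * ?t + dc_uid n v') div ?t = a" "(b * ?t + dc_uid n w') div ?t = b"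
        using lt[OF vw(3)] lt[OF vw(4)] by simp_all
      then have "a = b" using e by simp
      then have "dc_uid n v' = dc_uid n w'" using e by simp
      then show "v = w" using Suc vw \<open>a = b\<close> by (auto simp: bij_betw_def inj_on_def)
    qed
    show "dc_uid n ` dc_verts n (Suc k) = {..<dc_t n (Suc k)}"
    proof (intro equalityI subsetI)
      fix x assume "x \<in> dc_uid n ` dc_verts n (Suc k)"
      then obtain a v where "a \<le> ?t" "v \<in> dc_verts n k" "x = a * ?t + dc_uid n v" using dc_uid_Cons by fastforce
      then have "x < a * ?t + ?t" "a * ?t \<le> ?t * ?t" using lt by (auto intro: mult_le_mono1)
      then have "x < ?t * ?t + ?t" by linarith
      then show "x \<in> {..<dc_t n (Suc k)}" by simp
    next
      fix x assume "x \<in> {..<dc_t n (Suc k)}"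
      then have x: "x < ?t * (?t + 1)" by simp
      then have "0 < ?t" by (metis gr0I mult_0 not_less0)
      then have "x mod ?t < ?t" by simp
      then obtain v where v: "v \<in> dc_verts n k" "dc_uid n v = x mod ?t"
        using Suc by (metis bij_betw_def imageE lessThan_iff)
      have "x div ?t \<le> ?t" using x by (metis add.commute less_Suc_eq_le less_mult_imp_div_less mult.commute plus_1_eq_Suc)
      then have "(x div ?t) # v \<in> dc_verts n (Suc k)" using v by auto
      moreover have "dc_uid n ((x div ?t) # v) = x"
        unfolding dc_uid_Cons[OF v(1)] v(2) by (rule div_mult_mod_eq)
      ultimately show "x \<in> dc_uid n ` dc_verts n (Suc k)" by force
    qed
  qed
qed

lemma finite_dc_verts: "finite (dc_verts n k)"
  using dc_uid_bij bij_betw_finite by blast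

lemma card_dc_verts: "card (dc_verts n k) = dc_t n k"
  using bij_betw_same_card[OF dc_uid_bij[of n k]] by simp

lemma dc_edges_doubleton:
  "e \<in> dc_edges n k \<Longrightarrow> \<exists>u v. e = {u, v} \<and> u \<in> dc_verts n k \<and> v \<in> dc_verts n k"
proof (induction k arbitrary: e)
  case (Suc k)
  then consider i u v where "e = {i # u, i # v}" "i \<le> dc_t n k" "{u, v} \<in> dc_edges n k"
    | a b u v where "e = {a # u, b # v}" "a < b" "b \<le> dc_t n k" "u \<in> dc_verts n k" "v \<in> dc_verts n k" by auto
  then show ?case
  proof cases
    case 1
    then have "u \<in> dc_verts n k" "v \<in> dc_verts n k" using Suc.IH[of "{u, v}"] by (auto simp: doubleton_eq_iff)
    then show ?thesis using 1 by (intro exI[of _ "i # u"] exI[of _ "i # v"]) simp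
  next
    case 2
    then show ?thesis by (intro exI[of _ "a # u"] exI[of _ "b # v"]) simp
  qed
qed auto

lemma finite_dc_edges: "finite (dc_edges n k)"
  by (rule finite_subset[of _ "Pow (dc_verts n k)"]) (use dc_edges_doubleton finite_dc_verts in fastforce)+

definition dc_vert :: "nat \<Rightarrow> nat \<Rightarrow> nat \<Rightarrow> nat list" where
  "dc_vert n k = inv_into (dc_verts n k) (dc_uid n)"

lemma dc_vert_in: "x < dc_t n k \<Longrightarrow> dc_vert n k x \<in> dc_verts n k"
  using dc_uid_bij[of n k] unfolding dc_vert_def by (auto simp: bij_betw_def intro: inv_into_into)

lemma dc_uid_vert: "x < dc_t n k \<Longrightarrow> dc_uid n (dc_vert n k x) = x"
  using dc_uid_bij[of n k] unfolding dc_vert_def by (auto simp: bij_betw_def intro: f_inv_into_f)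

lemma dc_vert_uid: "v \<in> dc_verts n k \<Longrightarrow> dc_vert n k (dc_uid n v) = v"
  using dc_uid_bij[of n k] unfolding dc_vert_def by (auto simp: bij_betw_def)

lemma dc_vert_bij: "bij_betw (dc_vert n k) {..<dc_t n k} (dc_verts n k)"
  unfolding dc_vert_def by (rule bij_betw_inv_into[OF dc_uid_bij])

text \<open>The copies other than \<open>i\<close> are numbered consecutively with \<open>i\<close>
  skipped. For \<open>a < b\<close> this gives identifier \<open>b - 1\<close> in copy
  \<open>a\<close> and \<open>a\<close> in copy \<open>b\<close>, which is the rule for the cross
  edges.\<close>

definition dc_port :: "nat \<Rightarrow> nat \<Rightarrow> nat \<Rightarrow> nat \<Rightarrow> nat list" where
  "dc_port n k i j = i # dc_vert n k (if i < j then j - 1 else j)"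

abbreviation "dc_copy_verts n k i \<equiv> (#) i ` dc_verts n k"
abbreviation "dc_copy_edges n k i \<equiv> (`) ((#) i) ` dc_edges n k"

lemma dc_cells: "cells {..dc_t n k} (dc_copy_verts n k) (dc_copy_edges n k) (dc_port n k)"
proof
  fix i assume i: "i \<in> {..dc_t n k}"
  let ?g = "\<lambda>j. if i < j then j - 1 else j"
  have g: "bij_betw ?g ({..dc_t n k} - {i}) {..<dc_t n k}"
    by (rule bij_betw_byWitness[of _ "\<lambda>x. if x < i then x else x + 1"]) (use i in auto)
  have "bij_betw ((#) i) (dc_verts n k) (dc_copy_verts n k i)" by (simp add: bij_betw_def)
  from bij_betw_trans[OF bij_betw_trans[OF g dc_vert_bij] this]
  show "bij_betw (dc_port n k i) ({..dc_t n k} - {i}) (dc_copy_verts n k i)"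
    by (rule bij_betw_cong[THEN iffD1, rotated]) (simp add: dc_port_def)
next
  fix i e assume "e \<in> dc_copy_edges n k i"
  then show "e \<subseteq> dc_copy_verts n k i \<and> e \<noteq> {}" using dc_edges_doubleton by fastforce
qed auto

lemma dc_cells_verts: "cells.verts {..dc_t n k} (dc_copy_verts n k) = dc_verts n (Suc k)"
  by (subst cells.verts_def[OF dc_cells]) auto

lemma dc_cells_edges:
  "cells.edges {..dc_t n k} (dc_copy_edges n k) (dc_port n k) = dc_edges n (Suc k)"
proof -
  interpret cells "{..dc_t n k}" "dc_copy_verts n k" "dc_copy_edges n k" "dc_port n k" by (rule dc_cells)
  have "(\<Union>i\<in>{..dc_t n k}. dc_copy_edges n k i) =
    {{i # u, i # v} | i u v. i \<le> dc_t n k \<and> {u, v} \<in> dc_edges n k}" (is "?L = ?R")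
  proof (intro equalityI subsetI)
    fix e assume "e \<in> ?L"
    then obtain i e' where e: "i \<le> dc_t n k" "e' \<in> dc_edges n k" "e = (#) i ` e'" by auto
    then obtain u v where "e' = {u, v}" using dc_edges_doubleton by blast
    then show "e \<in> ?R" using e by auto
  next
    fix e assume "e \<in> ?R"
    then obtain i u v where e: "i \<le> dc_t n k" "{u, v} \<in> dc_edges n k" "e = {i # u, i # v}" by blast
    then have "e = (#) i ` {u, v}" by simp
    then show "e \<in> ?L" using e by blast
  qed
  moreover have "cross = {{a # u, b # v} | a b u v. a < b \<and> b \<le> dc_t n k \<and>
          u \<in> dc_verts n k \<and> v \<in> dc_verts n k \<and> dc_uid n u = b - 1 \<and> dc_uid n v = a}" (is "_ = ?R")
  proof (intro equalityI subsetI)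
    fix e assume "e \<in> cross"
    then obtain a b where ab: "a < b" "b \<le> dc_t n k" "e = {dc_port n k a b, dc_port n k b a}"
      unfolding cross_def by (smt (verit) atMost_iff insert_commute linorder_neqE_nat mem_Collect_eq)
    then show "e \<in> ?R" using dc_vert_in[of "b - 1" n k] dc_vert_in[of a n k] dc_uid_vert[of "b - 1" n k] dc_uid_vert[of a n k]
      unfolding dc_port_def by (intro CollectI exI[of _ a] exI[of _ b] exI[of _ "dc_vert n k (b - 1)"] exI[of _ "dc_vert n k a"]) auto
  next
    fix e assume "e \<in> ?R"
    then obtain a b u v where ab: "e = {a # u, b # v}" "a < b" "b \<le> dc_t n k"
      "u \<in> dc_verts n k" "v \<in> dc_verts n k" "dc_uid n u = b - 1" "dc_uid n v = a" by blast
    then have "e = {dc_port n k a b, dc_port n k b a}"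
      using dc_vert_uid[of u n k] dc_vert_uid[of v n k] by (simp add: dc_port_def)
    moreover have "a \<in> {..dc_t n k}" "b \<in> {..dc_t n k}" "a \<noteq> b" using ab by auto
    ultimately show "e \<in> cross" unfolding cross_def by blast
  qed
  ultimately show ?thesis unfolding edges_def by simp
qed

lemma dc_t_ge: "2 \<le> n \<Longrightarrow> n + k \<le> dc_t n k"
proof (induction k)
  case (Suc k)
  then have "1 * 1 \<le> dc_t n k * dc_t n k" by (intro mult_le_mono) linarith+
  then have "n + k + 1 \<le> dc_t n k * dc_t n k + dc_t n k" using Suc by linarith
  then show ?case by simp
qed simp

text \<open>Faults of a copy are pulled back along the injection \<open>(#) i\<close>; their number
  does not grow, and the paths found in \<open>dc_verts n k\<close> are mapped forward.\<close>

lemma dcell_step: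
  assumes conn: "tolerantly_connected f (dc_verts n k) (dc_edges n k)"
    and ham: "tolerantly_hamiltonian (f + 1) (dc_verts n k) (dc_edges n k)"
    and t: "f + 4 \<le> dc_t n k"
    and vd: "f + 7 \<le> dc_t n k \<or> (\<forall>w\<in>dc_verts n k. \<forall>u\<in>dc_verts n k - {w}. \<forall>v\<in>dc_verts n k - {w}. u \<noteq> v \<longrightarrow>
      joins (dc_edges n k) (dc_verts n k - {w}) u v)"
  shows "tolerantly_connected (f + 1) (dc_verts n (Suc k)) (dc_edges n (Suc k))"
    and "tolerantly_hamiltonian (f + 2) (dc_verts n (Suc k)) (dc_edges n (Suc k))"
proof -
  let ?V = "dc_verts n k" and ?E = "dc_edges n k" and ?t = "dc_t n k"
  have pull: "\<exists>X' Y'. X' \<subseteq> ?V \<and> finite Y' \<and> card X' + card Y' \<le> card X + card Y \<and>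
      (#) i ` (?V - X') = dc_copy_verts n k i - X \<and>
      (\<forall>x y. {x, y} \<in> ?E - Y' \<longrightarrow> {i # x, i # y} \<in> dc_copy_edges n k i - Y)"
    if XY: "X \<subseteq> dc_copy_verts n k i" "finite Y" for i X and Y :: "nat list set set"
  proof (intro exI conjI allI impI)
    let ?X = "{x \<in> ?V. i # x \<in> X}" and ?Y = "{e \<in> ?E. (#) i ` e \<in> Y}"
    show "?X \<subseteq> ?V" "finite ?Y" using finite_dc_edges[of n k] by auto
    have "finite X" using XY(1) finite_dc_verts finite_subset by blast
    then have "card ?X \<le> card X" by (intro card_inj_on_le[of "(#) i"]) (auto simp: inj_on_def)
    moreover have "card ?Y \<le> card Y"
      using XY(2) by (intro card_inj_on_le[of "(`) ((#) i)"]) (auto simp: inj_on_def inj_image_eq_iff)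
    ultimately show "card ?X + card ?Y \<le> card X + card Y" by simp
    show "(#) i ` (?V - ?X) = dc_copy_verts n k i - X" by auto
    show "{i # x, i # y} \<in> dc_copy_edges n k i - Y" if "{x, y} \<in> ?E - ?Y" for x y
      using that image_eqI[of "{i # x, i # y}" "(`) ((#) i)" "{x, y}" ?E] by auto
  qed
  have inj: "inj_on ((#) i) A" for i :: nat and A by (simp add: inj_on_def)
  interpret tolerant_cells "{..?t}" "dc_copy_verts n k" "dc_copy_edges n k" "dc_port n k" f ?t
  proof (rule tolerant_cells.intro[OF dc_cells], unfold_locales)
    show "card {..?t} = ?t + 1" "f + 4 \<le> ?t" using t by auto
  next
    fix i X Y u v
    assume a: "X \<subseteq> dc_copy_verts n k i" "finite (Y :: nat list set set)" "card X + card Y \<le> f"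
      "u \<in> dc_copy_verts n k i - X" "v \<in> dc_copy_verts n k i - X" "u \<noteq> v"
    obtain X' Y' where p: "X' \<subseteq> ?V" "finite Y'" "card X' + card Y' \<le> card X + card Y"
      "(#) i ` (?V - X') = dc_copy_verts n k i - X"
      "\<forall>x y. {x, y} \<in> ?E - Y' \<longrightarrow> {i # x, i # y} \<in> dc_copy_edges n k i - Y"
      using pull[OF a(1,2)] by (elim exE conjE)
    obtain u' v' where uv: "u = i # u'" "v = i # v'" "u' \<in> ?V - X'" "v' \<in> ?V - X'"
      using a(4,5) unfolding p(4)[symmetric] by blast
    have "joins (?E - Y') (?V - X') u' v'"
      using conn p a uv unfolding tolerantly_connected_def by (metis order_trans)
    then have "joins (dc_copy_edges n k i - Y) ((#) i ` (?V - X')) (i # u') (i # v')"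
      by (rule joins_image[OF _ inj]) (use p(5) in blast)
    then show "joins (dc_copy_edges n k i - Y) (dc_copy_verts n k i - X) u v" by (simp only: p(4) uv)
  next
    fix i X Y
    assume a: "X \<subseteq> dc_copy_verts n k i" "finite (Y :: nat list set set)" "card X + card Y \<le> f + 1"
    obtain X' Y' where p: "X' \<subseteq> ?V" "finite Y'" "card X' + card Y' \<le> card X + card Y"
      "(#) i ` (?V - X') = dc_copy_verts n k i - X"
      "\<forall>x y. {x, y} \<in> ?E - Y' \<longrightarrow> {i # x, i # y} \<in> dc_copy_edges n k i - Y"
      using pull[OF a(1,2)] by (elim exE conjE)
    have "hamiltonian (?V - X') (?E - Y')"
      using ham p a unfolding tolerantly_hamiltonian_def by (metis order_trans)
    then have "hamiltonian ((#) i ` (?V - X')) (dc_copy_edges n k i - Y)"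
      by (rule hamiltonian_image[OF _ inj]) (use p(5) in blast)
    then show "hamiltonian (dc_copy_verts n k i - X) (dc_copy_edges n k i - Y)" by (simp only: p(4))
  next
    show "f + 7 \<le> ?t \<or> (\<forall>i\<in>{..?t}. \<forall>w\<in>dc_copy_verts n k i. \<forall>u\<in>dc_copy_verts n k i - {w}.
      \<forall>v\<in>dc_copy_verts n k i - {w}. u \<noteq> v \<longrightarrow> joins (dc_copy_edges n k i) (dc_copy_verts n k i - {w}) u v)"
    proof (cases "f + 7 \<le> ?t")
      case False
      have "joins (dc_copy_edges n k i) (dc_copy_verts n k i - {w}) u v"
        if w: "w \<in> dc_copy_verts n k i" "u \<in> dc_copy_verts n k i - {w}" "v \<in> dc_copy_verts n k i - {w}" "u \<noteq> v" for i w u v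
      proof -
        obtain w' u' v' where wuv: "w = i # w'" "u = i # u'" "v = i # v'" "w' \<in> ?V" "u' \<in> ?V - {w'}" "v' \<in> ?V - {w'}" "u' \<noteq> v'"
          using w by auto
        then have "joins ?E (?V - {w'}) u' v'" using vd False by blast
        then have "joins (dc_copy_edges n k i) ((#) i ` (?V - {w'})) (i # u') (i # v')"
        proof (rule joins_image[OF _ inj])
          fix x y assume "{x, y} \<in> ?E"
          then have "(#) i ` {x, y} \<in> dc_copy_edges n k i" by (rule imageI)
          then show "{i # x, i # y} \<in> dc_copy_edges n k i" by simp
        qed
        moreover have "(#) i ` (?V - {w'}) = dc_copy_verts n k i - {w}" using wuv by auto
        ultimately show ?thesis using wuv by simp
      qed
      then show ?thesis by blast
    qed simp
  qed
  note ve = dc_cells_verts[of n k] dc_cells_edges[of n k]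
  have fc: "faulty_cells {..?t} (dc_copy_verts n k) (dc_copy_edges n k) (dc_port n k) f ?t X (Y \<inter> edges)"
    if "X \<subseteq> verts" for X Y
    by unfold_locales (use that in auto)
  \<comment> \<open>Members of \<open>Y\<close> that are not edges are discarded; this does not
    change the graph and does not increase the count.\<close>
  have le: "card (Y \<inter> edges) \<le> card Y" if "finite Y" for Y using that by (intro card_mono) auto
  have eq: "edges - Y \<inter> edges = edges - Y" for Y by blast
  show "tolerantly_connected (f + 1) (dc_verts n (Suc k)) (dc_edges n (Suc k))"
    unfolding tolerantly_connected_def ve[symmetric]
  proof (intro allI impI)
    fix X Y u v
    assume "X \<subseteq> verts" "finite (Y :: nat list set set)" "card X + card Y \<le> f + 1" "u \<in> verts - X" "v \<in> verts - X" "u \<noteq> v"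
    then show "joins (edges - Y) (verts - X) u v"
      using faulty_cells.joins_step[OF fc, of X Y u v] le[of Y] eq[of Y] by simp
  qed
  show "tolerantly_hamiltonian (f + 2) (dc_verts n (Suc k)) (dc_edges n (Suc k))"
    unfolding tolerantly_hamiltonian_def ve[symmetric]
  proof (intro allI impI)
    fix X Y
    assume "X \<subseteq> verts" "finite (Y :: nat list set set)" "card X + card Y \<le> f + 2"
    then show "hamiltonian (verts - X) (edges - Y)"
      using faulty_cells.hamiltonian_step[OF fc, of X Y] le[of Y] eq[of Y] by simp
  qed
qed

section \<open>Base cases: executable adjacency and Posa rotations\<close>

text \<open>Adjacency computed on identifiers instead of labels: quotient and remainder are the
  number of the copy and the identifier inside it.\<close>

fun uid_adj :: "nat \<Rightarrow> nat \<Rightarrow> nat \<Rightarrow> nat \<Rightarrow> bool" where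
  "uid_adj n 0 x y \<longleftrightarrow> x \<noteq> y"
| "uid_adj n (Suc k) x y \<longleftrightarrow>
     (if x div dc_t n k = y div dc_t n k then uid_adj n k (x mod dc_t n k) (y mod dc_t n k)
      else if x div dc_t n k < y div dc_t n k
      then Suc (x mod dc_t n k) = y div dc_t n k \<and> y mod dc_t n k = x div dc_t n k
      else Suc (y mod dc_t n k) = x div dc_t n k \<and> x mod dc_t n k = y div dc_t n k)"

lemma dc_vert_Suc:
  assumes "x < dc_t n (Suc k)"
  shows "dc_vert n (Suc k) x = (x div dc_t n k) # dc_vert n k (x mod dc_t n k)"
    and "x div dc_t n k \<le> dc_t n k" "x mod dc_t n k < dc_t n k"
proof -
  let ?t = "dc_t n k"
  have x: "x < (?t + 1) * ?t" using assms by simp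
  then have "0 < ?t" by (metis gr0I mult_0_right not_less0)
  then show 1: "x mod ?t < ?t" by simp
  show 2: "x div ?t \<le> ?t" using less_mult_imp_div_less[OF x] by simp
  have v: "dc_vert n k (x mod ?t) \<in> dc_verts n k" by (rule dc_vert_in[OF 1])
  then have "(x div ?t) # dc_vert n k (x mod ?t) \<in> dc_verts n (Suc k)" using 2 by simp
  moreover have "dc_uid n ((x div ?t) # dc_vert n k (x mod ?t)) = x"
    unfolding dc_uid_Cons[OF v] dc_uid_vert[OF 1] by (rule div_mult_mod_eq)
  ultimately show "dc_vert n (Suc k) x = (x div ?t) # dc_vert n k (x mod ?t)"
    using dc_vert_uid[of "(x div ?t) # dc_vert n k (x mod ?t)" n "Suc k"] by simp
qed

lemma uid_adj_edge:
  "uid_adj n k x y \<Longrightarrow> x < dc_t n k \<Longrightarrow> y < dc_t n k \<Longrightarrow> {dc_vert n k x, dc_vert n k y} \<in> dc_edges n k"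
proof (induction k arbitrary: x y)
  case 0
  have "dc_vert n 0 z = [z]" if "z < n" for z using dc_vert_uid[of "[z]" n 0] that by simp
  then show ?case using 0 by auto
next
  case (Suc k)
  let ?t = "dc_t n k"
  note x = dc_vert_Suc[OF Suc.prems(2)] and y = dc_vert_Suc[OF Suc.prems(3)]
  have cross: "{a # dc_vert n k u, b # dc_vert n k v} \<in> dc_edges n (Suc k)"
    if "a < b" "b \<le> ?t" "Suc u = b" "v = a" "u < ?t" "v < ?t" for a b u v
    using that dc_vert_in[of u n k] dc_vert_in[of v n k] dc_uid_vert[of u n k] dc_uid_vert[of v n k]
    unfolding dc_edges.simps
    by (intro UnI2 CollectI exI[of _ a] exI[of _ b] exI[of _ "dc_vert n k u"] exI[of _ "dc_vert n k v"]) auto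
  consider "x div ?t = y div ?t" | "x div ?t < y div ?t" | "y div ?t < x div ?t" by linarith
  then show ?case
  proof cases
    case 1
    then have "{dc_vert n k (x mod ?t), dc_vert n k (y mod ?t)} \<in> dc_edges n k"
      using Suc.IH[of "x mod ?t" "y mod ?t"] Suc.prems(1) x(3) y(3) by simp
    then show ?thesis unfolding x(1) y(1) dc_edges.simps using 1 x(2) by auto
  next
    case 2
    then show ?thesis using cross[of "x div ?t" "y div ?t" "x mod ?t" "y mod ?t"] Suc.prems(1) x y by simp
  next
    case 3
    then show ?thesis using cross[of "y div ?t" "x div ?t" "y mod ?t" "x mod ?t"] Suc.prems(1) x y
      by (simp add: insert_commute)
  qed
qed

definition uid_edges :: "nat \<Rightarrow> nat \<Rightarrow> nat set set" where
  "uid_edges n k = {{x, y} |x y. x < dc_t n k \<and> y < dc_t n k \<and> uid_adj n k x y}"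

lemma uid_edges_image:
  assumes "{x, y} \<in> uid_edges n k"
  shows "{dc_vert n k x, dc_vert n k y} \<in> dc_edges n k"
proof -
  obtain a b where ab: "{x, y} = {a, b}" "a < dc_t n k" "b < dc_t n k" "uid_adj n k a b"
    using CollectD[OF assms[unfolded uid_edges_def]] by (elim exE conjE)
  have "dc_vert n k ` {x, y} = dc_vert n k ` {a, b}" using ab(1) by (rule arg_cong)
  then have "{dc_vert n k x, dc_vert n k y} = {dc_vert n k a, dc_vert n k b}" by simp
  then show ?thesis using uid_adj_edge[OF ab(4,2,3)] by simp
qed

lemma hamiltonian_uid_image:
  "hamiltonian {..<dc_t n k} (uid_edges n k) \<Longrightarrow> hamiltonian (dc_vert n k ` {..<dc_t n k}) (dc_edges n k)"
  by (rule hamiltonian_image) (use dc_vert_bij in \<open>auto simp: bij_betw_def intro: uid_edges_image\<close>)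

fun adj_path :: "nat \<Rightarrow> nat \<Rightarrow> nat list \<Rightarrow> bool" where
  "adj_path n k (x # y # p) \<longleftrightarrow> uid_adj n k x y \<and> adj_path n k (y # p)"
| "adj_path n k p \<longleftrightarrow> True"

definition adj_cycle :: "nat \<Rightarrow> nat \<Rightarrow> nat list \<Rightarrow> bool" where
  "adj_cycle n k c \<longleftrightarrow> length c = dc_t n k \<and> distinct c \<and> list_all (\<lambda>x. x < dc_t n k) c \<and>
     adj_path n k c \<and> uid_adj n k (last c) (hd c)"

lemma is_path_adj:
  "adj_path n k p \<Longrightarrow> set p \<subseteq> {..<dc_t n k} \<Longrightarrow> is_path (uid_edges n k) p"
  by (induction n k p rule: adj_path.induct) (auto simp: uid_edges_def)

lemma hamiltonian_adj_cycle:
  assumes "adj_cycle n k c" "3 \<le> dc_t n k"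
  shows "hamiltonian_cycle {..<dc_t n k} (uid_edges n k) c"
proof -
  have c: "length c = dc_t n k" "distinct c" "set c \<subseteq> {..<dc_t n k}" "adj_path n k c" "uid_adj n k (last c) (hd c)"
    using assms(1) by (auto simp: adj_cycle_def list_all_iff)
  have "set c = {..<dc_t n k}" using card_subset_eq[of "{..<dc_t n k}" "set c"] c(1,3) distinct_card[OF c(2)] by simp
  moreover have "c \<noteq> []" using c(1) assms(2) by auto
  then have "last c < dc_t n k" "hd c < dc_t n k" using c(3) last_in_set hd_in_set by blast+
  then have "{last c, hd c} \<in> uid_edges n k" using c(5) unfolding uid_edges_def by blast
  ultimately show ?thesis using c assms(2) is_path_adj[of n k c] by (simp add: hamiltonian_cycle_def)
qed

text \<open>Posa rotation: if the first vertex of a path is adjacent to \<open>m\<close>, the part before \<open>m\<close> is reversed;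
  the last vertex stays fixed and the first vertex changes.\<close>

definition rotation :: "nat \<Rightarrow> nat list \<Rightarrow> nat list" where
  "rotation m q = rev (takeWhile (\<lambda>y. y \<noteq> m) q) @ dropWhile (\<lambda>y. y \<noteq> m) q"

lemma split_at_first:
  "u \<notin> set A \<Longrightarrow> takeWhile (\<lambda>y. y \<noteq> u) (A @ u # B) = A \<and> dropWhile (\<lambda>y. y \<noteq> u) (A @ u # B) = u # B"
  by (induction A) auto

text \<open>Dropping the fixed last vertex leaves a path whose ends are adjacent, that is, a
  Hamiltonian cycle after deletion of that vertex.\<close>

definition closes :: "nat \<Rightarrow> nat \<Rightarrow> nat list \<Rightarrow> bool" where
  "closes n k q \<longleftrightarrow> uid_adj n k (last (butlast q)) (hd q)"

text \<open>Performs the rotations at the vertices of a list and accumulates the first vertices of the paths;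
  the boolean records whether the path without its last vertex closed up to a cycle.\<close>

fun rotations :: "nat \<Rightarrow> nat \<Rightarrow> nat list \<Rightarrow> nat list \<Rightarrow> nat list \<Rightarrow> bool \<Rightarrow> nat list \<times> bool" where
  "rotations n k q [] hs b = (hd q # hs, b \<or> closes n k q)"
| "rotations n k q (m # ms) hs b =
     (if m < dc_t n k \<and> uid_adj n k m (hd q) then rotations n k (rotation m q) ms (hd q # hs) (b \<or> closes n k q)
      else (hs, b))"

text \<open>The cycle is opened directly behind \<open>u\<close>, so that \<open>u\<close> becomes
  the last vertex, the one fixed by all rotations.\<close>

definition cut_at :: "nat \<Rightarrow> nat list \<Rightarrow> nat list" where
  "cut_at u c = tl (dropWhile (\<lambda>y. y \<noteq> u) c) @ takeWhile (\<lambda>y. y \<noteq> u) c @ [u]"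

fun chains :: "nat \<Rightarrow> nat \<Rightarrow> nat list list \<Rightarrow> nat \<Rightarrow> (nat \<times> nat list) list \<Rightarrow> nat list \<times> bool \<Rightarrow> nat list \<times> bool" where
  "chains n k cs u [] r = r"
| "chains n k cs u ((i, ms) # xs) r =
     chains n k cs u xs (if i < length cs then rotations n k (cut_at u (cs ! i)) ms (fst r) (snd r) else r)"

definition rotation_path :: "nat \<Rightarrow> nat \<Rightarrow> nat \<Rightarrow> nat list \<Rightarrow> bool" where
  "rotation_path n k u q \<longleftrightarrow> hamiltonian_path {..<dc_t n k} (uid_edges n k) (hd q) u q"

text \<open>For \<open>q = A @ m # B\<close> the rotated path is \<open>rev A @ m # B\<close>: the
  edge from \<open>last A\<close> to \<open>m\<close> is exchanged for the one from
  \<open>hd A\<close> to \<open>m\<close>.\<close>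

lemma rotation_path_rotation:
  assumes q: "rotation_path n k u q" and m: "m < dc_t n k" "uid_adj n k m (hd q)" "hd q \<noteq> m"
  shows "rotation_path n k u (rotation m q)"
proof -
  have q': "q \<noteq> []" "distinct q" "set q = {..<dc_t n k}" "is_path (uid_edges n k) q" "last q = u"
    using q by (auto simp: rotation_path_def hamiltonian_path_def)
  then obtain A B where AB: "q = A @ m # B" "m \<notin> set A" using m(1) split_list_first[of m q] by auto
  then have A: "A \<noteq> []" using m(3) by auto
  have r: "rotation m q = rev A @ m # B" using split_at_first[OF AB(2), of B] AB(1) by (simp add: rotation_def)
  have "hd q < dc_t n k" using q'(1,3) hd_in_set by blast
  then have "{m, hd q} \<in> uid_edges n k" using m unfolding uid_edges_def by blast
  then have "{hd A, m} \<in> uid_edges n k" using AB A by (simp add: insert_commute)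
  then have "is_path (uid_edges n k) (rotation m q)" using q'(4) AB A r by (simp add: is_path_append last_rev)
  moreover have "set (rotation m q) = {..<dc_t n k}" using q'(3) AB r by auto
  moreover have "distinct (rotation m q)" using q'(2) AB r by auto
  ultimately show ?thesis using q'(5) AB r by (simp add: rotation_path_def hamiltonian_path_def)
qed

lemma rotation_path_closes:
  assumes q: "rotation_path n k u q" and c: "closes n k q" and t: "4 \<le> dc_t n k"
  shows "hamiltonian ({..<dc_t n k} - {u}) (uid_edges n k)"
proof -
  have q': "q \<noteq> []" "distinct q" "set q = {..<dc_t n k}" "is_path (uid_edges n k) q" "last q = u"
    using q by (auto simp: rotation_path_def hamiltonian_path_def)
  define p where "p = butlast q"
  have qp: "q = p @ [u]" using q' by (metis append_butlast_last_id p_def)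
  have "length q = dc_t n k" using q'(2,3) distinct_card[of q] by simp
  then have p: "p \<noteq> []" using qp t by auto
  have sp: "set p = {..<dc_t n k} - {u}" "distinct p" using q'(2,3) qp by auto
  moreover have "is_path (uid_edges n k) p" using q'(4) qp p by (simp add: is_path_append)
  ultimately have "hamiltonian_path ({..<dc_t n k} - {u}) (uid_edges n k) (hd p) (last p) p"
    using p by (simp add: hamiltonian_path_def)
  then have "joins (uid_edges n k) ({..<dc_t n k} - {u}) (hd p) (last p)" unfolding joins_def by blast
  moreover have "{last p, hd p} \<in> uid_edges n k"
  proof -
    have "last p < dc_t n k" "hd p < dc_t n k" using sp(1) last_in_set[OF p] hd_in_set[OF p] by blast+
    moreover have "uid_adj n k (last p) (hd p)" using c qp p by (simp add: closes_def)
    ultimately show ?thesis unfolding uid_edges_def by blast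
  qed
  moreover have "u \<in> {..<dc_t n k}" unfolding q'(3)[symmetric] qp by simp
  then have "3 \<le> card ({..<dc_t n k} - {u})" using t by simp
  ultimately show ?thesis by (rule hamiltonianI)
qed

definition sound :: "nat \<Rightarrow> nat \<Rightarrow> nat \<Rightarrow> nat list \<times> bool \<Rightarrow> bool" where
  "sound n k u r \<longleftrightarrow> (\<forall>v\<in>set (fst r). joins (uid_edges n k) {..<dc_t n k} v u) \<and>
     (snd r \<longrightarrow> hamiltonian ({..<dc_t n k} - {u}) (uid_edges n k))"

lemma uid_adj_irrefl: "\<not> uid_adj n k x x"
  by (induction k arbitrary: x) auto

lemma sound_rotations:
  assumes "rotation_path n k u q" "sound n k u (hs, b)" "4 \<le> dc_t n k"
  shows "sound n k u (rotations n k q ms hs b)"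
  using assms
proof (induction ms arbitrary: q hs b)
  case Nil
  then show ?case
    using rotation_path_closes[OF Nil(1)] unfolding sound_def rotation_path_def joins_def by auto
next
  case (Cons m ms)
  have "sound n k u (hd q # hs, b \<or> closes n k q)"
    using Cons.prems rotation_path_closes[OF Cons.prems(1)] unfolding sound_def rotation_path_def joins_def by auto
  moreover have "rotation_path n k u (rotation m q)" if "m < dc_t n k" "uid_adj n k m (hd q)"
    by (rule rotation_path_rotation[OF Cons.prems(1) that]) (use that uid_adj_irrefl in auto)
  ultimately show ?case using Cons.IH Cons.prems(2,3) by simp
qed

lemma rotation_path_cut_at:
  assumes c: "hamiltonian_cycle {..<dc_t n k} (uid_edges n k) c" and u: "u < dc_t n k"
  shows "rotation_path n k u (cut_at u c)"
proof -
  have "u \<in> set c" using c u by (auto simp: hamiltonian_cycle_def)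
  then obtain A B where AB: "c = A @ u # B" "u \<notin> set A" using split_list_first by metis
  have "takeWhile (\<lambda>y. y \<noteq> u) c = A" "dropWhile (\<lambda>y. y \<noteq> u) c = u # B"
    using split_at_first[OF AB(2), of B] AB(1) by simp_all
  then have e: "cut_at u c = B @ (A @ [u])" by (simp add: cut_at_def)
  have "hamiltonian_cycle {..<dc_t n k} (uid_edges n k) (B @ (A @ [u]))"
    by (rule hamiltonian_cycle_rotate) (use c AB in simp)
  then show ?thesis unfolding rotation_path_def e by (simp add: hamiltonian_cycle_def hamiltonian_path_def)
qed

lemma hamiltonian_cycle_rev:
  "hamiltonian_cycle V E c \<Longrightarrow> hamiltonian_cycle V E (rev c)"
  by (auto simp: hamiltonian_cycle_def hd_rev last_rev insert_commute)

lemma sound_chains: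
  assumes "\<forall>c\<in>set cs. hamiltonian_cycle {..<dc_t n k} (uid_edges n k) c" "u < dc_t n k" "4 \<le> dc_t n k"
    and "sound n k u r"
  shows "sound n k u (chains n k cs u xs r)"
  using assms(4)
proof (induction xs arbitrary: r)
  case (Cons x xs)
  obtain i ms where x: "x = (i, ms)" by (cases x)
  have "sound n k u (rotations n k (cut_at u (cs ! i)) ms (fst r) (snd r))" if "i < length cs"
    by (rule sound_rotations[OF rotation_path_cut_at]) (use assms that Cons.prems in auto)
  then show ?case using Cons x by simp
qed simp

definition cyclic_pairs :: "nat list \<Rightarrow> (nat \<times> nat) list" where
  "cyclic_pairs c = zip c (tl c @ [hd c])"

text \<open>Guarantees a Hamiltonian cycle after deletion of any single edge: an edge off the first
  cycle is avoided by that cycle, and for each of its own edges some listed cycle avoids it.\<close>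

definition certificate :: "nat \<Rightarrow> nat \<Rightarrow> nat list list \<Rightarrow> bool" where
  "certificate n k cs \<longleftrightarrow> 4 \<le> dc_t n k \<and> cs \<noteq> [] \<and> list_all (adj_cycle n k) cs \<and>
     list_all (\<lambda>(x, y). list_ex (\<lambda>c. list_all (\<lambda>(a, b). (a, b) \<noteq> (x, y) \<and> (a, b) \<noteq> (y, x)) (cyclic_pairs c)) cs)
       (cyclic_pairs (hd cs))"

text \<open>Only partners \<open>v > u\<close> are required, since paths can be reversed. Indices
  from \<open>length cs\<close> on refer to the cycles traversed backwards.\<close>

definition chain_check :: "nat \<Rightarrow> nat \<Rightarrow> nat list list \<Rightarrow> nat \<Rightarrow> (nat \<times> nat list) list \<Rightarrow> bool" where
  "chain_check n k cs u xs \<longleftrightarrow> (let r = chains n k (cs @ map rev cs) u xs ([], False) in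
     snd r \<and> list_all (\<lambda>v. v \<in> set (fst r)) [Suc u..<dc_t n k])"

fun chain_checks :: "nat \<Rightarrow> nat \<Rightarrow> nat list list \<Rightarrow> nat \<Rightarrow> (nat \<times> nat list) list list \<Rightarrow> bool" where
  "chain_checks n k cs u [] \<longleftrightarrow> True"
| "chain_checks n k cs u (xs # xss) \<longleftrightarrow> chain_check n k cs u xs \<and> chain_checks n k cs (Suc u) xss"

lemma chain_checks_nth:
  "chain_checks n k cs u xss \<Longrightarrow> u \<le> v \<Longrightarrow> v < u + length xss \<Longrightarrow> \<exists>xs. chain_check n k cs v xs"
proof (induction xss arbitrary: u)
  case (Cons xs xss)
  then show ?case by (cases "v = u") auto
qed simp

lemma hamiltonian_cycle_avoids:
  assumes c: "hamiltonian_cycle V E c" and "\<forall>(a, b)\<in>set (cyclic_pairs c). {a, b} \<noteq> e"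
  shows "hamiltonian V (E - {e})"
proof -
  have ne: "c \<noteq> []" using c by (auto simp: hamiltonian_cycle_def)
  have p: "{c ! i, (tl c @ [hd c]) ! i} \<noteq> e" if "i < length c" for i
  proof -
    have "(c ! i, (tl c @ [hd c]) ! i) \<in> set (cyclic_pairs c)"
      unfolding cyclic_pairs_def set_zip using that ne by (intro CollectI exI[of _ i]) simp
    then show ?thesis using assms(2) by blast
  qed
  have "{c ! i, c ! Suc i} \<noteq> e" if "Suc i < length c" for i
  proof -
    have "(tl c @ [hd c]) ! i = c ! Suc i" using that by (cases c) (auto simp: nth_append)
    then show ?thesis using p[of i] that by simp
  qed
  then have "is_path (E - {e}) c" using c unfolding hamiltonian_cycle_def is_path_def by simp
  moreover have "{last c, hd c} \<noteq> e" using p[of "length c - 1"] ne by (simp add: last_conv_nth nth_append)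
  ultimately show ?thesis using c unfolding hamiltonian_def hamiltonian_cycle_def by auto
qed

text \<open>The rotations give all fault-free paths and, through the closing flag, the cycles after
  deletion of one vertex; the avoiding cycles cover one deleted edge.\<close>

lemma certificate_sound:
  assumes "certificate n k cs" and check: "\<And>u. u < dc_t n k \<Longrightarrow> \<exists>xs. chain_check n k cs u xs"
  shows "tolerantly_connected 0 (dc_verts n k) (dc_edges n k)"
    and "tolerantly_hamiltonian 1 (dc_verts n k) (dc_edges n k)"
proof -
  let ?N = "{..<dc_t n k}" and ?E = "uid_edges n k" and ?h = "dc_vert n k"
  have t: "4 \<le> dc_t n k" using assms(1) by (simp add: certificate_def)
  have cs: "\<forall>c\<in>set cs. hamiltonian_cycle ?N ?E c"
    using assms(1) hamiltonian_adj_cycle t by (auto simp: certificate_def list_all_iff)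
  then have cs': "\<forall>c\<in>set (cs @ map rev cs). hamiltonian_cycle ?N ?E c"
    using hamiltonian_cycle_rev by auto
  have u: "hamiltonian (?N - {u}) ?E \<and> (\<forall>v. u < v \<and> v < dc_t n k \<longrightarrow> joins ?E ?N v u)" if "u < dc_t n k" for u
  proof -
    obtain xs where xs: "chain_check n k cs u xs" using check \<open>u < dc_t n k\<close> by blast
    let ?r = "chains n k (cs @ map rev cs) u xs ([], False)"
    have "snd ?r \<and> (\<forall>v\<in>set [Suc u..<dc_t n k]. v \<in> set (fst ?r))"
      using xs unfolding chain_check_def list_all_iff Let_def by fast
    moreover have "sound n k u ?r" by (rule sound_chains[OF cs' that t]) (simp add: sound_def)
    ultimately show ?thesis unfolding sound_def by auto
  qed
  have avoid: "hamiltonian ?N (?E - {e})" for e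
  proof (cases "\<forall>(a, b)\<in>set (cyclic_pairs (hd cs)). {a, b} \<noteq> e")
    case True
    have "hd cs \<in> set cs" using assms(1) by (simp add: certificate_def)
    then show ?thesis using hamiltonian_cycle_avoids True cs by blast
  next
    case False
    then obtain x y where xy: "(x, y) \<in> set (cyclic_pairs (hd cs))" "e = {x, y}" by blast
    then obtain c where c: "c \<in> set cs" "\<forall>(a, b)\<in>set (cyclic_pairs c). (a, b) \<noteq> (x, y) \<and> (a, b) \<noteq> (y, x)"
      using assms(1) unfolding certificate_def list_all_iff list_ex_iff by fast
    then have "\<forall>(a, b)\<in>set (cyclic_pairs c). {a, b} \<noteq> e" using xy(2) by (auto simp: doubleton_eq_iff)
    then show ?thesis using hamiltonian_cycle_avoids cs c(1) by blast
  qed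
  have bij: "bij_betw ?h ?N (dc_verts n k)" by (rule dc_vert_bij)
  then have inj: "inj_on ?h ?N" and img: "?h ` ?N = dc_verts n k" by (auto simp: bij_betw_def)
  note edge = uid_edges_image[of _ _ n k]
  have fin: "finite X" if "X \<subseteq> dc_verts n k" for X using that finite_dc_verts finite_subset by blast
  show "tolerantly_connected 0 (dc_verts n k) (dc_edges n k)"
    unfolding tolerantly_connected_def
  proof (intro allI impI)
    fix X Y u' v'
    assume a: "X \<subseteq> dc_verts n k" "finite (Y :: nat list set set)" "card X + card Y \<le> 0"
      "u' \<in> dc_verts n k - X" "v' \<in> dc_verts n k - X" "u' \<noteq> v'"
    have XY: "X = {}" "Y = {}" using a(1-3) fin by auto
    have "u' \<in> ?h ` ?N" "v' \<in> ?h ` ?N" unfolding img using a(4,5) by simp_all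
    then obtain x y where xy: "x < dc_t n k" "y < dc_t n k" "u' = ?h x" "v' = ?h y" by auto
    have "joins ?E ?N x y"
    proof (cases "x < y")
      case True
      then show ?thesis using conjunct2[OF u[OF xy(1)]] xy(2) by (intro joins_rev[of _ _ y x]) simp
    next
      case False
      then have "y < x" using xy a(6) by (metis linorder_neqE_nat)
      then show ?thesis using conjunct2[OF u[OF xy(2)]] xy(1) by simp
    qed
    then have "joins (dc_edges n k) (?h ` ?N) (?h x) (?h y)"
      by (rule joins_image[OF _ inj]) (rule edge)
    then show "joins (dc_edges n k - Y) (dc_verts n k - X) u' v'" using XY xy img by simp
  qed
  show "tolerantly_hamiltonian 1 (dc_verts n k) (dc_edges n k)"
    unfolding tolerantly_hamiltonian_def
  proof (intro allI impI)
    fix X Y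
    assume a: "X \<subseteq> dc_verts n k" "finite (Y :: nat list set set)" "card X + card Y \<le> 1"
    show "hamiltonian (dc_verts n k - X) (dc_edges n k - Y)"
    proof (cases "X = {}")
      case True
      obtain e where Y: "Y \<subseteq> {e}"
        using a(2,3) card_le_Suc0_iff_eq[of Y] True by (cases "Y = {}") auto
      have "hamiltonian (?h ` ?N) (dc_edges n k - {e})"
      proof (rule hamiltonian_image[OF avoid inj])
        \<comment> \<open>The faulty edge is pulled back to the set of identifiers whose labels lie
          in \<open>e\<close>; by injectivity it equals \<open>{x, y}\<close> as soon as the image
          of this pair is \<open>e\<close>.\<close>
        fix x y assume xy: "{x, y} \<in> ?E - {{z \<in> ?N. ?h z \<in> e}}" "x \<in> ?N" "y \<in> ?N"
        have "{?h x, ?h y} \<noteq> e"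
        proof
          assume "{?h x, ?h y} = e"
          then have "{z \<in> ?N. ?h z \<in> e} = {x, y}" using inj_on_eq_iff[OF inj] xy(2,3) by auto
          then show False using xy(1) by auto
        qed
        then show "{?h x, ?h y} \<in> dc_edges n k - {e}" using edge xy(1) by blast
      qed
      then have "hamiltonian (?h ` ?N) (dc_edges n k - Y)"
        by (rule hamiltonian_mono) (use Y in blast)
      then show ?thesis using True img by simp
    next
      case False
      have "1 \<le> card X" using False fin[OF a(1)] by (simp add: Suc_le_eq card_gt_0_iff)
      then have "card X = 1" "card Y = 0" using a(3) by linarith+
      then have "card X = 1" "Y = {}" using a(2) by simp_all
      then obtain w where w: "X = {w}" using card_1_singletonE by blast
      then have "w \<in> ?h ` ?N" unfolding img using a(1) by simp
      then obtain x where x: "x < dc_t n k" "w = ?h x" by auto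
      have "hamiltonian (?h ` (?N - {x})) (dc_edges n k)"
        by (rule hamiltonian_image[of _ ?E]) (use u[OF x(1)] inj edge in \<open>auto intro: inj_on_subset\<close>)
      moreover have "?h ` (?N - {x}) = dc_verts n k - X"
        using w x img inj_on_image_set_diff[OF inj, of ?N "{x}"] by auto
      ultimately show ?thesis using \<open>Y = {}\<close> by simp
    qed
  qed
qed

section \<open>Certificates for DCell_1 with n = 3 and DCell_2 with n = 2\<close>

text \<open>The cycles and the rotation sequences were found by a computer search.\<close>

definition cycles_31 :: "nat list list" where
  "cycles_31 =
    [[8,11,10,9,2,1,0,3,5,4,7,6],[11,9,10,5,4,3,0,2,1,6,7,8],[7,4,3,5,10,11,9,2,0,1,6,8]]"

lemma certificate_31: "certificate 3 1 cycles_31"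
  by code_simp

lemma chains_31_0:
  "chain_checks 3 1 cycles_31 0
    [[(3,[6,7,8,9,5,3,4,6,11,10,9,0])],[(4,[9,11,10,3,7,6,8,9,5,4,3,1])],[(5,[10,8,6,7,5,0,2,1,8,4,3,5])],[(4,[7,
    6,8,10,2,0,1,7,11,9,10])],[(0,[4,10,11,9,0,6,7,8])],[(1,[5,11,11,5,7,8,6,0,9,10,11])]]"
  by code_simp

lemma chains_31_6:
  "chain_checks 3 1 cycles_31 6
    [[(3,[8,9,9,8,6,7,3,10])],[(5,[11,10,9,1,3,4,5])],[(0,[9,5,4,3,2]),(1,[10])],[(1,[9])],[(3,[])],[(5,[])]]"
  by code_simp

lemma chains_31:
  assumes "u < 12"
  shows "\<exists>xs. chain_check 3 1 cycles_31 u xs"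
proof -
  consider "u < 6" | "6 \<le> u" "u < 12"
    using assms by linarith
  then show ?thesis
    by cases (use chain_checks_nth[OF chains_31_0, of u]
      chain_checks_nth[OF chains_31_6, of u] in simp_all)
qed

definition cycles_22 :: "nat list list" where
  "cycles_22 =
    [[26,27,21,23,22,33,35,34,31,10,7,6,8,19,18,20,14,15,17,38,39,41,40,29,28,25,9,11,37,36,5,4,30,32,16,13,12,1,
    0,2,3,24],[13,16,17,15,26,27,29,40,37,36,38,39,41,35,33,32,30,31,34,28,25,24,3,5,4,1,12,14,20,21,23,22,19,18,
    2,0,6,8,9,11,10,7],[1,4,30,31,10,11,37,40,41,39,38,36,5,3,2,18,20,21,23,22,19,8,9,25,24,26,27,29,28,34,35,33,
    32,16,17,15,14,12,13,7,6,0],[0,6,7,13,16,17,38,39,23,22,33,32,30,4,1,12,14,15,26,24,25,28,29,27,21,20,18,19,8,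
    9,11,10,31,34,35,41,40,37,36,5,3,2],[30,32,16,13,7,6,8,9,25,28,34,31,10,11,37,40,29,27,21,23,39,41,35,33,22,
    19,18,20,14,12,1,0,2,3,24,26,15,17,38,36,5,4],[41,35,33,22,19,8,9,25,24,26,15,17,16,32,30,4,1,0,6,7,13,12,14,
    20,18,2,3,5,36,38,39,23,21,27,29,28,34,31,10,11,37,40],[16,17,15,14,20,21,23,22,19,18,2,3,24,26,27,29,28,25,9,
    8,6,0,1,12,13,7,10,11,37,40,41,39,38,36,5,4,30,31,34,35,33,32],[4,30,32,16,17,38,36,5,3,24,26,15,14,20,18,2,0,
    6,8,19,22,33,35,41,39,23,21,27,29,40,37,11,9,25,28,34,31,10,7,13,12,1],[21,23,22,33,35,34,31,10,11,9,25,28,29,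
    27,26,24,3,2,0,1,12,14,15,17,38,39,41,40,37,36,5,4,30,32,16,13,7,6,8,19,18,20],[19,18,2,3,24,26,27,29,28,25,9,
    11,37,40,41,39,38,36,5,4,30,32,16,17,15,14,20,21,23,22,33,35,34,31,10,7,13,12,1,0,6,8],[7,13,16,17,15,26,27,
    29,40,41,39,38,36,37,11,9,8,6,0,2,18,19,22,23,21,20,14,12,1,4,5,3,24,25,28,34,35,33,32,30,31,10],[12,1,0,2,18,
    19,22,33,35,41,40,29,27,26,24,3,5,4,30,32,16,17,15,14,20,21,23,39,38,36,37,11,10,31,34,28,25,9,8,6,7,13],[19,
    8,6,0,2,18,20,21,27,26,15,14,12,1,4,5,3,24,25,9,11,10,7,13,16,17,38,36,37,40,29,28,34,31,30,32,33,35,41,39,23,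
    22],[22,33,32,30,4,5,36,38,39,23,21,27,29,28,25,9,11,37,40,41,35,34,31,10,7,13,16,17,15,26,24,3,2,18,20,14,12,
    1,0,6,8,19],[20,14,15,17,16,13,12,1,0,2,18,19,8,6,7,10,31,34,35,41,40,29,28,25,9,11,37,36,38,39,23,22,33,32,
    30,4,5,3,24,26,27,21],[4,1,12,13,7,10,11,37,36,5,3,24,26,15,14,20,21,27,29,40,41,35,33,32,16,17,38,39,23,22,
    19,18,2,0,6,8,9,25,28,34,31,30],[19,22,33,35,34,31,30,32,16,13,7,10,11,9,25,28,29,27,26,24,3,5,4,1,12,14,15,
    17,38,36,37,40,41,39,23,21,20,18,2,0,6,8],[32,16,13,7,10,31,30,4,5,36,37,11,9,25,28,34,35,41,40,29,27,21,23,
    39,38,17,15,26,24,3,2,18,20,14,12,1,0,6,8,19,22,33],[38,36,37,40,29,28,34,31,30,32,16,13,12,14,20,18,2,0,1,4,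
    5,3,24,25,9,11,10,7,6,8,19,22,33,35,41,39,23,21,27,26,15,17],[7,13,16,17,38,39,41,40,37,36,5,3,24,25,28,29,27,
    26,15,14,12,1,4,30,32,33,35,34,31,10,11,9,8,19,22,23,21,20,18,2,0,6],[19,8,6,0,2,18,20,14,12,1,4,30,32,33,35,
    34,31,10,7,13,16,17,15,26,24,3,5,36,38,39,41,40,37,11,9,25,28,29,27,21,23,22],[4,30,31,34,28,25,24,3,2,18,19,
    22,23,21,20,14,12,1,0,6,8,9,11,10,7,13,16,32,33,35,41,39,38,17,15,26,27,29,40,37,36,5],[18,19,8,6,0,2,3,24,26,
    15,17,16,13,7,10,31,30,32,33,22,23,21,27,29,40,37,11,9,25,28,34,35,41,39,38,36,5,4,1,12,14,20],[30,32,16,13,7,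
    6,0,2,18,20,21,23,39,41,40,37,11,10,31,34,35,33,22,19,8,9,25,28,29,27,26,24,3,5,36,38,17,15,14,12,1,4],[38,36,
    37,11,10,31,30,32,16,13,7,6,0,2,18,19,8,9,25,28,34,35,33,22,23,39,41,40,29,27,21,20,14,12,1,4,5,3,24,26,15,
    17],[4,30,32,16,13,12,14,15,17,38,36,5,3,2,18,20,21,23,39,41,35,33,22,19,8,9,11,37,40,29,27,26,24,25,28,34,31,
    10,7,6,0,1],[41,39,23,21,27,29,28,25,9,8,19,22,33,35,34,31,30,32,16,13,12,14,20,18,2,3,24,26,15,17,38,36,5,4,
    1,0,6,7,10,11,37,40],[39,23,22,33,32,16,17,38,36,5,4,30,31,10,7,13,12,1,0,6,8,19,18,2,3,24,26,15,14,20,21,27,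
    29,40,37,11,9,25,28,34,35,41],[21,23,39,38,17,15,14,12,1,0,6,8,19,22,33,32,16,13,7,10,31,30,4,5,36,37,11,9,25,
    28,34,35,41,40,29,27,26,24,3,2,18,20],[27,29,28,25,9,11,37,40,41,39,38,36,5,3,24,26,15,17,16,13,7,10,31,34,35,
    33,32,30,4,1,12,14,20,18,2,0,6,8,19,22,23,21],[5,36,38,39,41,35,33,32,30,4,1,0,2,18,19,22,23,21,20,14,12,13,
    16,17,15,26,27,29,40,37,11,9,8,6,7,10,31,34,28,25,24,3],[39,41,35,33,22,19,18,20,14,12,13,16,32,30,31,34,28,
    29,40,37,11,10,7,6,8,9,25,24,3,2,0,1,4,5,36,38,17,15,26,27,21,23],[15,17,16,32,30,31,34,28,29,27,21,23,39,38,
    36,37,40,41,35,33,22,19,8,6,0,1,4,5,3,2,18,20,14,12,13,7,10,11,9,25,24,26],[41,39,38,36,37,11,9,8,6,7,10,31,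
    34,35,33,32,30,4,5,3,2,0,1,12,13,16,17,15,14,20,18,19,22,23,21,27,26,24,25,28,29,40],[28,34,35,41,39,23,21,20,
    14,12,1,0,6,8,9,11,37,40,29,27,26,15,17,38,36,5,4,30,31,10,7,13,16,32,33,22,19,18,2,3,24,25]]"

lemma certificate_22: "certificate 2 2 cycles_22"
  by code_simp

lemma chains_22_0:
  "chain_checks 2 2 cycles_22 0
    [[(34,[0,4,32,17,39,22,8,25,29,21,39,17,14,18,0,7,12,0,18,22,35,40,27,23,38,15,20,27,40,36,17,14,1,30,34,41,
    37,10,13,32,22,39,36,3]),(69,[0,7]),(67,[0,12,15]),(38,[0,8,22,35]),(31,[12,15,24,28,27,20,2,5,30]),(15,[0,3,
    25,29,37,38,41,34,10,6,19,20,23])],[(67,[2,19,23,41,29,26,14,1,30,33,34,25,3,18,22,35,28,27,20,19,9,24]),(68,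
    [6,13,32,31,28,9,10,34,41,37,5,24,28,35,40,27,15,12]),(27,[1,14,18,0,7,11]),(43,[1,13,17,36]),(20,[5,2,1,13,
    32,22,39,35,28,40,36]),(53,[6,9,37,41,38])],[(53,[19,23,38,16,33,34,25,8,0,12,7,31,28,27,20,2,1,30,16,12,4,36,
    17,14,18,22,35,40,11,7,8,25,26,21]),(33,[6,6,2,24,9,10,13,32,31,28,27,15,12,16,30,1,13,10]),(22,[5]),(32,[19,
    23,41])],[(42,[4,31,11,8,18,3,25,29,41,38,15,12,16,33,23,41,34,10,9,28,31,4,0,7,11,36,17,32,22,39,36,11,25,3,
    18,21,22,32,17,39,35,28]),(0,[25,34,30,1]),(9,[25,34,41,23,27,15,38,37,29,26,17,13,6,2]),(6,[25,34,10,9])],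
    [(56,[4,32,17,36,11,31,35,22,39,40,28,9,10,6,19,20,15,38,41,29,25,26,21,22,18,14,17,32,4,3,25]),(14,[36,40,27,
    23,41,29,34,33,19,20,12,7]),(19,[31,28,9,6,1,13,32,4,12,16,30]),(43,[4,31,28,24,15,20,2,5])],[(53,[30,33,34,
    25,8,0,3,26,14,1,2,19,23,38,5,24,15,16,7,31,28,9,37]),(62,[37,10,6,2,20,12,4,32,35,40,11,7,0,18]),(32,[5,30,
    10,37,29]),(2,[24,28,40,36,17]),(35,[38,23,19]),(1,[30,16,38,5,2,20]),(38,[5,24,27,40,39]),(36,[2,1,13,32,
    22])]]"
  by code_simp

lemma chains_22_6:
  "chain_checks 2 2 cycles_22 6
    [[(6,[2,20,27,15,38,37,29,26,17,13,6,19,2,5,1,14,21,39,35]),(14,[13,32,31,28,27,23]),(43,[10,37,29,21,39,35,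
    28]),(46,[19,23,27,15,38,41,34,30]),(44,[2,5,37,29]),(17,[6,2,19,23,20,15,27,28,31,32,17,36,3,18,14,26,25,8]),
    (68,[19,33,16,7,11])],[(40,[7,16,38,41,29,25,11,36,39,40,28,9,37,29,26,14]),(6,[31,32,22,39,17,13,14,18]),(27,
    [16]),(49,[0,3]),(44,[7,16,33,19,9,24,15]),(26,[31,28,24,5]),(12,[12,20,23,33,34]),(10,[12,15,24,2])],[(62,[7,
    16,15,12,7,8,22,35,40,36,3,25,8,7,11,40,28,31,32,17,14,18,8,25,34,41]),(6,[7,16,30,10,9,24]),(47,[8,7,31,35,
    22,21,14,17,39,40,27,20,19]),(30,[0,12,15,38]),(42,[8,18,21]),(37,[18,14]),(44,[7,16,38])],[(17,[9,10,34,33,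
    23,41,37,9,24,5,38,16,30,1,13,32,4,12,15,27,28,35,22,39,17,26,29,34,10,6,2,19,23,20,12]),(53,[28,35,40,11]),
    (55,[10,6,1,13,32,22,18]),(51,[37,29,21,14,26])],[(14,[30,16,38,5,1,14,26,29,34,33,30,10,13,17,36,4,31,35,32,
    13,10,34,29,37,5,2,6,9,24,27,23]),(0,[13,17,36,40,27,15,12]),(62,[10,6,2,20,12,4,3,25,8,22]),(18,[10,37,41]),
    (8,[37,29,21]),(65,[13,32,31,35])],[(69,[11,36,39,40,11,25,29,37,38,41,33,30,34,25,26,14,13,6,19,20,12,7,8]),
    (30,[25,29,21,18,8,11,36,17,32]),(66,[36,39,22]),(12,[31]),(17,[11,40,40,11,8,7,12,15,27]),(35,[11,40,35,28,
    27,15,16,33]),(15,[40,28])]]"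
  by code_simp

lemma chains_22_12:
  "chain_checks 2 2 cycles_22 12
    [[(9,[12,16,38,37,29,34,30,33,41,23,27,28,31,32,17,36,3,25,34,33,19,20,12,4,36,40,39,21,14]),(37,[20,27]),(11,
    [4,36,17,26,21,22]),(26,[12,7,31,28]),(41,[4,32])],[(14,[13,32,31,28,27,23,19,9,24,15,12,4,36,40,28,31,11,25,
    34,10,9,19,20,27,40,39,17,14,21,22,35,31,11,8,18,3,26]),(7,[13,6,9,10,30,33,34,29,41,38]),(37,[1,5])],[(54,
    [17,36,11,25,34,30,16,38,37,29,21,14,13,17,36,4,32,22]),(23,[14,26,25,34]),(53,[14,21,22,32,4]),(29,[21,39,35,
    28]),(33,[21,39,35,28]),(61,[14,21,22]),(21,[13,6,19,20,27]),(34,[13,6,19,23])],[(11,[15,38,5,2,20,27,15,12,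
    16,33,34,29,26]),(41,[38,37,29,34,10,9,19,20,27,28,31,32,13,6,2,5,1,14,21,39,35,22]),(42,[27,28,28,27,15,12,
    16,33,23]),(35,[12,4,31,11]),(20,[27,40,36])],[(27,[16,30,34,29,41,33,19,20,12,4,31,28,40,36,3,0,7,16,15,27,
    23,38]),(1,[16,12,15,24]),(46,[33,34,29,21,22]),(65,[7,11,25,26,21]),(18,[7,31,35,40,11,8,0,3,36,39,22])],
    [(65,[32,31,35,40,36,4,12,15,24,2,6,19,20,27,28]),(11,[26,21,22,8,0,4,36]),(16,[17,26,25,34,10,6,9,28,40,35]),
    (28,[26,21]),(0,[17,26,29,34,30,33,41,37,38]),(8,[17,26,25,34,30,33])]]"
  by code_simp

lemma chains_22_18:
  "chain_checks 2 2 cycles_22 18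
    [[(44,[22,32,13,14,18,0,4,31,28,24,15,38,37,29,25,8,7,11,40,28,9,37,38,23,33,41,29,21]),(25,[14,1,5,37,10,
    30]),(59,[3,3,18,22,32,4,36,39]),(0,[21,29,34,41,23]),(67,[18,21,26,14,1])],[(15,[19,33,30,5,38,41,34,10,9,24,
    27]),(69,[23,27,28,31,11,25]),(64,[9,10,6,1,13,32,22,39,17,14,21]),(32,[19,23,41]),(60,[19,6,13,17,26,3,4,31,
    11]),(8,[2,5,38,23,27,40])],[(36,[20,27,24,9,19,20,15,27,28,35,22,39,17,32,4,36,39,40,11,8,18,3,25,34,33]),
    (17,[20,19]),(59,[23,38]),(40,[15,38,41]),(37,[19,6,10]),(28,[27,28,31,32,17,26])],[(66,[29,41,34,34,41,29,21,
    22,32,17,39,40,27,24,5,30,16,38]),(16,[21,22,32]),(33,[29,29,21,39,17,32,31]),(48,[22,35,28,24,5,37,29,25,3,0,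
    4,36]),(67,[26,14,1,30,33])],[(27,[22,21,26,17,39,40,36,3,0,7,16,38,41,33,30,34,29,37,5,2,6,9,24,15,12,7,8,
    25]),(4,[22,32,17,39,40,28]),(63,[22,35,31])],[(3,[23,41,29,26]),(62,[38,37,41,33,30,34,29,37,38,15,12,4]),
    (21,[27,24]),(6,[23,27,40,36]),(4,[23,20,15,27,28,35]),(67,[20,15,27,40])]]"
  by code_simp

lemma chains_22_24:
  "chain_checks 2 2 cycles_22 24
    [[(18,[28,27,24,2,6,13,17,39,22,32,4,36,11,8,7,31,35,40,36,4,12,16,30,34,29]),(38,[27,23,41]),(41,[24,15,38]),
    (15,[27,23,41])],[(13,[25,34,30,16,38,37]),(6,[25,34,41,41,34,25,11,31,32,22,39]),(11,[11,40,28,28,40,11,25,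
    29]),(34,[29,41,38,16,12,15]),(62,[8,22,35])],[(45,[26,21,39,17,32,4,36,40,35]),(31,[29,25,11,31,4,12,15,16,
    33,34]),(56,[26,21,39,40,28]),(49,[26,29]),(50,[25,29,37,38])],[(2,[40,36,17,13,1,2,24,28,31]),(35,[15,16,33,
    41]),(33,[15,38]),(52,[27,20,19,9,10,34,29]),(36,[27,28,35]),(32,[27,40])],[(65,[35,22,8,25,26,14,1,5,37,41]),
    (21,[28,35,40,28,9,19,33,30,10,37,38]),(2,[31]),(22,[31,11,36])],[(25,[29,41,34,30,5]),(52,[37,10,34,33]),(6,
    [29,21,39]),(34,[29,41,38,37,29,21,22,35,31,32,17,36,40])]]"
  by code_simp

lemma chains_22_30:
  "chain_checks 2 2 cycles_22 30
    [[(48,[16,38,41,29,34]),(47,[10,6,1,13,32]),(63,[30,1,13,17,36,40]),(20,[30,5]),(32,[10,6,2,24,28])],[(63,[31,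
    32,35]),(23,[28,24,15,16,33,41]),(32,[35,39,17,14,1,30,33,41,38]),(36,[31,35,40]),(37,[31,7,16,38,37])],[(52,
    [35,35,32,17,36]),(5,[31]),(35,[32,17,26,29,37,10]),(16,[17,26,25,34,41,38])],[(20,[41,41,33,16,38,37]),(19,
    [41,23,27,40]),(39,[33,23,20,15,27,28,35]),(8,[41,23,27,40,39])],[(63,[34,33,23,41,37]),(8,[30,1,13,17,36]),
    (46,[30,33,34,29,21,22,35])],[(30,[35,40,36,4,12,15,38]),(49,[35,39,17,26,29]),(57,[35,40,28,24,5,30]),(8,[28,
    24,15,20,2,5])]]"
  by code_simp

lemma chains_22_36:
  "chain_checks 2 2 cycles_22 36
    [[(4,[36,39]),(18,[]),(44,[36,3,0,7,16,38]),(14,[17,26,29])],[(4,[41]),(38,[29,26,3,18,14,17,36,4,0,8,22,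
    35])],[(67,[41,34,10,37]),(27,[38,15,12,4,32,35,40])],[(47,[]),(7,[22,18,3,25,29])],[(14,[40,39,21])],[(38,
    [33,16,15,27])]]"
  by code_simp

lemma chains_22:
  assumes "u < 42"
  shows "\<exists>xs. chain_check 2 2 cycles_22 u xs"
proof -
  consider "u < 6" | "6 \<le> u" "u < 12" | "12 \<le> u" "u < 18" | "18 \<le> u" "u < 24" | "24 \<le> u" "u < 30" | "30 \<le> u" "u < 36" | "36 \<le> u" "u < 42"
    using assms by linarith
  then show ?thesis
    by cases (use chain_checks_nth[OF chains_22_0, of u]
      chain_checks_nth[OF chains_22_6, of u]
      chain_checks_nth[OF chains_22_12, of u]
      chain_checks_nth[OF chains_22_18, of u]
      chain_checks_nth[OF chains_22_24, of u]
      chain_checks_nth[OF chains_22_30, of u]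
      chain_checks_nth[OF chains_22_36, of u] in simp_all)
qed

lemma dc_t_small: "dc_t 3 1 = 12" "dc_t 2 2 = 42" "dc_t 2 1 = 6"
  by code_simp+

lemma dcell_3_1:
  "tolerantly_connected 0 (dc_verts 3 1) (dc_edges 3 1)" "tolerantly_hamiltonian 1 (dc_verts 3 1) (dc_edges 3 1)"
  using certificate_sound[OF certificate_31] chains_31 unfolding dc_t_small by blast+

lemma dcell_2_2:
  "tolerantly_connected 0 (dc_verts 2 2) (dc_edges 2 2)" "tolerantly_hamiltonian 1 (dc_verts 2 2) (dc_edges 2 2)"
  using certificate_sound[OF certificate_22] chains_22 unfolding dc_t_small by blast+

lemma complete_dcell:
  "a \<in> dc_verts n 0 \<Longrightarrow> b \<in> dc_verts n 0 \<Longrightarrow> a \<noteq> b \<Longrightarrow> {a, b} \<in> dc_edges n 0"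
  by auto

section \<open>The induction and the small cases\<close>

lemma dcell_tolerant:
  assumes n: "2 \<le> n" and nk: "4 \<le> n + k"
  shows "tolerantly_connected (n + k - 4) (dc_verts n k) (dc_edges n k) \<and>
    tolerantly_hamiltonian (n + k - 3) (dc_verts n k) (dc_edges n k)"
  using nk
proof (induction k)
  case 0
  have "card (dc_verts n 0) = n" using card_dc_verts[of n 0] by simp
  then show ?case
    using 0 complete_joins[OF finite_dc_verts[of n 0], of _ _ _ _ "dc_edges n 0"]
      complete_hamiltonian[OF finite_dc_verts[of n 0], of _ _ "dc_edges n 0"] complete_dcell
    unfolding tolerantly_connected_def tolerantly_hamiltonian_def by simp
next
  case (Suc k)
  show ?case
  proof (cases "4 \<le> n + k")
    case True
    define f where "f = n + k - 4"
    have f: "n + k - 4 = f" "n + k - 3 = f + 1" "n + Suc k - 4 = f + 1" "n + Suc k - 3 = f + 2" "f + 4 = n + k"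
      using True by (auto simp: f_def)
    have conn: "tolerantly_connected f (dc_verts n k) (dc_edges n k)"
      and ham: "tolerantly_hamiltonian (f + 1) (dc_verts n k) (dc_edges n k)"
      using Suc.IH[OF True] unfolding f by auto
    have t: "f + 4 \<le> dc_t n k" using dc_t_ge[OF n, of k] f by simp
    let ?V = "dc_verts n k" and ?E = "dc_edges n k"
    have "f + 7 \<le> dc_t n k \<or> (\<forall>w\<in>?V. \<forall>u\<in>?V - {w}. \<forall>v\<in>?V - {w}. u \<noteq> v \<longrightarrow> joins ?E (?V - {w}) u v)"
    proof (cases "f = 0")
      case False
      have "joins (?E - {}) (?V - {w}) u v" if "w \<in> ?V" "u \<in> ?V - {w}" "v \<in> ?V - {w}" "u \<noteq> v" for w u v
      proof -
        have "{w} \<subseteq> ?V" "finite {}" "card {w} + card {} \<le> f" using that(1) False by simp_all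
        then show ?thesis using conn that(2-4) unfolding tolerantly_connected_def by blast
      qed
      then show ?thesis by simp
    next
      case True
      \<comment> \<open>For \<open>f = 0\<close> the cells with 12 and 42 vertices satisfy the first
        alternative. In K_4 the deletion of a vertex leaves a triangle, which is
        Hamiltonian-connected.\<close>
      then have "n = 4 \<and> k = 0 \<or> n = 3 \<and> k = 1 \<or> n = 2 \<and> k = 2" using f n by auto
      moreover have "joins ?E (?V - {w}) u v" if "k = 0" "u \<in> ?V - {w}" "v \<in> ?V - {w}" "u \<noteq> v" for w u v
      proof -
        have "joins (- {}) (?V - {w}) u v"
          using that finite_dc_verts by (intro joins_free) (auto simp: induced_def)
        then show ?thesis by (rule joins_mono_edges) (use complete_dcell that(1) in blast)
      qed
      moreover have "7 \<le> dc_t 3 1" "7 \<le> dc_t 2 2" unfolding dc_t_small by simp_all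
      ultimately show ?thesis using True by (metis add_0)
    qed
    then show ?thesis unfolding f using dcell_step[OF conn ham t] by blast
  next
    case False
    then consider "n = 3" "Suc k = 1" | "n = 2" "Suc k = 2" using Suc.prems n by force
    then show ?thesis
    proof cases
      case 1
      then show ?thesis using dcell_3_1 by (simp only: One_nat_def) simp
    next
      case 2
      then show ?thesis using dcell_2_2 by (simp only: numeral_2_eq_2) simp
    qed
  qed
qed

text \<open>This graph is a cycle of length 6; the list runs around it. It settles
  \<open>n + k = 3\<close> with \<open>k = 1\<close>, where no fault is allowed.\<close>

lemma hamiltonian_dcell_2_1: "hamiltonian (dc_verts 2 1) (dc_edges 2 1)"
proof -
  have "adj_cycle 2 1 [0, 1, 4, 5, 3, 2]" by code_simp
  then have "hamiltonian {..<dc_t 2 1} (uid_edges 2 1)"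
    using hamiltonian_adj_cycle[of 2 1] unfolding hamiltonian_def by fastforce
  then have "hamiltonian (dc_vert 2 1 ` {..<dc_t 2 1}) (dc_edges 2 1)"
    by (rule hamiltonian_uid_image)
  then show ?thesis using dc_vert_bij[of 2 1] by (simp add: bij_betw_def)
qed

theorem theorem3:
  fixes n k :: nat
  assumes "n \<ge> 2"
  shows "fault_hamiltonian_connected (int n + int k - 4) (dc_verts n k) (dc_edges n k)
       \<and> fault_hamiltonian (int n + int k - 3) (dc_verts n k) (dc_edges n k)"
proof (cases "4 \<le> n + k")
  case True
  have "int n + int k - 4 = int (n + k - 4)" "int n + int k - 3 = int (n + k - 3)" using True by auto
  then show ?thesis
    using dcell_tolerant[OF assms True] fault_hamiltonian_connectedI fault_hamiltonianI finite_dc_edges by metis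
next
  case False
  have conn: "fault_hamiltonian_connected (int n + int k - 4) (dc_verts n k) (dc_edges n k)"
    by (rule fault_vacuous) (use False in simp)
  \<comment> \<open>Here the bound for Hamiltonian-connectedness is negative. The bound for
    Hamiltonicity is -1 for K_2, and 0 for the triangle and the cycle of length 6.\<close>
  consider "n = 2" "k = 0" | "n = 3" "k = 0" | "n = 2" "k = 1" using False assms by force
  then show ?thesis
  proof cases
    case 1
    then have "fault_hamiltonian (int n + int k - 3) (dc_verts n k) (dc_edges n k)"
      by (intro fault_vacuous(1)) simp
    then show ?thesis using conn by simp
  next
    case 2
    have th: "tolerantly_hamiltonian 0 (dc_verts 3 0) (dc_edges 3 0)"
      using complete_hamiltonian[OF finite_dc_verts[of 3 0], of _ _ "dc_edges 3 0"] complete_dcell card_dc_verts[of 3 0]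
      unfolding tolerantly_hamiltonian_def by simp
    then show ?thesis using conn 2 fault_hamiltonianI[OF th finite_dc_edges] by simp
  next
    case 3
    have th: "tolerantly_hamiltonian 0 (dc_verts 2 1) (dc_edges 2 1)"
      unfolding tolerantly_hamiltonian_def
      using hamiltonian_dcell_2_1 finite_subset[OF _ finite_dc_verts[of 2 1]] by auto
    then show ?thesis using conn 3 fault_hamiltonianI[OF th finite_dc_edges] by simp
  qed
qed

end
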